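(* Let $G$ be a second countable principal locally compact Hausdorff groupoid admitting a Haar system, and let $H$ be a second countable locally compact Hausdorff groupoid with open range and source maps that is equivalent to $G$. If $G$ is integrable, then $H$ admits a Haar system and $H$ is integrable.
   Context: Groupoids are topological groupoids with open range and source maps (automatic in the presence of a Haar system). $G^{(0)}$ is the unit space of $G$, and $r,s:G\to G^{(0)}$ are the range and source maps. Actions: a left action of $G$ on a space $P$ consists of a continuous moment map $r_P:P\to G^{(0)}$ and a continuous map $(\gamma,p)\mapsto\gamma\cdot p$ from $G*P=\{(\gamma,p): s(\gamma)=r_P(p)\}$ to $P$ with $r_P(\gamma\cdot p)=r(\gamma)$, $r_P(p)\cdot p=p$ and $\gamma\cdot(\eta\cdot p)=(\gamma\eta)\cdot p$ for composable $\gamma,\eta$. The action is free if $\gamma\cdot p=p$ only when $\gamma=r_P(p)$. It is proper if the map $\Theta:G*P\to P\times P$, $\Theta(\gamma,p)=(\gamma\cdot p,p)$, is proper (preimages of compact sets are compact). Right actions are defined similarly, with moment map $s_P$. Equivalence: $G$ and $H$ are equivalent if there is a $(G,H)$-equivalence, i.e. a locally compact Hausdorff space $Z$ such that: (E1) $Z$ is a free and proper left $G$-space; (E2) $Z$ is a free and proper right $H$-space; (E3) the two actions commute; (E4) the moment map $r_Z:Z\to G^{(0)}$ is open and induces a homeomorphism $Z/H\to G^{(0)}$; (E5) the moment map $s_Z:Z\to H^{(0)}$ is open and induces a homeomorphism $G\backslash Z\to H^{(0)}$. $G$ is principal if the action of $G$ on $G^{(0)}$ given by $\gamma\cdot s(\gamma)=r(\gamma)$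 is free, i.e. every isotropy group $G(u)=\{\gamma: r(\gamma)=u=s(\gamma)\}$ is trivial. A Haar system on $G$ is a family $\lambda=\{\lambda^u\}_{u\in G^{(0)}}$ of Radon measures on $G$ with $\operatorname{supp}\lambda^u=r^{-1}(u)$, such that $u\mapsto\int f\,d\lambda^u$ is continuous for $f\in C_c(G)$, and left invariant: $\int f(\gamma\eta)\,d\lambda^{s(\gamma)}(\eta)=\int f(\eta)\,d\lambda^{r(\gamma)}(\eta)$ for $f\in C_c(G)$, $\gamma\in G$. A groupoid with Haar system $(G,\lambda)$ is integrable if for every compact set $N\subset G^{(0)}$, $\sup_{u\in N}\lambda^u(s^{-1}(N))<\infty$. For a second countable principal groupoid this condition holds for some Haar system if and only if it holds for every Haar system, so the Haar system is not mentioned; groupoids equivalent to principal groupoids are principal. *)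

theory Defs
  imports "HOL-Analysis.Analysis"
begin

section \<open>Topological groupoids\<close>

text \<open>
  The unit space is identified with the set of identity arrows, so that range and source are
  idempotent maps of the arrow space. The value of \<open>mul x y\<close> is only meaningful when
  \<open>src x = rng y\<close>.
\<close>

record 'g groupoid =
  arr_top :: "'g topology"
  rng :: "'g \<Rightarrow> 'g"
  src :: "'g \<Rightarrow> 'g"
  mul :: "'g \<Rightarrow> 'g \<Rightarrow> 'g"
  gpd_inv :: "'g \<Rightarrow> 'g"

abbreviation arrows :: "'g groupoid \<Rightarrow> 'g set" where
  "arrows G \<equiv> topspace (arr_top G)"

definition units :: "'g groupoid \<Rightarrow> 'g set" where
  "units G = rng G ` arrows G"

definition unit_space :: "'g groupoid \<Rightarrow> 'g topology" where
  "unit_space G = subtopology (arr_top G) (units G)"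

definition composable_space :: "'g groupoid \<Rightarrow> ('g \<times> 'g) topology" where
  "composable_space G =
     subtopology (prod_topology (arr_top G) (arr_top G)) {(x, y). src G x = rng G y}"

text \<open>Open range and source maps are part of the definition. Continuity of \<open>rng\<close> and \<open>src\<close> follows
  from that of multiplication and inversion.\<close>

locale topological_groupoid =
  fixes G :: "'g groupoid"
  assumes rng_closed: "x \<in> arrows G \<Longrightarrow> rng G x \<in> arrows G"
    and src_closed: "x \<in> arrows G \<Longrightarrow> src G x \<in> arrows G"
    and rng_rng: "x \<in> arrows G \<Longrightarrow> rng G (rng G x) = rng G x"
    and src_rng: "x \<in> arrows G \<Longrightarrow> src G (rng G x) = rng G x"
    and rng_src: "x \<in> arrows G \<Longrightarrow> rng G (src G x) = src G x"
    and src_src: "x \<in> arrows G \<Longrightarrow> src G (src G x) = src G x"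
    and mul_closed: "\<lbrakk>x \<in> arrows G; y \<in> arrows G; src G x = rng G y\<rbrakk> \<Longrightarrow> mul G x y \<in> arrows G"
    and rng_mul: "\<lbrakk>x \<in> arrows G; y \<in> arrows G; src G x = rng G y\<rbrakk> \<Longrightarrow> rng G (mul G x y) = rng G x"
    and src_mul: "\<lbrakk>x \<in> arrows G; y \<in> arrows G; src G x = rng G y\<rbrakk> \<Longrightarrow> src G (mul G x y) = src G y"
    and mul_assoc: "\<lbrakk>x \<in> arrows G; y \<in> arrows G; z \<in> arrows G; src G x = rng G y; src G y = rng G z\<rbrakk>
      \<Longrightarrow> mul G (mul G x y) z = mul G x (mul G y z)"
    and rng_left_unit: "x \<in> arrows G \<Longrightarrow> mul G (rng G x) x = x"
    and src_right_unit: "x \<in> arrows G \<Longrightarrow> mul G x (src G x) = x"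
    and inv_closed: "x \<in> arrows G \<Longrightarrow> gpd_inv G x \<in> arrows G"
    and rng_inv: "x \<in> arrows G \<Longrightarrow> rng G (gpd_inv G x) = src G x"
    and src_inv: "x \<in> arrows G \<Longrightarrow> src G (gpd_inv G x) = rng G x"
    and mul_inv: "x \<in> arrows G \<Longrightarrow> mul G x (gpd_inv G x) = rng G x"
    and inv_mul: "x \<in> arrows G \<Longrightarrow> mul G (gpd_inv G x) x = src G x"
    and continuous_mul: "continuous_map (composable_space G) (arr_top G) (\<lambda>(x, y). mul G x y)"
    and continuous_inv: "continuous_map (arr_top G) (arr_top G) (gpd_inv G)"
    and open_rng: "open_map (arr_top G) (unit_space G) (rng G)"
    and open_src: "open_map (arr_top G) (unit_space G) (src G)"

section \<open>Actions\<close>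

definition left_fibre_product :: "'g groupoid \<Rightarrow> 'p topology \<Rightarrow> ('p \<Rightarrow> 'g) \<Rightarrow> ('g \<times> 'p) topology" where
  "left_fibre_product G P \<rho> =
     subtopology (prod_topology (arr_top G) P) {(x, p). src G x = \<rho> p}"

definition left_action ::
    "'g groupoid \<Rightarrow> 'p topology \<Rightarrow> ('p \<Rightarrow> 'g) \<Rightarrow> ('g \<Rightarrow> 'p \<Rightarrow> 'p) \<Rightarrow> bool" where
  "left_action G P \<rho> act \<longleftrightarrow>
     continuous_map P (unit_space G) \<rho> \<and>
     continuous_map (left_fibre_product G P \<rho>) P (\<lambda>(x, p). act x p) \<and>
     (\<forall>x \<in> arrows G. \<forall>p \<in> topspace P. src G x = \<rho> p \<longrightarrow> \<rho> (act x p) = rng G x) \<and>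
     (\<forall>p \<in> topspace P. act (\<rho> p) p = p) \<and>
     (\<forall>x \<in> arrows G. \<forall>y \<in> arrows G. \<forall>p \<in> topspace P.
        src G x = rng G y \<and> src G y = \<rho> p \<longrightarrow> act x (act y p) = act (mul G x y) p)"

definition free_left_action ::
    "'g groupoid \<Rightarrow> 'p topology \<Rightarrow> ('p \<Rightarrow> 'g) \<Rightarrow> ('g \<Rightarrow> 'p \<Rightarrow> 'p) \<Rightarrow> bool" where
  "free_left_action G P \<rho> act \<longleftrightarrow>
     (\<forall>x \<in> arrows G. \<forall>p \<in> topspace P. src G x = \<rho> p \<and> act x p = p \<longrightarrow> x = \<rho> p)"

definition proper_left_action ::
    "'g groupoid \<Rightarrow> 'p topology \<Rightarrow> ('p \<Rightarrow> 'g) \<Rightarrow> ('g \<Rightarrow> 'p \<Rightarrow> 'p) \<Rightarrow> bool" where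
  "proper_left_action G P \<rho> act \<longleftrightarrow>
     (\<forall>K. compactin (prod_topology P P) K \<longrightarrow>
        compactin (left_fibre_product G P \<rho>)
          {(x, p) \<in> topspace (left_fibre_product G P \<rho>). (act x p, p) \<in> K})"

definition right_fibre_product :: "'h groupoid \<Rightarrow> 'p topology \<Rightarrow> ('p \<Rightarrow> 'h) \<Rightarrow> ('p \<times> 'h) topology" where
  "right_fibre_product H P \<sigma> =
     subtopology (prod_topology P (arr_top H)) {(p, x). \<sigma> p = rng H x}"

definition right_action ::
    "'h groupoid \<Rightarrow> 'p topology \<Rightarrow> ('p \<Rightarrow> 'h) \<Rightarrow> ('p \<Rightarrow> 'h \<Rightarrow> 'p) \<Rightarrow> bool" where
  "right_action H P \<sigma> act \<longleftrightarrow>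
     continuous_map P (unit_space H) \<sigma> \<and>
     continuous_map (right_fibre_product H P \<sigma>) P (\<lambda>(p, x). act p x) \<and>
     (\<forall>p \<in> topspace P. \<forall>x \<in> arrows H. \<sigma> p = rng H x \<longrightarrow> \<sigma> (act p x) = src H x) \<and>
     (\<forall>p \<in> topspace P. act p (\<sigma> p) = p) \<and>
     (\<forall>p \<in> topspace P. \<forall>x \<in> arrows H. \<forall>y \<in> arrows H.
        \<sigma> p = rng H x \<and> src H x = rng H y \<longrightarrow> act (act p x) y = act p (mul H x y))"

definition free_right_action ::
    "'h groupoid \<Rightarrow> 'p topology \<Rightarrow> ('p \<Rightarrow> 'h) \<Rightarrow> ('p \<Rightarrow> 'h \<Rightarrow> 'p) \<Rightarrow> bool" where
  "free_right_action H P \<sigma> act \<longleftrightarrow>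
     (\<forall>p \<in> topspace P. \<forall>x \<in> arrows H. \<sigma> p = rng H x \<and> act p x = p \<longrightarrow> x = \<sigma> p)"

definition proper_right_action ::
    "'h groupoid \<Rightarrow> 'p topology \<Rightarrow> ('p \<Rightarrow> 'h) \<Rightarrow> ('p \<Rightarrow> 'h \<Rightarrow> 'p) \<Rightarrow> bool" where
  "proper_right_action H P \<sigma> act \<longleftrightarrow>
     (\<forall>K. compactin (prod_topology P P) K \<longrightarrow>
        compactin (right_fibre_product H P \<sigma>)
          {(p, x) \<in> topspace (right_fibre_product H P \<sigma>). (act p x, p) \<in> K})"

definition principal_groupoid :: "'g groupoid \<Rightarrow> bool" where
  "principal_groupoid G \<longleftrightarrow> free_left_action G (unit_space G) (\<lambda>u. u) (\<lambda>x u. rng G x)"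

section \<open>Equivalence of groupoids\<close>

definition quotient_topology :: "'a topology \<Rightarrow> ('a \<Rightarrow> 'b) \<Rightarrow> 'b topology" where
  "quotient_topology X q =
     topology (\<lambda>U. U \<subseteq> q ` topspace X \<and> openin X {x \<in> topspace X. q x \<in> U})"

lemma openin_quotient_topology:
  "openin (quotient_topology X q) U \<longleftrightarrow>
     U \<subseteq> q ` topspace X \<and> openin X {x \<in> topspace X. q x \<in> U}"
proof -
  have "istopology (\<lambda>U. U \<subseteq> q ` topspace X \<and> openin X {x \<in> topspace X. q x \<in> U})"
    unfolding istopology_def
  proof (intro conjI allI impI)
    fix S T
    assume "S \<subseteq> q ` topspace X \<and> openin X {x \<in> topspace X. q x \<in> S}"
      and "T \<subseteq> q ` topspace X \<and> openin X {x \<in> topspace X. q x \<in> T}"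
    moreover have "{x \<in> topspace X. q x \<in> S \<inter> T} =
        {x \<in> topspace X. q x \<in> S} \<inter> {x \<in> topspace X. q x \<in> T}"
      by auto
    ultimately show "S \<inter> T \<subseteq> q ` topspace X" "openin X {x \<in> topspace X. q x \<in> S \<inter> T}"
      by auto
  next
    fix \<K>
    assume *: "\<forall>K\<in>\<K>. K \<subseteq> q ` topspace X \<and> openin X {x \<in> topspace X. q x \<in> K}"
    then show "\<Union>\<K> \<subseteq> q ` topspace X"
      by auto
    have "{x \<in> topspace X. q x \<in> \<Union>\<K>} = (\<Union>K\<in>\<K>. {x \<in> topspace X. q x \<in> K})"
      by auto
    also have "openin X \<dots>"
      using * by blast
    finally show "openin X {x \<in> topspace X. q x \<in> \<Union>\<K>}" .
  qed
  then show ?thesis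
    by (simp add: quotient_topology_def)
qed

lemma quotient_map_quotient_topology: "quotient_map X (quotient_topology X q) q"
proof -
  have "openin (quotient_topology X q) (q ` topspace X)"
    by (auto simp: openin_quotient_topology cong: conj_cong)
  then have "topspace (quotient_topology X q) = q ` topspace X"
    by (meson openin_quotient_topology openin_subset openin_topspace subset_antisym)
  then show ?thesis
    by (simp add: quotient_map_def openin_quotient_topology)
qed

definition left_orbit ::
    "'g groupoid \<Rightarrow> ('p \<Rightarrow> 'g) \<Rightarrow> ('g \<Rightarrow> 'p \<Rightarrow> 'p) \<Rightarrow> 'p \<Rightarrow> 'p set" where
  "left_orbit G \<rho> act p = {act x p | x. x \<in> arrows G \<and> src G x = \<rho> p}"

definition right_orbit ::
    "'h groupoid \<Rightarrow> ('p \<Rightarrow> 'h) \<Rightarrow> ('p \<Rightarrow> 'h \<Rightarrow> 'p) \<Rightarrow> 'p \<Rightarrow> 'p set" where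
  "right_orbit H \<sigma> act p = {act p x | x. x \<in> arrows H \<and> \<sigma> p = rng H x}"

definition induces_homeomorphism ::
    "'p topology \<Rightarrow> ('p \<Rightarrow> 'b) \<Rightarrow> 'c topology \<Rightarrow> ('p \<Rightarrow> 'c) \<Rightarrow> bool" where
  "induces_homeomorphism X q Y m \<longleftrightarrow>
     (\<exists>f. homeomorphic_map (quotient_topology X q) Y f \<and> (\<forall>x \<in> topspace X. f (q x) = m x))"

text \<open>The invariance of each moment map under the other action is what makes both sides of
  \<open>ract (lact x z) y = lact x (ract z y)\<close> meaningful.\<close>

definition actions_commute ::
    "'g groupoid \<Rightarrow> 'h groupoid \<Rightarrow> 'z topology \<Rightarrow> ('z \<Rightarrow> 'g) \<Rightarrow> ('g \<Rightarrow> 'z \<Rightarrow> 'z)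
      \<Rightarrow> ('z \<Rightarrow> 'h) \<Rightarrow> ('z \<Rightarrow> 'h \<Rightarrow> 'z) \<Rightarrow> bool" where
  "actions_commute G H Z \<rho> lact \<sigma> ract \<longleftrightarrow>
     (\<forall>z \<in> topspace Z. \<forall>y \<in> arrows H. \<sigma> z = rng H y \<longrightarrow> \<rho> (ract z y) = \<rho> z) \<and>
     (\<forall>x \<in> arrows G. \<forall>z \<in> topspace Z. src G x = \<rho> z \<longrightarrow> \<sigma> (lact x z) = \<sigma> z) \<and>
     (\<forall>x \<in> arrows G. \<forall>z \<in> topspace Z. \<forall>y \<in> arrows H. src G x = \<rho> z \<and> \<sigma> z = rng H y \<longrightarrow>
        ract (lact x z) y = lact x (ract z y))"

definition groupoid_equivalence ::
    "'g groupoid \<Rightarrow> 'h groupoid \<Rightarrow> 'z topology \<Rightarrow> ('z \<Rightarrow> 'g) \<Rightarrow> ('g \<Rightarrow> 'z \<Rightarrow> 'z)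
      \<Rightarrow> ('z \<Rightarrow> 'h) \<Rightarrow> ('z \<Rightarrow> 'h \<Rightarrow> 'z) \<Rightarrow> bool" where
  "groupoid_equivalence G H Z \<rho> lact \<sigma> ract \<longleftrightarrow>
     locally_compact_space Z \<and> Hausdorff_space Z \<and>
     (left_action G Z \<rho> lact \<and> free_left_action G Z \<rho> lact \<and> proper_left_action G Z \<rho> lact) \<and>
     (right_action H Z \<sigma> ract \<and> free_right_action H Z \<sigma> ract \<and> proper_right_action H Z \<sigma> ract) \<and>
     actions_commute G H Z \<rho> lact \<sigma> ract \<and>
     (open_map Z (unit_space G) \<rho> \<and>
        induces_homeomorphism Z (right_orbit H \<sigma> ract) (unit_space G) \<rho>) \<and>
     (open_map Z (unit_space H) \<sigma> \<and>
        induces_homeomorphism Z (left_orbit G \<rho> lact) (unit_space H) \<sigma>)"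

section \<open>Haar systems and integrability\<close>

definition borel_of :: "'a topology \<Rightarrow> 'a measure" where
  "borel_of X = sigma (topspace X) {U. openin X U}"

definition radon_measure :: "'a topology \<Rightarrow> 'a measure \<Rightarrow> bool" where
  "radon_measure X M \<longleftrightarrow>
     sets M = sets (borel_of X) \<and>
     (\<forall>K. compactin X K \<longrightarrow> emeasure M K < \<infinity>) \<and>
     (\<forall>A \<in> sets M. emeasure M A = (INF U \<in> {U. openin X U \<and> A \<subseteq> U}. emeasure M U)) \<and>
     (\<forall>U. openin X U \<longrightarrow>
        emeasure M U = (SUP K \<in> {K. compactin X K \<and> K \<subseteq> U}. emeasure M K))"

definition measure_support :: "'a topology \<Rightarrow> 'a measure \<Rightarrow> 'a set" where
  "measure_support X M = {x \<in> topspace X. \<forall>U. openin X U \<and> x \<in> U \<longrightarrow> emeasure M U > 0}"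

text \<open>Values outside \<open>topspace X\<close> are unconstrained; they play no role in integrals over \<open>X\<close>.\<close>

definition Cc :: "'a topology \<Rightarrow> ('a \<Rightarrow> complex) set" where
  "Cc X = {f. continuous_map X euclidean f \<and>
              compactin X (X closure_of {x \<in> topspace X. f x \<noteq> 0})}"

text \<open>In the invariance condition the first integral is restricted to the arrows \<open>y\<close> with
  \<open>rng y = src x\<close>, which support the measure, because \<open>mul x y\<close> is meaningless for other \<open>y\<close>.\<close>

definition haar_system :: "'g groupoid \<Rightarrow> ('g \<Rightarrow> 'g measure) \<Rightarrow> bool" where
  "haar_system G \<nu> \<longleftrightarrow>
     (\<forall>u \<in> units G. radon_measure (arr_top G) (\<nu> u) \<and>
        measure_support (arr_top G) (\<nu> u) = {x \<in> arrows G. rng G x = u}) \<and>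
     (\<forall>f \<in> Cc (arr_top G). continuous_map (unit_space G) euclidean (\<lambda>u. LINT x|\<nu> u. f x)) \<and>
     (\<forall>f \<in> Cc (arr_top G). \<forall>x \<in> arrows G.
        (LINT y:{y \<in> arrows G. rng G y = src G x}|\<nu> (src G x). f (mul G x y)) =
        (LINT y|\<nu> (rng G x). f y))"

definition integrable_groupoid :: "'g groupoid \<Rightarrow> ('g \<Rightarrow> 'g measure) \<Rightarrow> bool" where
  "integrable_groupoid G \<nu> \<longleftrightarrow>
     (\<forall>N. compactin (unit_space G) N \<longrightarrow>
        (SUP u \<in> N. emeasure (\<nu> u) {x \<in> arrows G. src G x \<in> N}) < \<infinity>)"

end

theory Submission
  imports Defs
begin

text \<open>
  For \<open>x, w\<close> in the same fibre of \<open>\<rho>\<close> let \<open>transporter x w\<close> be the unique \<open>h\<close> with \<open>x h = w\<close>. If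
  \<open>\<beta>\<close> is a continuous system of measures on the fibres of \<open>\<rho>\<close> with supports in a compact set, then
  integrating \<open>f (transporter x w)\<close> over \<open>w\<close> against \<open>\<beta>\<close>, and the resulting function of \<open>x\<close> over the
  \<open>G\<close>-orbit of \<open>z\<close> against the Haar system of \<open>G\<close>, gives a functional that depends only on \<open>\<sigma> z\<close> and
  is left invariant under \<open>H\<close>. A suitably weighted sum over countably many \<open>\<beta>\<close> has full support, and
  the Riesz representation theorem turns it into a Haar system. The measures \<open>\<beta>\<close> exist because \<open>\<rho>\<close>
  is open: a weight function on the base is split repeatedly along finer and finer covers of the total
  space. Principality of \<open>G\<close> makes \<open>(\<rho>, \<sigma>)\<close> injective, hence \<open>Z\<close> second countable.

  Integrability of \<open>G\<close> is equivalent to a bound, uniform over a compact set \<open>N\<close> of units, on the number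
  of translates of one compact set needed to cover the arrows from \<open>N\<close> to a unit of \<open>N\<close>. Such a
  covering does not mention the Haar system and passes through the equivalence.
\<close>

section \<open>Compactly supported continuous functions\<close>

text \<open>The Haar system lives on the arrows of \<open>G\<close>, and \<open>Z\<close> carries no
  measure, so an equivalence alone offers nothing to integrate against along the fibres of \<rho>;
  hence the construction of the \<beta>. Their compact supports are forced: orbits of
  \<open>G\<close> in \<open>Z\<close> need not be compact, and the second integration is under
  control only because the first one returns a function of compact support. For the same reason no
  single \<beta> of this kind has full support on a noncompact fibre. The countable sum is therefore
  taken after both integrations, with weights that make it converge for every compactly supported
  function on \<open>H\<close>. The functionals are defined at points of \<open>Z\<close>; as
  \<sigma> is a quotient map, continuity on \<open>Z\<close> becomes continuity on the units of
  \<open>H\<close>, and an arbitrary section of \<sigma> will do. Integrability is transferred to an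
  arbitrary Haar system of \<open>H\<close>, not just to the constructed one.\<close>

definition Cc_real :: "'a topology \<Rightarrow> ('a \<Rightarrow> real) set" where
  "Cc_real X = {f. continuous_map X euclideanreal f \<and>
     (\<exists>K. compactin X K \<and> (\<forall>x \<in> topspace X - K. f x = 0))}"

lemma Cc_realI:
  assumes "continuous_map X euclideanreal f" "compactin X K"
    and "\<And>x. x \<in> topspace X \<Longrightarrow> x \<notin> K \<Longrightarrow> f x = 0"
  shows "f \<in> Cc_real X"
  using assms by (auto simp: Cc_real_def)

lemma Cc_real_continuous: "f \<in> Cc_real X \<Longrightarrow> continuous_map X euclideanreal f"
  by (simp add: Cc_real_def)

lemma Cc_realE:
  assumes "f \<in> Cc_real X"
  obtains K where "compactin X K" "\<And>x. x \<in> topspace X \<Longrightarrow> x \<notin> K \<Longrightarrow> f x = 0"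
  using assms by (auto simp: Cc_real_def)

lemma Cc_real_mult:
  assumes "f \<in> Cc_real X" "continuous_map X euclideanreal g"
  shows "(\<lambda>x. f x * g x) \<in> Cc_real X" "(\<lambda>x. g x * f x) \<in> Cc_real X"
  using assms by (auto simp: Cc_real_def intro!: continuous_intros)

lemma Cc_real_scale: "f \<in> Cc_real X \<Longrightarrow> (\<lambda>x. c * f x) \<in> Cc_real X"
  by (rule Cc_real_mult) auto

lemma Cc_real_add:
  assumes "f \<in> Cc_real X" "g \<in> Cc_real X"
  shows "(\<lambda>x. f x + g x) \<in> Cc_real X"
proof -
  obtain K L where "compactin X K" "\<And>x. x \<in> topspace X \<Longrightarrow> x \<notin> K \<Longrightarrow> f x = 0"
    and "compactin X L" "\<And>x. x \<in> topspace X \<Longrightarrow> x \<notin> L \<Longrightarrow> g x = 0"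
    using assms by (metis Cc_realE)
  then show ?thesis
    using assms by (intro Cc_realI[of _ _ "K \<union> L"])
      (auto intro!: continuous_intros compactin_Un dest: Cc_real_continuous)
qed

lemma Cc_real_minus: "f \<in> Cc_real X \<Longrightarrow> (\<lambda>x. - f x) \<in> Cc_real X"
  using Cc_real_scale[of f X "-1"] by simp

lemma Cc_real_diff: "f \<in> Cc_real X \<Longrightarrow> g \<in> Cc_real X \<Longrightarrow> (\<lambda>x. f x - g x) \<in> Cc_real X"
  using Cc_real_add[of f X "\<lambda>x. - g x"] Cc_real_minus[of g X] by simp

lemma Cc_real_zero: "(\<lambda>x. 0) \<in> Cc_real X"
  by (rule Cc_realI[of _ _ "{}"]) auto

lemma Cc_real_sum: "(\<And>i. i \<in> A \<Longrightarrow> f i \<in> Cc_real X) \<Longrightarrow> (\<lambda>x. \<Sum>i\<in>A. f i x) \<in> Cc_real X"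
  by (induction A rule: infinite_finite_induct) (auto intro: Cc_real_add Cc_real_zero)

lemma Cc_real_bounded:
  assumes "f \<in> Cc_real X"
  obtains B where "B \<ge> 0" "\<And>x. x \<in> topspace X \<Longrightarrow> \<bar>f x\<bar> \<le> B"
proof -
  obtain K where K: "compactin X K" "\<And>x. x \<in> topspace X \<Longrightarrow> x \<notin> K \<Longrightarrow> f x = 0"
    using assms by (rule Cc_realE) blast
  have "compact (f ` K)"
    using image_compactin[OF K(1) Cc_real_continuous[OF assms]] by simp
  then obtain B where "\<And>x. x \<in> K \<Longrightarrow> \<bar>f x\<bar> \<le> B"
    by (metis bounded_real compact_imp_bounded image_eqI)
  then show thesis
    using K(2) by (intro that[of "max 0 B"]) (fastforce simp: le_max_iff_disj)+
qed

section \<open>Urysohn functions, cut-offs and extension on locally compact Hausdorff spaces\<close>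

locale lch_space =
  fixes X :: "'a topology"
  assumes lc: "locally_compact_space X" and haus: "Hausdorff_space X"
begin

lemma compact_closed: "compactin X K \<Longrightarrow> closedin X K"
  using haus compactin_imp_closedin by blast

lemma completely_regular: "completely_regular_space X"
  using haus lc locally_compact_regular_imp_completely_regular_space by blast

text \<open>The open set U is itself a locally compact Hausdorff space, so K has a compact
  neighbourhood inside it, and what is open in U is open in X.\<close>

lemma compact_neighbourhood:
  assumes "compactin X K" "openin X U" "K \<subseteq> U"
  obtains V C where "openin X V" "compactin X C" "K \<subseteq> V" "V \<subseteq> C" "C \<subseteq> U"
proof -
  let ?Y = "subtopology X U"
  have Y: "locally_compact_space ?Y" "Hausdorff_space ?Y"
    using assms(2) haus lc Hausdorff_space_subtopology locally_compact_space_open_subset by blast+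
  have "compactin ?Y K"
    using assms by (simp add: compactin_subtopology)
  then obtain V C where "openin ?Y V" "compactin ?Y C" "K \<subseteq> V" "V \<subseteq> C"
    using locally_compact_space_compact_closed_compact[of ?Y] Y by metis
  then show thesis
    using that assms(2) by (metis compactin_subtopology openin_open_subtopology)
qed

text \<open>K is separated from the complement of an open V that lies in a compact C inside U. The
  set C is returned because vanishing outside a compact subset of U is more than vanishing outside
  U; \<open>below\<close> and \<open>subordinate\<close> ask for the former.\<close>

lemma urysohn:
  assumes "compactin X K" "openin X U" "K \<subseteq> U"
  obtains f :: "'a \<Rightarrow> real" and C where "continuous_map X euclideanreal f"
    "\<And>x. x \<in> topspace X \<Longrightarrow> 0 \<le> f x \<and> f x \<le> 1" "\<And>x. x \<in> K \<Longrightarrow> f x = 1"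
    "compactin X C" "C \<subseteq> U" "\<And>x. x \<in> topspace X \<Longrightarrow> x \<notin> C \<Longrightarrow> f x = 0"
proof -
  obtain V C where VC: "openin X V" "compactin X C" "K \<subseteq> V" "V \<subseteq> C" "C \<subseteq> U"
    using compact_neighbourhood[OF assms] .
  have "closedin X (topspace X - V)" "disjnt (topspace X - V) K"
    using VC by (auto simp: disjnt_def)
  then obtain f where f: "continuous_map X (subtopology euclidean {0..1::real}) f"
    "f ` (topspace X - V) \<subseteq> {0}" "f ` K \<subseteq> {1}"
    using Urysohn_completely_regular_compact_closed[of 0 "1::real" X K "topspace X - V"]
      Urysohn_completely_regular_closed_compact[of 0 "1::real" X "topspace X - V" K]
      completely_regular assms(1)
    by (metis disjnt_sym zero_le_one)
  show thesis
  proof (rule that[OF _ _ _ VC(2,5)])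
    show "continuous_map X euclideanreal f" using f(1) continuous_map_into_fulltopology by blast
    show "0 \<le> f x \<and> f x \<le> 1" if "x \<in> topspace X" for x
      using f(1) that by (auto simp: continuous_map_in_subtopology)
    show "f x = 1" if "x \<in> K" for x using f(3) that by auto
    show "f x = 0" if "x \<in> topspace X" "x \<notin> C" for x using f(2) that VC by blast
  qed
qed

lemma urysohn_Cc:
  assumes "compactin X K" "openin X U" "K \<subseteq> U"
  obtains f where "f \<in> Cc_real X" "\<And>x. x \<in> topspace X \<Longrightarrow> 0 \<le> f x \<and> f x \<le> 1"
    "\<And>x. x \<in> K \<Longrightarrow> f x = 1" "\<And>x. x \<in> topspace X \<Longrightarrow> x \<notin> U \<Longrightarrow> f x = 0"
proof -
  obtain f C where "continuous_map X euclideanreal f"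
    "\<And>x. x \<in> topspace X \<Longrightarrow> 0 \<le> f x \<and> f x \<le> 1" "\<And>x. x \<in> K \<Longrightarrow> f x = 1"
    "compactin X C" "C \<subseteq> U" "\<And>x. x \<in> topspace X \<Longrightarrow> x \<notin> C \<Longrightarrow> f x = 0"
    using urysohn[OF assms] by blast
  then show thesis
    by (intro that[of f]) (auto intro: Cc_realI)
qed

text \<open>A two-set partition of unity applied to p: \<phi> is 1 on a compact neighbourhood D of C
  - V, so (1 - \<phi>) p vanishes on W and is carried by C - W, which lies in V. It serves both the
  subadditivity of the outer measure and the splitting of weights.\<close>

lemma split_Cc:
  assumes p: "continuous_map X euclideanreal p" "\<And>x. x \<in> topspace X \<Longrightarrow> 0 \<le> p x"
    and C: "compactin X C" "\<And>x. x \<in> topspace X \<Longrightarrow> x \<notin> C \<Longrightarrow> p x = 0"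
    and UV: "openin X U" "openin X V" "C \<subseteq> U \<union> V"
  obtains g h D E where "continuous_map X euclideanreal g" "continuous_map X euclideanreal h"
    "compactin X D" "D \<subseteq> U" "\<And>x. x \<in> topspace X \<Longrightarrow> x \<notin> D \<Longrightarrow> g x = 0"
    "compactin X E" "E \<subseteq> V" "\<And>x. x \<in> topspace X \<Longrightarrow> x \<notin> E \<Longrightarrow> h x = 0"
    "\<And>x. x \<in> topspace X \<Longrightarrow> 0 \<le> g x" "\<And>x. x \<in> topspace X \<Longrightarrow> 0 \<le> h x"
    "\<And>x. p x = g x + h x"
proof -
  have "compactin X (C - V)"
    using C(1) UV(2) by (metis Diff_eq compact_Int_closedin compact_closed
        closed_compactin closedin_diff Diff_subset)
  moreover have "C - V \<subseteq> U" using UV by auto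
  ultimately obtain W D where WD: "openin X W" "compactin X D" "C - V \<subseteq> W" "W \<subseteq> D" "D \<subseteq> U"
    using compact_neighbourhood UV(1) by metis
  obtain \<phi> D' where \<phi>: "continuous_map X euclideanreal \<phi>"
    "\<And>x. x \<in> topspace X \<Longrightarrow> 0 \<le> \<phi> x \<and> \<phi> x \<le> 1" "\<And>x. x \<in> D \<Longrightarrow> \<phi> x = 1"
    "compactin X D'" "D' \<subseteq> U" "\<And>x. x \<in> topspace X \<Longrightarrow> x \<notin> D' \<Longrightarrow> \<phi> x = 0"
    using urysohn[OF WD(2) UV(1) WD(5)] by blast
  have E: "compactin X (C - W)"
    using C(1) WD(1) by (metis closed_compactin closedin_diff Diff_subset compact_closed)
  show thesis
  proof (rule that[of "\<lambda>x. \<phi> x * p x" "\<lambda>x. (1 - \<phi> x) * p x", OF _ _ \<phi>(4,5) _ E])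
    show "(1 - \<phi> x) * p x = 0" if "x \<in> topspace X" "x \<notin> C - W" for x
      using that C(2) WD(4) \<phi>(3) by auto
    show "C - W \<subseteq> V" using WD by auto
  qed (use \<phi> p in \<open>auto intro!: continuous_intros simp: algebra_simps mult_left_le_one_le\<close>)
qed

text \<open>Tietze is applied on the compact set S \<inter> C, and the result is multiplied by a
  cut-off that is 1 on K and 0 outside V. The product is right on all of S because f vanishes on S -
  K. A function known only on a closed fibre thus becomes the restriction of a member of
  \<open>Cc_real\<close>.\<close>

lemma extend_Cc:
  assumes S: "closedin X S" and f: "continuous_map (subtopology X S) euclideanreal f"
    and K: "compactin X K" "\<And>x. x \<in> S \<Longrightarrow> x \<notin> K \<Longrightarrow> f x = 0"
  obtains g where "g \<in> Cc_real X" "\<And>x. x \<in> S \<Longrightarrow> g x = f x"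
proof -
  have "K \<subseteq> topspace X" using K(1) compactin_subset_topspace by blast
  then obtain V C where VC: "openin X V" "compactin X C" "K \<subseteq> V" "V \<subseteq> C"
    using compact_neighbourhood[OF K(1) openin_topspace] by metis
  have SC: "compactin X (S \<inter> C)"
    using S VC(2) closed_Int_compactin by blast
  have "continuous_map (subtopology X (S \<inter> C)) euclidean f"
    using f by (metis continuous_map_from_subtopology subtopology_subtopology)
  then obtain g where g: "continuous_map X euclideanreal g" "\<And>x. x \<in> S \<inter> C \<Longrightarrow> g x = f x"
    using Tietze_extension_completely_regular[OF completely_regular SC, of UNIV f] by auto
  obtain \<psi> where \<psi>: "\<psi> \<in> Cc_real X"
    "\<And>x. x \<in> K \<Longrightarrow> \<psi> x = 1" "\<And>x. x \<in> topspace X \<Longrightarrow> x \<notin> V \<Longrightarrow> \<psi> x = 0"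
    using urysohn_Cc[OF K(1) VC(1,3)] by metis
  show thesis
  proof (rule that[OF Cc_real_mult(1)[OF \<psi>(1) g(1)]])
    fix x assume x: "x \<in> S"
    then have "x \<in> topspace X" using S closedin_subset by blast
    then show "\<psi> x * g x = f x"
      using x g(2)[of x] \<psi>(2,3)[of x] K(2)[of x] VC by (cases "x \<in> K"; cases "x \<in> V") auto
  qed
qed

end

section \<open>The Riesz representation theorem\<close>

lemma space_borel_of [simp]: "space (borel_of X) = topspace X"
  unfolding borel_of_def by (rule space_measure_of) (auto dest: openin_subset)

lemma sets_borel_of: "sets (borel_of X) = sigma_sets (topspace X) {U. openin X U}"
  unfolding borel_of_def by (rule sets_measure_of) (auto dest: openin_subset)

text \<open>The part of \<open>radon_measure\<close> on which integrating members of
  \<open>Cc_real\<close> rests; regularity enters through \<open>radon_null_open\<close>.\<close>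

definition locally_finite_borel :: "'a topology \<Rightarrow> 'a measure \<Rightarrow> bool" where
  "locally_finite_borel X M \<longleftrightarrow>
     sets M = sets (borel_of X) \<and> (\<forall>K. compactin X K \<longrightarrow> emeasure M K < \<infinity>)"

lemma radon_locally_finite: "radon_measure X M \<Longrightarrow> locally_finite_borel X M"
  by (simp add: radon_measure_def locally_finite_borel_def)

lemma lfb_space: "locally_finite_borel X M \<Longrightarrow> space M = topspace X"
  by (metis locally_finite_borel_def sets_eq_imp_space_eq space_borel_of)

lemma lfb_open: "locally_finite_borel X M \<Longrightarrow> openin X U \<Longrightarrow> U \<in> sets M"
  by (simp add: locally_finite_borel_def sets_borel_of sigma_sets.Basic)

lemma lfb_closed:
  assumes "locally_finite_borel X M" "closedin X C" shows "C \<in> sets M"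
proof -
  have "space M - (topspace X - C) \<in> sets M"
    using lfb_open[OF assms(1)] assms(2) by blast
  then show ?thesis
    using lfb_space[OF assms(1)] assms(2) by (metis closedin_def double_diff subset_refl)
qed

lemma lfb_continuous_measurable:
  fixes f :: "'a \<Rightarrow> 'b::topological_space"
  assumes M: "locally_finite_borel X M" and f: "continuous_map X euclidean f"
  shows "f \<in> borel_measurable M"
proof (rule borel_measurableI)
  fix S :: "'b set" assume "open S"
  then have "openin X {x \<in> topspace X. f x \<in> S}"
    using f by (simp add: openin_continuous_map_preimage)
  moreover have "f -` S \<inter> space M = {x \<in> topspace X. f x \<in> S}"
    using lfb_space[OF M] by auto
  ultimately show "f -` S \<inter> space M \<in> sets M"
    using lfb_open[OF M] by simp
qed

context lch_space
begin

lemma lfb_compact: "locally_finite_borel X M \<Longrightarrow> compactin X K \<Longrightarrow> K \<in> sets M"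
  by (simp add: compact_closed lfb_closed)

lemma lfb_Cc_integrable:
  assumes M: "locally_finite_borel X M" and f: "f \<in> Cc_real X"
  shows "integrable M f"
proof -
  obtain K where K: "compactin X K" "\<And>x. x \<in> topspace X \<Longrightarrow> x \<notin> K \<Longrightarrow> f x = 0"
    using f by (rule Cc_realE) blast
  obtain B where "\<And>x. x \<in> topspace X \<Longrightarrow> \<bar>f x\<bar> \<le> B"
    using f by (rule Cc_real_bounded) blast
  then show ?thesis
    using M K lfb_space[OF M] compactin_subset_topspace[OF K(1)]
    by (intro integrableI_bounded_set[of K M f B] lfb_compact
        lfb_continuous_measurable[OF M Cc_real_continuous[OF f]])
      (auto simp: locally_finite_borel_def)
qed

end

section \<open>Outer measure of a positive functional on \<open>Cc_real\<close>\<close>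

locale positive_functional = lch_space X for X :: "'a topology" +
  fixes I :: "('a \<Rightarrow> real) \<Rightarrow> real"
  assumes I_add: "f \<in> Cc_real X \<Longrightarrow> g \<in> Cc_real X \<Longrightarrow> I (\<lambda>x. f x + g x) = I f + I g"
    and I_scale: "f \<in> Cc_real X \<Longrightarrow> I (\<lambda>x. c * f x) = c * I f"
    and I_nonneg: "f \<in> Cc_real X \<Longrightarrow> (\<And>x. x \<in> topspace X \<Longrightarrow> 0 \<le> f x) \<Longrightarrow> 0 \<le> I f"
begin

lemma I_diff: "f \<in> Cc_real X \<Longrightarrow> g \<in> Cc_real X \<Longrightarrow> I (\<lambda>x. f x - g x) = I f - I g"
  using I_add[of f "\<lambda>x. - 1 * g x"] I_scale[of g "-1"] Cc_real_scale[of g X "-1"] by simp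

lemma I_mono:
  assumes "f \<in> Cc_real X" "g \<in> Cc_real X" "\<And>x. x \<in> topspace X \<Longrightarrow> f x \<le> g x"
  shows "I f \<le> I g"
  using I_nonneg[OF Cc_real_diff[OF assms(2,1)]] I_diff[OF assms(2,1)] assms(3) by auto

lemma I_cong:
  assumes "f \<in> Cc_real X" "g \<in> Cc_real X" "\<And>x. x \<in> topspace X \<Longrightarrow> f x = g x"
  shows "I f = I g"
  using assms by (intro antisym I_mono) auto

lemma I_zero: "I (\<lambda>x. 0) = 0"
  using I_scale[OF Cc_real_zero, of 0] by simp

lemma I_sum: "(\<And>i. i \<in> A \<Longrightarrow> f i \<in> Cc_real X) \<Longrightarrow> I (\<lambda>x. \<Sum>i\<in>A. f i x) = (\<Sum>i\<in>A. I (f i))"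
  by (induction A rule: infinite_finite_induct) (auto simp: I_zero I_add Cc_real_sum)

text \<open>Rudin's relation f \<prec> U, with a compact carrier inside U in place of the closed
  support.\<close>

definition below :: "'a set \<Rightarrow> ('a \<Rightarrow> real) set" where
  "below U = {f \<in> Cc_real X. (\<forall>x \<in> topspace X. 0 \<le> f x \<and> f x \<le> 1) \<and>
     (\<exists>K. compactin X K \<and> K \<subseteq> U \<and> (\<forall>x \<in> topspace X - K. f x = 0))}"

definition content :: "'a set \<Rightarrow> ennreal" where
  "content U = (SUP f \<in> below U. ennreal (I f))"

definition outer :: "'a set \<Rightarrow> ennreal" where
  "outer A = (INF U \<in> {U. openin X U \<and> A \<subseteq> U}. content U)"

lemma content_upper: "f \<in> below U \<Longrightarrow> ennreal (I f) \<le> content U"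
  unfolding content_def by (rule SUP_upper)

lemma zero_in_below: "(\<lambda>x. 0) \<in> below U"
  unfolding below_def using Cc_real_zero compactin_empty by fastforce

lemma content_mono: "U \<subseteq> V \<Longrightarrow> content U \<le> content V"
  unfolding content_def below_def by (rule SUP_subset_mono) auto

text \<open>By \<open>split_Cc\<close> a test function for the union is a sum of test functions for
  the two sets; both stay at most 1, being nonnegative with a sum at most 1.\<close>

lemma content_Un:
  assumes U: "openin X U" and V: "openin X V"
  shows "content (U \<union> V) \<le> content U + content V"
  unfolding content_def[of "U \<union> V"]
proof (rule SUP_least)
  fix f assume "f \<in> below (U \<union> V)"
  then obtain C where f: "continuous_map X euclideanreal f" "\<And>x. x \<in> topspace X \<Longrightarrow> 0 \<le> f x"
    and f1: "\<And>x. x \<in> topspace X \<Longrightarrow> f x \<le> 1"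
    and C: "compactin X C" "\<And>x. x \<in> topspace X \<Longrightarrow> x \<notin> C \<Longrightarrow> f x = 0" "C \<subseteq> U \<union> V"
    by (auto simp: below_def Cc_real_def)
  obtain g h D E where gh: "continuous_map X euclideanreal g" "continuous_map X euclideanreal h"
    "compactin X D" "D \<subseteq> U" "\<And>x. x \<in> topspace X \<Longrightarrow> x \<notin> D \<Longrightarrow> g x = 0"
    "compactin X E" "E \<subseteq> V" "\<And>x. x \<in> topspace X \<Longrightarrow> x \<notin> E \<Longrightarrow> h x = 0"
    "\<And>x. x \<in> topspace X \<Longrightarrow> 0 \<le> g x" "\<And>x. x \<in> topspace X \<Longrightarrow> 0 \<le> h x"
    "\<And>x. f x = g x + h x"
    using split_Cc[OF f C(1,2) U V C(3)] by blast
  have Cc: "g \<in> Cc_real X" "h \<in> Cc_real X"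
    using gh by (auto intro: Cc_realI)
  have le1: "g x \<le> 1" "h x \<le> 1" if "x \<in> topspace X" for x
    using gh(9,10,11)[of x] f1[OF that] that by linarith+
  then have "g \<in> below U" "h \<in> below V"
    using gh Cc by (auto simp: below_def)
  moreover have "f = (\<lambda>x. g x + h x)" using gh(11) by auto
  then have "I f = I g + I h" using I_add Cc by simp
  ultimately show "ennreal (I f) \<le> content U + content V"
    using I_nonneg[OF Cc(1)] I_nonneg[OF Cc(2)] gh(9,10)
    by (metis add_mono content_upper ennreal_plus)
qed

lemma content_empty: "content {} = 0"
proof -
  have "I f \<le> 0" if "f \<in> below {}" for f
    using that I_mono[OF _ Cc_real_zero, of f] I_zero by (auto simp: below_def)
  then have "content {} \<le> 0"
    unfolding content_def by (intro SUP_least) (auto simp: ennreal_neg)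
  then show ?thesis by simp
qed

lemma content_UN_finite:
  fixes U :: "nat \<Rightarrow> 'a set"
  assumes "\<And>i. openin X (U i)"
  shows "content (\<Union>i<n. U i) \<le> (\<Sum>i<n. content (U i))"
proof (induction n)
  case (Suc n)
  have "(\<Union>i<Suc n. U i) = (\<Union>i<n. U i) \<union> U n" by (auto simp: less_Suc_eq)
  then have "content (\<Union>i<Suc n. U i) \<le> content (\<Union>i<n. U i) + content (U n)"
    using content_Un[OF openin_Union assms, of "U ` {..<n}" n] assms by auto
  with Suc show ?case by (simp add: order_trans add_right_mono)
qed (simp add: content_empty)

text \<open>The carrier of a test function is compact, hence covered by finitely many of the
  \<open>U i\<close>.\<close>

lemma content_UN:
  fixes U :: "nat \<Rightarrow> 'a set"
  assumes U: "\<And>i. openin X (U i)"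
  shows "content (\<Union>i. U i) \<le> (\<Sum>i. content (U i))"
  unfolding content_def[of "\<Union>i. U i"]
proof (rule SUP_least)
  fix f assume f: "f \<in> below (\<Union>i. U i)"
  then obtain K where K: "compactin X K" "K \<subseteq> (\<Union>i. U i)" "\<forall>x \<in> topspace X - K. f x = 0"
    by (auto simp: below_def)
  obtain \<F> where \<F>: "finite \<F>" "\<F> \<subseteq> range U" "K \<subseteq> \<Union>\<F>"
    using K U unfolding compactin_def by (metis (no_types, lifting) imageE)
  obtain N where "finite N" "\<F> = U ` N"
    using finite_subset_image[OF \<F>(1,2)] by auto
  moreover then obtain n where "N \<subseteq> {..<n}"
    using finite_nat_iff_bounded by auto
  ultimately have "K \<subseteq> (\<Union>i<n. U i)" using \<F>(3) by fastforce
  then have "f \<in> below (\<Union>i<n. U i)" using f K by (auto simp: below_def)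
  then have "ennreal (I f) \<le> (\<Sum>i<n. content (U i))"
    using content_upper content_UN_finite[of U n] U order_trans by blast
  also have "\<dots> \<le> (\<Sum>i. content (U i))"
    by (rule sum_le_suminf) auto
  finally show "ennreal (I f) \<le> (\<Sum>i. content (U i))" .
qed

lemma outer_open: "openin X U \<Longrightarrow> outer U = content U"
  unfolding outer_def by (intro antisym INF_lower INF_greatest content_mono) auto

lemma outer_mono: "A \<subseteq> B \<Longrightarrow> outer A \<le> outer B"
  unfolding outer_def by (rule INF_superset_mono) auto

lemma outer_le_content: "openin X U \<Longrightarrow> A \<subseteq> U \<Longrightarrow> outer A \<le> content U"
  unfolding outer_def by (intro INF_lower) auto

lemma outer_UN:
  fixes A :: "nat \<Rightarrow> 'a set"
  assumes A: "\<And>n. A n \<subseteq> topspace X"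
  shows "outer (\<Union>i. A i) \<le> (\<Sum>n. outer (A n))"
proof (rule ennreal_le_epsilon)
  fix b and e :: real assume e: "0 < e" and fin: "(\<Sum>n. outer (A n)) < top"
  \<comment> \<open>Finiteness of the sum makes every term finite, so the added error is a strict
    increase and some open set undercuts the infimum.\<close>
  then have "outer (A n) < outer (A n) + ennreal (e * (1/2)^Suc n)" for n
    by (auto simp add: less_top dest!: ennreal_suminf_lessD)
  then have "\<exists>U. openin X U \<and> A n \<subseteq> U \<and> content U < outer (A n) + ennreal (e * (1/2)^Suc n)" for n
    unfolding outer_def by (subst (asm) (1) INF_less_iff) auto
  then obtain U where U: "\<And>n. openin X (U n)" "\<And>n. A n \<subseteq> U n"
    "\<And>n. content (U n) < outer (A n) + ennreal (e * (1/2)^Suc n)"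
    by metis
  have "outer (\<Union>i. A i) \<le> content (\<Union>i. U i)"
    using U by (intro outer_le_content) auto
  also have "\<dots> \<le> (\<Sum>i. content (U i))"
    using U(1) by (rule content_UN)
  also have "\<dots> \<le> (\<Sum>n. outer (A n) + ennreal (e * (1/2) ^ Suc n))"
    using U(3) by (intro suminf_le allI less_imp_le) auto
  also have "\<dots> = (\<Sum>n. outer (A n)) + (\<Sum>n. ennreal e * ennreal ((1/2) ^ Suc n))"
    using e by (subst suminf_add[symmetric])
      (auto simp del: ennreal_suminf_cmult simp add: ennreal_mult[symmetric])
  also have "\<dots> = (\<Sum>n. outer (A n)) + e"
    unfolding ennreal_suminf_cmult
    by (subst suminf_ennreal_eq[OF zero_le_power power_half_series]) auto
  finally show "outer (\<Union>i. A i) \<le> (\<Sum>n. outer (A n)) + e" .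
qed

lemma outer_measure_space_outer: "outer_measure_space (Pow (topspace X)) outer"
  unfolding outer_measure_space_def positive_def increasing_def countably_subadditive_def
  using outer_open[OF openin_empty] content_empty
  by (auto intro: outer_mono outer_UN)

text \<open>If f is carried by a compact K inside U \<inter> V and g by a compact subset of U - K,
  then f + g is again a test function for U. Suprema over g and then over f give the Caratheodory
  inequality for an open test set, U - K being open and containing U - V.\<close>

lemma content_split:
  assumes U: "openin X U" and V: "openin X V"
  shows "content (U \<inter> V) + outer (U - V) \<le> content U"
proof -
  have *: "ennreal (I f) + outer (U - V) \<le> content U" if f: "f \<in> below (U \<inter> V)" for f
  proof -
    from f obtain K where K: "compactin X K" "K \<subseteq> U \<inter> V" "\<forall>x \<in> topspace X - K. f x = 0"
      by (auto simp: below_def)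
    have op: "openin X (U - K)"
      using U K(1) compact_closed by blast
    have f0: "f \<in> Cc_real X" "0 \<le> I f"
      using f by (auto simp: below_def intro: I_nonneg)
    have "ennreal (I f) + content (U - K) = (SUP g \<in> below (U - K). ennreal (I f) + ennreal (I g))"
      unfolding content_def using zero_in_below by (subst ennreal_SUP_add_right) auto
    also have "\<dots> \<le> content U"
    proof (rule SUP_least)
      fix g assume g: "g \<in> below (U - K)"
      then obtain L where L: "compactin X L" "L \<subseteq> U - K" "\<forall>x \<in> topspace X - L. g x = 0"
        by (auto simp: below_def)
      have g0: "g \<in> Cc_real X" "0 \<le> I g"
        using g by (auto simp: below_def intro: I_nonneg)
      have "f x + g x \<le> 1" if "x \<in> topspace X" for x
      proof (cases "x \<in> K")
        case True
        then have "g x = 0" using L(2,3) that by auto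
        then show ?thesis using f that by (simp add: below_def)
      next
        case False
        then have "f x = 0" using K(3) that by auto
        then show ?thesis using g that by (simp add: below_def)
      qed
      then have "(\<lambda>x. f x + g x) \<in> below U"
        unfolding below_def using f g K L f0 g0
        by (auto simp: below_def intro!: Cc_real_add exI[of _ "K \<union> L"] compactin_Un)
      then show "ennreal (I f) + ennreal (I g) \<le> content U"
        using content_upper I_add[OF f0(1) g0(1)] f0(2) g0(2) by (metis ennreal_plus)
    qed
    finally have "ennreal (I f) + content (U - K) \<le> content U" .
    moreover have "outer (U - V) \<le> content (U - K)"
      using op K(2) by (intro outer_le_content) auto
    ultimately show ?thesis by (meson add_left_mono order_trans)
  qed
  have "content (U \<inter> V) + outer (U - V) = (SUP f \<in> below (U \<inter> V). ennreal (I f) + outer (U - V))"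
    unfolding content_def using zero_in_below by (subst ennreal_SUP_add_left) auto
  also have "\<dots> \<le> content U" using * by (rule SUP_least)
  finally show ?thesis .
qed

text \<open>For an arbitrary A the inequality is inherited from the open sets containing A, over
  which \<open>outer\<close> is an infimum.\<close>

lemma open_caratheodory:
  assumes V: "openin X V"
  shows "V \<in> lambda_system (topspace X) (Pow (topspace X)) outer"
proof -
  have "outer (A \<inter> V) + outer (A - V) = outer A" if A: "A \<subseteq> topspace X" for A
  proof (rule antisym)
    show "outer (A \<inter> V) + outer (A - V) \<le> outer A"
      unfolding outer_def[of A]
    proof (rule INF_greatest, clarify)
      fix U assume U: "openin X U" "A \<subseteq> U"
      have "outer (A \<inter> V) + outer (A - V) \<le> content (U \<inter> V) + outer (U - V)"
        using U V by (intro add_mono outer_le_content outer_mono) auto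
      then show "outer (A \<inter> V) + outer (A - V) \<le> content U"
        using content_split[OF U(1) V] by simp
    qed
    have "subadditive (Pow (topspace X)) outer"
      using outer_measure_space_outer
      by (intro ring_of_sets.countably_subadditive_subadditive[OF ring_of_sets_Pow])
        (auto simp: outer_measure_space_def)
    then have "outer ((A \<inter> V) \<union> (A - V)) \<le> outer (A \<inter> V) + outer (A - V)"
      using A by (intro subadditiveD) auto
    then show "outer A \<le> outer (A \<inter> V) + outer (A - V)"
      by (simp add: Int_Diff_Un)
  qed
  then show ?thesis
    using openin_subset[OF V] by (simp add: algebra.lambda_system_eq[OF algebra_Pow])
qed

definition riesz :: "'a measure" where
  "riesz = measure_of (topspace X) {U. openin X U} outer"

lemma sets_riesz: "sets riesz = sets (borel_of X)"
  unfolding riesz_def sets_borel_of by (rule sets_measure_of) (auto dest: openin_subset)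

lemma emeasure_riesz:
  assumes "A \<in> sets (borel_of X)" shows "emeasure riesz A = outer A"
proof -
  let ?L = "lambda_system (topspace X) (Pow (topspace X)) outer"
  have L: "measure_space (topspace X) ?L outer"
    using sigma_algebra.caratheodory_lemma[OF sigma_algebra_Pow outer_measure_space_outer] .
  then have "sigma_sets (topspace X) {U. openin X U} \<subseteq> ?L"
    using open_caratheodory
    by (intro sigma_algebra.sigma_sets_subset) (auto simp: measure_space_def)
  then have "measure_space (topspace X) (sigma_sets (topspace X) {U. openin X U}) outer"
    by (intro measure_down[OF L] sigma_algebra_sigma_sets) (auto dest: openin_subset)
  then show ?thesis
    using assms sets_riesz sets_borel_of[of X]
    by (intro emeasure_measure_of[OF riesz_def])
      (auto simp: measure_space_def dest: openin_subset)
qed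

end

lemma closed_borel_of: "closedin X C \<Longrightarrow> C \<in> sets (borel_of X)"
  unfolding sets_borel_of
  by (metis (mono_tags) closedin_def double_diff mem_Collect_eq sigma_sets.Basic sigma_sets.Compl subset_refl)

section \<open>Comparison of the functional with its measure\<close>

context positive_functional
begin

lemma I_le_outer:
  assumes "g \<in> Cc_real X" "\<And>x. x \<in> topspace X \<Longrightarrow> 0 \<le> g x \<and> g x \<le> 1"
    and "compactin X L" "\<And>x. x \<in> topspace X \<Longrightarrow> x \<notin> L \<Longrightarrow> g x = 0"
  shows "ennreal (I g) \<le> outer L"
  unfolding outer_def
proof (rule INF_greatest)
  fix U assume "U \<in> {U. openin X U \<and> L \<subseteq> U}"
  then have "g \<in> below U" using assms by (auto simp: below_def)
  then show "ennreal (I g) \<le> content U" by (rule content_upper)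
qed

text \<open>For 0 < c < 1 the set where g > c is open and contains L, and each of its test functions
  h satisfies c h \<le> g. Hence \<open>outer L\<close> is at most I g / c, and c tends to
  1.\<close>

lemma outer_le_I:
  assumes g: "g \<in> Cc_real X" "\<And>x. x \<in> topspace X \<Longrightarrow> 0 \<le> g x"
    and L: "L \<subseteq> topspace X" "\<And>x. x \<in> L \<Longrightarrow> 1 \<le> g x"
  shows "outer L \<le> ennreal (I g)"
proof -
  have *: "outer L \<le> ennreal (I g / c)" if c: "0 < c" "c < 1" for c
  proof -
    let ?U = "{x \<in> topspace X. g x \<in> {c<..}}"
    have "openin X ?U"
      using Cc_real_continuous[OF g(1)] by (rule openin_continuous_map_preimage) auto
    then have "outer L \<le> content ?U"
      using L c by (intro outer_le_content) force+
    also have "\<dots> \<le> ennreal (I g / c)"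
      unfolding content_def
    proof (rule SUP_least)
      fix h assume h: "h \<in> below ?U"
      then have hC: "h \<in> Cc_real X" by (simp add: below_def)
      have "c * h x \<le> g x" if x: "x \<in> topspace X" for x
      proof (cases "g x > c")
        case True
        have "h x \<le> 1" using h x by (simp add: below_def)
        then have "c * h x \<le> c" using c by (simp add: mult_left_le)
        with True show ?thesis by linarith
      next
        case False
        then have "h x = 0" using h x by (auto simp: below_def)
        then show ?thesis using g(2)[OF x] by simp
      qed
      then have "c * I h \<le> I g"
        using I_mono[OF Cc_real_scale[OF hC, of c] g(1)] I_scale[OF hC, of c] by simp
      then show "ennreal (I h) \<le> ennreal (I g / c)"
        using c by (intro ennreal_leI) (simp add: field_simps)
    qed
    finally show ?thesis .
  qed
  have pos: "0 \<le> I g" using g by (intro I_nonneg) auto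
  obtain r where r: "0 \<le> r" "outer L = ennreal r"
    using *[of "1/2"] by (cases "outer L") (auto simp: top_unique)
  have "c * r \<le> I g" if "0 < c" "c < 1" for c
    using *[OF that] r pos that by (simp add: field_simps)
  then have "r \<le> I g" by (rule field_le_mult_one_interval)
  then show ?thesis using r by (simp add: ennreal_leI)
qed

lemma emeasure_riesz_compact: "compactin X K \<Longrightarrow> emeasure riesz K = outer K"
  by (simp add: closed_borel_of compact_closed emeasure_riesz)

lemma emeasure_riesz_open: "openin X U \<Longrightarrow> emeasure riesz U = content U"
  by (simp add: emeasure_riesz outer_open sets_borel_of sigma_sets.Basic)

text \<open>Outer regularity is built into \<open>outer\<close>; inner regularity on open sets holds
  because the value at a test function is bounded by the measure of its compact carrier.\<close>

lemma radon_riesz: "radon_measure X riesz"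
  unfolding radon_measure_def
proof (intro conjI allI impI ballI)
  show "emeasure riesz K < \<infinity>" if K: "compactin X K" for K
  proof -
    obtain f where "f \<in> Cc_real X" "\<And>x. x \<in> topspace X \<Longrightarrow> 0 \<le> f x \<and> f x \<le> 1" "\<And>x. x \<in> K \<Longrightarrow> f x = 1"
      using urysohn_Cc[OF K openin_topspace] compactin_subset_topspace[OF K] by metis
    then have "outer K \<le> ennreal (I f)"
      using compactin_subset_topspace[OF K] by (intro outer_le_I) auto
    then show ?thesis
      using emeasure_riesz_compact[OF K] by (simp add: order_le_less_trans)
  qed
  show "emeasure riesz A = (INF U \<in> {U. openin X U \<and> A \<subseteq> U}. emeasure riesz U)"
    if "A \<in> sets riesz" for A
    using that by (auto simp: sets_riesz emeasure_riesz outer_def emeasure_riesz_open intro!: INF_cong)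
  show "emeasure riesz U = (SUP K \<in> {K. compactin X K \<and> K \<subseteq> U}. emeasure riesz K)"
    if U: "openin X U" for U
  proof (rule antisym)
    show "emeasure riesz U \<le> (SUP K \<in> {K. compactin X K \<and> K \<subseteq> U}. emeasure riesz K)"
      unfolding emeasure_riesz_open[OF U] content_def
    proof (rule SUP_least)
      fix f assume f: "f \<in> below U"
      then obtain K where K: "compactin X K" "K \<subseteq> U" "\<And>x. x \<in> topspace X \<Longrightarrow> x \<notin> K \<Longrightarrow> f x = 0"
        by (auto simp: below_def)
      have "ennreal (I f) \<le> emeasure riesz K"
        using f K by (subst emeasure_riesz_compact) (auto simp: below_def intro!: I_le_outer)
      with K show "ennreal (I f) \<le> (SUP K \<in> {K. compactin X K \<and> K \<subseteq> U}. emeasure riesz K)"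
        by (auto intro: SUP_upper2)
    qed
    show "(SUP K \<in> {K. compactin X K \<and> K \<subseteq> U}. emeasure riesz K) \<le> emeasure riesz U"
      using U by (auto intro!: SUP_least emeasure_mono simp: sets_riesz sets_borel_of sigma_sets.Basic)
  qed
qed (rule sets_riesz)

text \<open>The functional and the integral both lie between the same Riemann-type sums of the measures
  of the superlevel sets.\<close>

lemma integral_riesz_unit:
  assumes f: "f \<in> Cc_real X" "\<And>x. x \<in> topspace X \<Longrightarrow> 0 \<le> f x \<and> f x \<le> 1"
  shows "integral\<^sup>L riesz f = I f"
proof -
  have M: "locally_finite_borel X riesz"
    by (rule radon_locally_finite[OF radon_riesz])
  have space: "space riesz = topspace X" by (rule lfb_space[OF M])
  obtain K where K: "compactin X K" "\<And>x. x \<in> topspace X \<Longrightarrow> x \<notin> K \<Longrightarrow> f x = 0"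
    using f(1) by (rule Cc_realE) blast
  have KX: "K \<subseteq> topspace X" using K(1) compactin_subset_topspace by blast
  have bound: "real n * \<bar>integral\<^sup>L riesz f - I f\<bar> \<le> measure riesz K" if n: "n > 0" for n
  proof -
    \<comment> \<open>f is sliced into n horizontal layers of height 1/n. \<open>g k\<close> is the
      k-th layer stretched to height 1, so it lies between the indicators of
      \<open>L (Suc k)\<close> and \<open>L k\<close>, and the \<open>g k\<close> with k < n add up
      to n f.\<close>
    define L where "L k = {x \<in> K. real k / n \<le> f x}" for k
    define g where "g k x = n * max 0 (min (f x - real k / n) (1 / n))" for k x
    define a where "a k = measure riesz (L k)" for k
    have Lc: "compactin X (L k)" for k
    proof -
      have "closedin X {x \<in> topspace X. f x \<in> {real k / n..}}"
        using Cc_real_continuous[OF f(1)] by (rule closedin_continuous_map_preimage) auto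
      moreover have "L k = {x \<in> topspace X. f x \<in> {real k / n..}} \<inter> K"
        using KX by (auto simp: L_def)
      ultimately show ?thesis using K(1) closed_Int_compactin by metis
    qed
    have em: "emeasure riesz (L k) = ennreal (a k)" for k
      unfolding a_def using M Lc[of k] emeasure_eq_ennreal_measure
      by (auto simp: locally_finite_borel_def less_top[symmetric])
    have gC: "g k \<in> Cc_real X" for k
    proof (rule Cc_realI[OF _ K(1)])
      show "continuous_map X euclideanreal (g k)"
        unfolding g_def using f(1)
        by (auto intro!: continuous_intros continuous_map_real_max continuous_map_real_min dest: Cc_real_continuous)
      show "g k x = 0" if "x \<in> topspace X" "x \<notin> K" for x
        using that K(2) by (simp add: g_def max_absorb1 min.coboundedI1)
    qed
    have g01: "0 \<le> g k x" "g k x \<le> 1" for k x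
      unfolding g_def using n by (auto simp: max_def min_def field_simps)
    have g0: "g k x = 0" if "x \<in> topspace X" "x \<notin> L k" for k x
    proof -
      have "f x - real k / n \<le> 0" using that K(2)[of x] by (cases "x \<in> K") (auto simp: L_def)
      then show ?thesis by (simp add: g_def max_absorb1 min.coboundedI1)
    qed
    have g1: "g k x = 1" if "x \<in> L (Suc k)" for k x
    proof -
      have "1 / n \<le> f x - real k / n" using that by (simp add: L_def add_divide_distrib)
      then show ?thesis using n by (simp add: g_def min_absorb2)
    qed
    have nf: "(\<Sum>k<n. g k x) = n * f x" if x: "x \<in> topspace X" for x
    proof -
      have "(\<Sum>k<m. g k x) = n * min (f x) (real m / n)" for m
      proof (induction m)
        case (Suc m)
        have "min (f x) (r + d) = min (f x) r + max 0 (min (f x - r) d)" if "0 < d" for r d :: real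
          using that by (auto simp: max_def min_def)
        from this[of "1 / n" "real m / n"] n
        have "min (f x) (real (Suc m) / n) = min (f x) (real m / n) + max 0 (min (f x - real m / n) (1 / n))"
          by (simp add: add_divide_distrib add.commute)
        with Suc show ?case by (simp add: g_def distrib_left)
      qed (use f(2)[OF x] in simp)
      from this[of n] show ?thesis using n f(2)[OF x] by simp
    qed
    have I1: "I (g k) \<le> a k" for k
    proof -
      have "ennreal (I (g k)) \<le> ennreal (a k)"
        using I_le_outer[OF gC _ Lc g0, of k k] g01 emeasure_riesz_compact[OF Lc[of k]] em[of k] by simp
      then show ?thesis by (simp add: a_def)
    qed
    have I2: "a (Suc k) \<le> I (g k)" for k
    proof -
      have "ennreal (a (Suc k)) \<le> ennreal (I (g k))"
        using outer_le_I[OF gC[of k] g01(1) compactin_subset_topspace[OF Lc[of "Suc k"]]] g1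
          emeasure_riesz_compact[OF Lc[of "Suc k"]] em[of "Suc k"]
        by simp
      then show ?thesis
        using I_nonneg[OF gC[of k]] g01(1) by (subst (asm) ennreal_le_iff) auto
    qed
    have ind: "integrable riesz (indicator (L k) :: _ \<Rightarrow> real)" for k
      using lfb_compact[OF M Lc[of k]] em[of k] by (simp add: integrable_indicator_iff)
    have int_ind: "integral\<^sup>L riesz (indicator (L k)) = a k" for k
      using lfb_compact[OF M Lc[of k]] sets.sets_into_space[of "L k" riesz]
      by (simp add: a_def Int_absorb1)
    have gi: "integrable riesz (g k)" for k by (rule lfb_Cc_integrable[OF M gC])
    have J1: "integral\<^sup>L riesz (g k) \<le> a k" for k
      unfolding int_ind[symmetric]
      by (rule integral_mono[OF gi ind]) (use g01 g0 space in \<open>auto simp: indicator_def\<close>)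
    have J2: "a (Suc k) \<le> integral\<^sup>L riesz (g k)" for k
      unfolding int_ind[symmetric]
      by (rule integral_mono[OF ind gi]) (use g01 g1 space in \<open>auto simp: indicator_def\<close>)
    have "n * I f = I (\<lambda>x. \<Sum>k<n. g k x)"
      using I_cong[OF Cc_real_scale[OF f(1), of n] Cc_real_sum[of "{..<n}" g]] gC nf
        I_scale[OF f(1)] by simp
    then have A: "n * I f = (\<Sum>k<n. I (g k))"
      using I_sum[of "{..<n}" g] gC by simp
    have "n * integral\<^sup>L riesz f = integral\<^sup>L riesz (\<lambda>x. \<Sum>k<n. g k x)"
      using nf space by (subst integral_mult_right_zero[symmetric]) (intro Bochner_Integration.integral_cong, auto)
    then have B: "n * integral\<^sup>L riesz f = (\<Sum>k<n. integral\<^sup>L riesz (g k))"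
      using gi by simp
    \<comment> \<open>Upper and lower sums differ by a 0 - a n, hence by at most the measure of K,
      whatever n is.\<close>
    have sumS: "(\<Sum>k<n. a k) \<le> (\<Sum>k<n. a (Suc k)) + a 0"
      using sum.lessThan_Suc_shift[of a n] sum.lessThan_Suc[of a n] measure_nonneg[of riesz "L n"]
      unfolding a_def by linarith
    have "(\<Sum>k<n. a (Suc k)) \<le> (\<Sum>k<n. I (g k))" "(\<Sum>k<n. I (g k)) \<le> (\<Sum>k<n. a k)"
      "(\<Sum>k<n. a (Suc k)) \<le> (\<Sum>k<n. integral\<^sup>L riesz (g k))" "(\<Sum>k<n. integral\<^sup>L riesz (g k)) \<le> (\<Sum>k<n. a k)"
      using I1 I2 J1 J2 by (auto intro: sum_mono)
    then have "\<bar>n * integral\<^sup>L riesz f - n * I f\<bar> \<le> a 0"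
      using sumS unfolding A B by linarith
    moreover have "L 0 = K" using f(2) KX by (auto simp: L_def)
    moreover have "\<bar>n * integral\<^sup>L riesz f - n * I f\<bar> = n * \<bar>integral\<^sup>L riesz f - I f\<bar>"
      by (metis abs_mult abs_of_nat right_diff_distrib)
    ultimately show ?thesis by (simp add: a_def)
  qed
  show ?thesis
  proof (rule ccontr)
    assume "integral\<^sup>L riesz f \<noteq> I f"
    then obtain n :: nat where "measure riesz K < n * \<bar>integral\<^sup>L riesz f - I f\<bar>"
      using reals_Archimedean3[of "\<bar>integral\<^sup>L riesz f - I f\<bar>"] by auto
    with bound[of n] measure_nonneg[of riesz K] show False
      by (cases "n = 0") auto
  qed
qed

lemma integral_riesz:
  assumes f: "f \<in> Cc_real X"
  shows "integral\<^sup>L riesz f = I f"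
proof -
  have M: "locally_finite_borel X riesz"
    by (rule radon_locally_finite[OF radon_riesz])
  obtain B where B: "B \<ge> 0" "\<And>x. x \<in> topspace X \<Longrightarrow> \<bar>f x\<bar> \<le> B"
    using f by (rule Cc_real_bounded) blast
  \<comment> \<open>The added 1 keeps c positive when B = 0. After scaling by c, the positive and
    the negative part of f take values in [0,1].\<close>
  define c where "c = 1 / (B + 1)"
  have c: "c > 0" "c * B \<le> 1" using B(1) by (auto simp: c_def field_simps)
  let ?p = "\<lambda>x. c * max 0 (f x)" and ?n = "\<lambda>x. c * max 0 (- f x)"
  obtain K where K: "compactin X K" "\<And>x. x \<in> topspace X \<Longrightarrow> x \<notin> K \<Longrightarrow> f x = 0"
    using f by (rule Cc_realE) blast
  have Cc: "?p \<in> Cc_real X" "?n \<in> Cc_real X"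
    using f K(2) by (auto intro!: Cc_realI[OF _ K(1)] continuous_intros continuous_map_real_max dest: Cc_real_continuous)
  have b: "c * max 0 (f x) \<le> 1" "c * max 0 (- f x) \<le> 1" if "x \<in> topspace X" for x
  proof -
    have "max 0 (f x) \<le> B" "max 0 (- f x) \<le> B" using B(1) B(2)[OF that] by auto
    then show "c * max 0 (f x) \<le> 1" "c * max 0 (- f x) \<le> 1"
      using c by (meson less_imp_le mult_left_mono order_trans)+
  qed
  have "integral\<^sup>L riesz ?p = I ?p" "integral\<^sup>L riesz ?n = I ?n"
    using c b by (intro integral_riesz_unit Cc; simp)+
  then have "integral\<^sup>L riesz (\<lambda>x. ?p x - ?n x) = I (\<lambda>x. ?p x - ?n x)"
    by (subst Bochner_Integration.integral_diff[OF lfb_Cc_integrable[OF M Cc(1)] lfb_Cc_integrable[OF M Cc(2)]])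
      (simp only: I_diff[OF Cc])
  moreover have "(\<lambda>x. ?p x - ?n x) = (\<lambda>x. c * f x)"
    by (auto simp: max_def)
  ultimately show ?thesis
    using c(1) I_scale[OF f, of c] by simp
qed

theorem riesz_representation: "\<exists>M. radon_measure X M \<and> (\<forall>f \<in> Cc_real X. integral\<^sup>L M f = I f)"
  using radon_riesz integral_riesz by blast

end

text \<open>Inner regularity reduces the claim to compact subsets C of U, and the indicator of C is
  dominated by a Urysohn function of the tested kind. This is how a measure obtained from a
  functional is shown to sit on a fibre.\<close>

lemma (in lch_space) radon_null_open:
  assumes M: "radon_measure X M" and U: "openin X U"
    and zero: "\<And>f. f \<in> Cc_real X \<Longrightarrow> (\<And>x. x \<in> topspace X \<Longrightarrow> 0 \<le> f x \<and> f x \<le> 1) \<Longrightarrow>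
      (\<And>x. x \<in> topspace X \<Longrightarrow> x \<notin> U \<Longrightarrow> f x = 0) \<Longrightarrow> integral\<^sup>L M f = 0"
  shows "emeasure M U = 0"
proof -
  note lfb = radon_locally_finite[OF M]
  have "emeasure M C = 0" if C: "compactin X C" "C \<subseteq> U" for C
  proof -
    obtain f where f: "f \<in> Cc_real X" "\<And>x. x \<in> topspace X \<Longrightarrow> 0 \<le> f x \<and> f x \<le> 1"
      "\<And>x. x \<in> C \<Longrightarrow> f x = 1" "\<And>x. x \<in> topspace X \<Longrightarrow> x \<notin> U \<Longrightarrow> f x = 0"
      using urysohn_Cc[OF C(1) U C(2)] by blast
    have CX: "C \<inter> topspace X = C" using compactin_subset_topspace[OF C(1)] by blast
    have "integral\<^sup>L M (indicator C) \<le> integral\<^sup>L M f"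
      using f(2,3) lfb_space[OF lfb] lfb_compact[OF lfb C(1)] lfb C(1) CX
      by (intro integral_mono lfb_Cc_integrable[OF lfb f(1)])
        (auto simp: integrable_indicator_iff locally_finite_borel_def indicator_def)
    then have "measure M C \<le> 0"
      using zero[OF f(1,2,4)] lfb_space[OF lfb] CX by simp
    then have "measure M C = 0" using measure_nonneg[of M C] by linarith
    then show ?thesis
      using lfb C(1) unfolding locally_finite_borel_def
      by (metis emeasure_eq_ennreal_measure ennreal_0 infinity_ennreal_def less_irrefl)
  qed
  then have "(SUP C \<in> {C. compactin X C \<and> C \<subseteq> U}. emeasure M C) = 0"
    by (intro antisym SUP_least) auto
  then show ?thesis using M U unfolding radon_measure_def by metis
qed

section \<open>Systems of measures on the fibres of a map\<close>

lemma continuous_map_real_iff: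
  fixes f :: "'a \<Rightarrow> real"
  shows "continuous_map P euclideanreal f \<longleftrightarrow>
    (\<forall>p \<in> topspace P. \<forall>e>0. \<exists>N. openin P N \<and> p \<in> N \<and> (\<forall>p' \<in> N. \<bar>f p' - f p\<bar> < e))"
  using Met_TC.continuous_map_to_metric[of P f]
  by (simp add: dist_real_def abs_minus_commute)

lemma closedin_fibre:
  assumes "Hausdorff_space Y" "continuous_map X Y f"
  shows "closedin X {x \<in> topspace X. f x = y}"
proof (cases "y \<in> topspace Y")
  case True
  then show ?thesis
    using closedin_continuous_map_preimage[OF assms(2), of "{y}"] closedin_Hausdorff_singleton[OF assms(1)]
    by simp
next
  case False
  then have "{x \<in> topspace X. f x = y} = {}"
    using assms(2) continuous_map_image_subset_topspace by fastforce
  then show ?thesis by (metis closedin_empty)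
qed

text \<open>A continuous system of measures along \<pi> whose members may miss parts of the fibre.
  Haar systems are the case where \<pi> is the range map; the systems along \<rho> sit on compact
  parts of the fibres.\<close>

locale fibre_system = lch_space X for X :: "'x topology" +
  fixes Y :: "'y topology" and \<pi> :: "'x \<Rightarrow> 'y" and \<beta> :: "'y \<Rightarrow> 'x measure"
  assumes Y_hausdorff: "Hausdorff_space Y"
    and \<pi>: "continuous_map X Y \<pi>"
    and \<beta>_lfb: "y \<in> topspace Y \<Longrightarrow> locally_finite_borel X (\<beta> y)"
    and \<beta>_fibre: "y \<in> topspace Y \<Longrightarrow> AE x in \<beta> y. \<pi> x = y"
    and \<beta>_continuous: "f \<in> Cc_real X \<Longrightarrow> continuous_map Y euclideanreal (\<lambda>y. integral\<^sup>L (\<beta> y) f)"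
begin

definition fibre :: "'y \<Rightarrow> 'x set" where
  "fibre y = {x \<in> topspace X. \<pi> x = y}"

text \<open>Integration is confined to the fibre because integrands such as
  \<open>f (mul G x y)\<close> or \<open>f (transporter x w)\<close> mean nothing outside
  it.\<close>

definition fint :: "'y \<Rightarrow> ('x \<Rightarrow> real) \<Rightarrow> real" where
  "fint y F = (LINT x:fibre y|\<beta> y. F x)"

definition fibre_Cc :: "'y \<Rightarrow> ('x \<Rightarrow> real) \<Rightarrow> bool" where
  "fibre_Cc y F \<longleftrightarrow> continuous_map (subtopology X (fibre y)) euclideanreal F \<and>
     (\<exists>K. compactin X K \<and> (\<forall>x \<in> fibre y - K. F x = 0))"

lemma closed_fibre: "closedin X (fibre y)"
  unfolding fibre_def by (rule closedin_fibre[OF Y_hausdorff \<pi>])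

lemma fibre_Cc_extend:
  assumes "fibre_Cc y F"
  obtains g where "g \<in> Cc_real X" "\<And>x. x \<in> fibre y \<Longrightarrow> g x = F x"
  using assms extend_Cc[OF closed_fibre] unfolding fibre_Cc_def by (metis DiffI)

lemma Cc_fibre_Cc:
  assumes "g \<in> Cc_real X" "\<And>x. x \<in> fibre y \<Longrightarrow> g x = F x"
  shows "fibre_Cc y F"
proof -
  have "continuous_map (subtopology X (fibre y)) euclideanreal F"
    using assms(2) by (intro continuous_map_eq[OF continuous_map_from_subtopology[OF Cc_real_continuous[OF assms(1)]]]) simp
  moreover obtain K where "compactin X K" "\<And>x. x \<in> topspace X \<Longrightarrow> x \<notin> K \<Longrightarrow> g x = 0"
    using assms(1) by (rule Cc_realE) blast
  ultimately show ?thesis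
    using assms(2) unfolding fibre_Cc_def fibre_def by (metis (no_types, lifting) DiffE mem_Collect_eq)
qed

lemma fint_cong: "(\<And>x. x \<in> fibre y \<Longrightarrow> F x = G x) \<Longrightarrow> fint y F = fint y G"
  unfolding fint_def set_lebesgue_integral_def
  by (intro Bochner_Integration.integral_cong) (auto simp: indicator_def)

lemma fibre_measurable: "y \<in> topspace Y \<Longrightarrow> fibre y \<in> sets (\<beta> y)"
  using lfb_closed[OF \<beta>_lfb closed_fibre] .

lemma fibre_Cc_integrable:
  assumes y: "y \<in> topspace Y" and F: "fibre_Cc y F"
  shows "set_integrable (\<beta> y) (fibre y) F"
proof -
  obtain g where g: "g \<in> Cc_real X" "\<And>x. x \<in> fibre y \<Longrightarrow> g x = F x"
    using F by (rule fibre_Cc_extend) blast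
  have "set_integrable (\<beta> y) (fibre y) g"
    unfolding set_integrable_def
    using fibre_measurable[OF y] lfb_Cc_integrable[OF \<beta>_lfb[OF y] g(1)]
    by (rule integrable_mult_indicator)
  then show ?thesis
    unfolding set_integrable_def
    by (rule back_subst[where P = "integrable (\<beta> y)"]) (auto simp: indicator_def g(2))
qed

text \<open>The bridge between integrands known on a fibre only and the continuity axiom, which
  speaks of functions on all of X.\<close>

lemma fint_Cc:
  assumes y: "y \<in> topspace Y" and g: "g \<in> Cc_real X" "\<And>x. x \<in> fibre y \<Longrightarrow> g x = F x"
  shows "fint y F = integral\<^sup>L (\<beta> y) g"
proof -
  note M = \<beta>_lfb[OF y]
  have "AE x in \<beta> y. x \<in> fibre y"
    using \<beta>_fibre[OF y] AE_space[of "\<beta> y"] by eventually_elim (simp add: fibre_def lfb_space[OF M])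
  then have "integral\<^sup>L (\<beta> y) g = fint y g"
    unfolding fint_def set_lebesgue_integral_def
    using borel_measurable_integrable[OF lfb_Cc_integrable[OF M g(1)]] fibre_measurable[OF y]
    by (intro integral_cong_AE) auto
  with g(2) show ?thesis using fint_cong[of y F g] by simp
qed

lemma fint_add:
  assumes "y \<in> topspace Y" "fibre_Cc y F" "fibre_Cc y G"
  shows "fint y (\<lambda>x. F x + G x) = fint y F + fint y G"
  using assms fibre_Cc_integrable unfolding fint_def by (intro set_integral_add) auto

lemma fint_diff:
  assumes "y \<in> topspace Y" "fibre_Cc y F" "fibre_Cc y G"
  shows "fint y (\<lambda>x. F x - G x) = fint y F - fint y G"
  using assms fibre_Cc_integrable unfolding fint_def by (intro set_integral_diff) auto

lemma fint_scale: "fint y (\<lambda>x. c * F x) = c * fint y F"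
  unfolding fint_def by simp

lemma fint_nonneg: "(\<And>x. x \<in> fibre y \<Longrightarrow> 0 \<le> F x) \<Longrightarrow> 0 \<le> fint y F"
  unfolding fint_def set_lebesgue_integral_def
  by (intro integral_nonneg_AE AE_I2) (auto simp: indicator_def)

lemma fint_mono:
  assumes "y \<in> topspace Y" "fibre_Cc y F" "fibre_Cc y G" "\<And>x. x \<in> fibre y \<Longrightarrow> F x \<le> G x"
  shows "fint y F \<le> fint y G"
  using fint_nonneg[of y "\<lambda>x. G x - F x"] fint_diff[OF assms(1,3,2)] assms(4) by auto

lemma fint_pos:
  assumes y: "y \<in> topspace Y" and F: "fibre_Cc y F" "\<And>x. x \<in> fibre y \<Longrightarrow> 0 \<le> F x"
    and A: "A \<in> sets (\<beta> y)" "emeasure (\<beta> y) A > 0" "\<And>x. x \<in> A \<Longrightarrow> x \<in> fibre y \<Longrightarrow> 0 < F x"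
  shows "0 < fint y F"
proof (rule ccontr)
  assume "\<not> 0 < fint y F"
  then have "fint y F = 0" using fint_nonneg[of y F] F(2) by fastforce
  then have "AE x in \<beta> y. indicator (fibre y) x *\<^sub>R F x = 0"
    using fibre_Cc_integrable[OF y F(1)] F(2) unfolding fint_def set_lebesgue_integral_def set_integrable_def
    by (subst (asm) integral_nonneg_eq_0_iff_AE) (auto simp: indicator_def)
  with \<beta>_fibre[OF y] AE_space[of "\<beta> y"] have "AE x in \<beta> y. x \<notin> A"
  proof eventually_elim
    case (elim x)
    then have "x \<in> fibre y" by (simp add: fibre_def lfb_space[OF \<beta>_lfb[OF y]])
    with elim A(3)[of x] show ?case by auto
  qed
  then have "emeasure (\<beta> y) A = 0"
    using A(1) sets.sets_into_space[OF A(1)]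
    by (subst (asm) AE_iff_measurable[OF A(1)]) auto
  with A(2) show False by simp
qed

text \<open>Near p0 the moving integrand \<open>F p\<close> is compared with one fixed \<phi> in
  \<open>Cc_real\<close> that extends \<open>F p0\<close>: on the fibre they differ by at most d
  \<psi>, and the integrals of the fixed functions \<phi> and \<psi> are continuous. The support
  condition is local in p, since the carriers of the \<open>F p\<close> may grow with p.\<close>

lemma continuous_fint:
  assumes q: "continuous_map P Y q"
    and F: "continuous_map (subtopology (prod_topology P X) {(p, x). q p = \<pi> x}) euclideanreal (\<lambda>(p, x). F p x)"
    and supp: "\<And>p. p \<in> topspace P \<Longrightarrow> \<exists>N K. openin P N \<and> p \<in> N \<and> compactin X K \<and>
      (\<forall>p' \<in> N. \<forall>x \<in> topspace X. q p' = \<pi> x \<longrightarrow> x \<notin> K \<longrightarrow> F p' x = 0)"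
  shows "continuous_map P euclideanreal (\<lambda>p. fint (q p) (F p))"
    and "\<And>p. p \<in> topspace P \<Longrightarrow> fibre_Cc (q p) (F p)"
proof -
  have qY: "q p \<in> topspace Y" if "p \<in> topspace P" for p
    using q that by (simp add: continuous_map_def Pi_iff)
  show F_Cc: "fibre_Cc (q p) (F p)" if p: "p \<in> topspace P" for p
    unfolding fibre_Cc_def
  proof (intro conjI)
    let ?S = "subtopology X (fibre (q p))"
    have "continuous_map ?S (subtopology (prod_topology P X) {(p, x). q p = \<pi> x}) (\<lambda>x. (p, x))"
      using p by (auto simp: continuous_map_in_subtopology continuous_map_pairwise o_def fibre_def
          continuous_map_from_subtopology)
    from continuous_map_compose[OF this F] show "continuous_map ?S euclideanreal (F p)"
      by (simp add: o_def)
    obtain N K where "p \<in> N" "compactin X K"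
      "\<forall>p' \<in> N. \<forall>x \<in> topspace X. q p' = \<pi> x \<longrightarrow> x \<notin> K \<longrightarrow> F p' x = 0"
      using supp[OF p] by blast
    then show "\<exists>K. compactin X K \<and> (\<forall>x \<in> fibre (q p) - K. F p x = 0)"
      by (auto simp: fibre_def)
  qed
  show "continuous_map P euclideanreal (\<lambda>p. fint (q p) (F p))"
    unfolding continuous_map_real_iff
  proof (intro ballI allI impI)
    fix p0 and e :: real assume p0: "p0 \<in> topspace P" and e: "0 < e"
    obtain N0 K0 where N0: "openin P N0" "p0 \<in> N0" "compactin X K0"
      "\<And>p x. p \<in> N0 \<Longrightarrow> x \<in> topspace X \<Longrightarrow> q p = \<pi> x \<Longrightarrow> x \<notin> K0 \<Longrightarrow> F p x = 0"
      using supp[OF p0] by blast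
    obtain \<phi> where \<phi>: "\<phi> \<in> Cc_real X" "\<And>x. x \<in> fibre (q p0) \<Longrightarrow> \<phi> x = F p0 x"
      using F_Cc[OF p0] by (rule fibre_Cc_extend) blast
    obtain K1 where K1: "compactin X K1" "\<And>x. x \<in> topspace X \<Longrightarrow> x \<notin> K1 \<Longrightarrow> \<phi> x = 0"
      using \<phi>(1) by (rule Cc_realE) blast
    define K where "K = K0 \<union> K1"
    have K: "compactin X K" unfolding K_def using N0(3) K1(1) by (rule compactin_Un)
    obtain \<psi> where \<psi>: "\<psi> \<in> Cc_real X" "\<And>x. x \<in> topspace X \<Longrightarrow> 0 \<le> \<psi> x \<and> \<psi> x \<le> 1" "\<And>x. x \<in> K \<Longrightarrow> \<psi> x = 1"
      using urysohn_Cc[OF K openin_topspace compactin_subset_topspace[OF K]] by metis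
    define A where "A p = integral\<^sup>L (\<beta> (q p)) \<phi>" for p
    define B where "B p = integral\<^sup>L (\<beta> (q p)) \<psi>" for p
    have A: "continuous_map P euclideanreal A" and B: "continuous_map P euclideanreal B"
      using continuous_map_compose[OF q \<beta>_continuous[OF \<phi>(1)]] continuous_map_compose[OF q \<beta>_continuous[OF \<psi>(1)]]
      by (simp_all add: A_def[abs_def] B_def[abs_def] o_def)
    have Bnn: "0 \<le> B p" if "p \<in> topspace P" for p
      unfolding B_def using \<psi>(2) lfb_space[OF \<beta>_lfb[OF qY[OF that]]]
      by (intro integral_nonneg_AE AE_I2) auto
    \<comment> \<open>Chosen so that d (B p0 + 1) = e / 2; close to p0 the integral
      \<open>B p\<close> of \<psi> stays below B p0 + 1.\<close>
    define d where "d = e / (2 * (B p0 + 1))"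
    have d: "d > 0" using e Bnn[OF p0] by (simp add: d_def)
    let ?W = "{(p, x). q p = \<pi> x}" and ?PX = "prod_topology P X"
    let ?D = "\<lambda>(p, x). F p x - \<phi> x"
    have "continuous_map (subtopology ?PX ?W) euclideanreal (\<lambda>z. \<phi> (snd z))"
      using continuous_map_compose[OF continuous_map_snd Cc_real_continuous[OF \<phi>(1)], of P]
      by (simp add: continuous_map_from_subtopology o_def)
    then have "continuous_map (subtopology ?PX ?W) euclideanreal ?D"
      using continuous_map_diff[OF F] by (simp add: case_prod_unfold)
    then have "openin (subtopology ?PX ?W) {z \<in> topspace (subtopology ?PX ?W). ?D z \<in> {-d<..<d}}"
      by (rule openin_continuous_map_preimage) auto
    then obtain U where U: "openin ?PX U" "{z \<in> topspace (subtopology ?PX ?W). ?D z \<in> {-d<..<d}} = U \<inter> ?W"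
      unfolding openin_subtopology by blast
    \<comment> \<open>F is continuous on the fibre product only, whereas the tube lemma asks for an
      open subset of the full product. Adding the complement of the fibre product, which is open as
      Y is Hausdorff, repairs this.\<close>
    have "closedin ?PX {z \<in> topspace ?PX. (q \<circ> fst) z = (\<pi> \<circ> snd) z}"
      using closedin_continuous_maps_eq[OF Y_hausdorff continuous_map_compose[OF continuous_map_fst q]
          continuous_map_compose[OF continuous_map_snd \<pi>]] .
    then have "openin ?PX (topspace ?PX - {z \<in> topspace ?PX. (q \<circ> fst) z = (\<pi> \<circ> snd) z})"
      by blast
    with U(1) have op: "openin ?PX (U \<union> (topspace ?PX - {z \<in> topspace ?PX. (q \<circ> fst) z = (\<pi> \<circ> snd) z}))"
      (is "openin _ ?O") by blast
    have "(p0, x) \<in> ?O" if x: "x \<in> K" for x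
    proof (cases "q p0 = \<pi> x")
      case True
      have xX: "x \<in> topspace X" using x K compactin_subset_topspace by blast
      then have "x \<in> fibre (q p0)" using True by (simp add: fibre_def)
      then have "(p0, x) \<in> {z \<in> topspace (subtopology ?PX ?W). ?D z \<in> {-d<..<d}}"
        using \<phi>(2) d p0 xX True by simp
      then show ?thesis using U(2) by blast
    next
      case False
      then show ?thesis using p0 x compactin_subset_topspace[OF K] by auto
    qed
    then have "{p0} \<times> K \<subseteq> ?O" by blast
    from tube_lemma_right[OF op K p0 this] obtain N1 V where
      N1: "openin P N1" "p0 \<in> N1" "K \<subseteq> V" "N1 \<times> V \<subseteq> ?O" by blast
    obtain N2 where N2: "openin P N2" "p0 \<in> N2" "\<And>p. p \<in> N2 \<Longrightarrow> \<bar>A p - A p0\<bar> < e / 2"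
      using A p0 e unfolding continuous_map_real_iff by (meson half_gt_zero)
    obtain N3 where N3: "openin P N3" "p0 \<in> N3" "\<And>p. p \<in> N3 \<Longrightarrow> \<bar>B p - B p0\<bar> < 1"
      using B p0 unfolding continuous_map_real_iff by (meson zero_less_one)
    have near: "\<bar>fint (q p) (F p) - A p\<bar> \<le> d * B p" if p: "p \<in> N0" "p \<in> N1" for p
    proof -
      have pP: "p \<in> topspace P" using p N0 openin_subset by blast
      have \<phi>f: "fibre_Cc (q p) \<phi>" and \<psi>f: "fibre_Cc (q p) (\<lambda>x. d * \<psi> x)"
        by (rule Cc_fibre_Cc[OF \<phi>(1) refl], rule Cc_fibre_Cc[OF Cc_real_scale[OF \<psi>(1)] refl])
      have bd: "\<bar>F p x - \<phi> x\<bar> \<le> d * \<psi> x" if x: "x \<in> fibre (q p)" for x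
      proof (cases "x \<in> K")
        case True
        then have "(p, x) \<in> ?O" using N1 p by blast
        moreover have "q p = \<pi> x" "x \<in> topspace X" using x by (auto simp: fibre_def)
        ultimately have "(p, x) \<in> U \<inter> ?W" using pP by auto
        then have "?D (p, x) \<in> {-d<..<d}" using U(2) by blast
        then show ?thesis using \<psi>(3)[OF True] by auto
      next
        case False
        then have "F p x = 0" "\<phi> x = 0"
          using x N0(4)[OF p(1), of x] K1(2)[of x] by (auto simp: fibre_def K_def)
        then show ?thesis using \<psi>(2)[of x] x d by (simp add: fibre_def)
      qed
      have "fint (q p) (F p) - fint (q p) \<phi> \<le> fint (q p) (\<lambda>x. d * \<psi> x)"
      proof -
        have "fint (q p) (F p) \<le> fint (q p) (\<lambda>x. \<phi> x + d * \<psi> x)"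
          by (rule fint_mono[OF qY[OF pP] F_Cc[OF pP]
                Cc_fibre_Cc[OF Cc_real_add[OF \<phi>(1) Cc_real_scale[OF \<psi>(1)]] refl]])
            (use bd in \<open>smt (verit)\<close>)
        then show ?thesis using fint_add[OF qY[OF pP] \<phi>f \<psi>f] by simp
      qed
      moreover have "fint (q p) \<phi> - fint (q p) (F p) \<le> fint (q p) (\<lambda>x. d * \<psi> x)"
      proof -
        have "fint (q p) (\<lambda>x. \<phi> x - d * \<psi> x) \<le> fint (q p) (F p)"
          by (rule fint_mono[OF qY[OF pP]
                Cc_fibre_Cc[OF Cc_real_diff[OF \<phi>(1) Cc_real_scale[OF \<psi>(1)]] refl] F_Cc[OF pP]])
            (use bd in \<open>smt (verit)\<close>)
        then show ?thesis using fint_diff[OF qY[OF pP] \<phi>f \<psi>f] by simp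
      qed
      moreover have "fint (q p) \<phi> = A p" "fint (q p) (\<lambda>x. d * \<psi> x) = d * B p"
        using fint_Cc[OF qY[OF pP] \<phi>(1)] fint_Cc[OF qY[OF pP] \<psi>(1)] fint_scale
        by (auto simp: A_def B_def)
      ultimately show ?thesis by linarith
    qed
    have p0A: "fint (q p0) (F p0) = A p0"
      unfolding A_def using fint_Cc[OF qY[OF p0] \<phi>] .
    have "\<bar>fint (q p) (F p) - fint (q p0) (F p0)\<bar> < e" if p: "p \<in> N0 \<inter> N1 \<inter> N2 \<inter> N3" for p
    proof -
      have "d * B p < d * (B p0 + 1)" using N3(3)[of p] p d by auto
      also have "\<dots> = e / 2" using Bnn[OF p0] by (simp add: d_def field_simps)
      finally have "d * B p < e / 2" .
      moreover have "\<bar>fint (q p) (F p) - A p\<bar> \<le> d * B p" "\<bar>A p - A p0\<bar> < e / 2"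
        using near[of p] N2(3)[of p] p by blast+
      ultimately show ?thesis unfolding p0A by linarith
    qed
    then show "\<exists>N. openin P N \<and> p0 \<in> N \<and> (\<forall>p \<in> N. \<bar>fint (q p) (F p) - fint (q p0) (F p0)\<bar> < e)"
      using N0 N1 N2 N3 by (intro exI[of _ "N0 \<inter> N1 \<inter> N2 \<inter> N3"]) auto
  qed
qed

end

section \<open>Systems of measures for open maps\<close>

lemma osc_bounded:
  fixes f :: "'a \<Rightarrow> real"
  assumes "\<And>x x'. x \<in> A \<Longrightarrow> x' \<in> A \<Longrightarrow> \<bar>f x - f x'\<bar> \<le> e"
  shows "\<exists>a b. \<forall>x \<in> A. a \<le> f x \<and> f x \<le> b"
proof (cases "A = {}")
  case False
  then obtain x where x: "x \<in> A" by blast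
  have "f x - e \<le> f x' \<and> f x' \<le> f x + e" if "x' \<in> A" for x'
    using assms[OF x that] by linarith
  then show ?thesis by blast
qed simp

text \<open>There are only countably many finite covers of K by members of a countable base, and for
  every f and e one of them has oscillation at most e on each member. A single sequence of covers
  thus serves all continuous functions; it need not be nested.\<close>

lemma second_countable_oscillation_covers:
  assumes sc: "second_countable X" and K: "compactin X K"
  obtains \<U> :: "nat \<Rightarrow> 'a set set" where
    "\<And>n W. W \<in> \<U> n \<Longrightarrow> openin X W" "\<And>n. K \<subseteq> \<Union>(\<U> n)"
    "\<And>(f :: 'a \<Rightarrow> real) e. continuous_map X euclideanreal f \<Longrightarrow> 0 < e \<Longrightarrow>
       \<exists>n. \<forall>W \<in> \<U> n. \<forall>x \<in> W. \<forall>x' \<in> W. \<bar>f x - f x'\<bar> \<le> e"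
proof -
  obtain \<B> where B: "countable \<B>" "\<And>V. V \<in> \<B> \<Longrightarrow> openin X V"
    "\<And>U x. openin X U \<Longrightarrow> x \<in> U \<Longrightarrow> \<exists>V \<in> \<B>. x \<in> V \<and> V \<subseteq> U"
    using sc unfolding second_countable_def by metis
  define \<C> where "\<C> = {F. finite F \<and> F \<subseteq> \<B> \<and> K \<subseteq> \<Union>F}"
  have sub: "\<exists>F \<in> \<C>. F \<subseteq> \<B>'" if B': "\<B>' \<subseteq> \<B>" "K \<subseteq> \<Union>\<B>'" for \<B>'
  proof -
    have "\<forall>V \<in> \<B>'. openin X V" using B'(1) B(2) by blast
    then obtain F where "finite F" "F \<subseteq> \<B>'" "K \<subseteq> \<Union>F"
      using K B'(2) unfolding compactin_def by meson
    then show ?thesis using B'(1) unfolding \<C>_def by blast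
  qed
  have "K \<subseteq> \<Union>\<B>"
    using B(3)[OF openin_topspace] compactin_subset_topspace[OF K] by blast
  then have ne: "\<C> \<noteq> {}" using sub by blast
  have "countable {F. finite F \<and> F \<subseteq> \<B>}"
    using B(1) by (rule countable_Collect_finite_subset)
  then have "countable \<C>" by (rule countable_subset[rotated]) (auto simp: \<C>_def)
  then have rng: "range (from_nat_into \<C>) = \<C>" by (rule range_from_nat_into[OF ne])
  then have inC: "from_nat_into \<C> n \<in> \<C>" for n by blast
  show thesis
  proof (rule that[of "from_nat_into \<C>"])
    show "openin X W" if "W \<in> from_nat_into \<C> n" for n W
      using that inC[of n] B(2) by (auto simp: \<C>_def)
    show "K \<subseteq> \<Union>(from_nat_into \<C> n)" for n
      using inC[of n] by (simp add: \<C>_def)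
    fix f :: "'a \<Rightarrow> real" and e :: real
    assume f: "continuous_map X euclideanreal f" and e: "0 < e"
    define \<B>' where "\<B>' = {V \<in> \<B>. \<forall>x \<in> V. \<forall>x' \<in> V. \<bar>f x - f x'\<bar> \<le> e}"
    have "K \<subseteq> \<Union>\<B>'"
    proof
      fix x assume "x \<in> K"
      then have xX: "x \<in> topspace X" using compactin_subset_topspace[OF K] by blast
      obtain N where N: "openin X N" "x \<in> N" "\<And>x'. x' \<in> N \<Longrightarrow> \<bar>f x' - f x\<bar> < e / 2"
        using f xX e unfolding continuous_map_real_iff by (meson half_gt_zero)
      obtain V where V: "V \<in> \<B>" "x \<in> V" "V \<subseteq> N" using B(3)[OF N(1,2)] by blast
      have "\<bar>f y - f y'\<bar> \<le> e" if "y \<in> V" "y' \<in> V" for y y'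
      proof -
        have "\<bar>f y - f x\<bar> < e / 2" "\<bar>f y' - f x\<bar> < e / 2"
          using N(3) V(3) that by blast+
        then show ?thesis by linarith
      qed
      then show "x \<in> \<Union>\<B>'" using V by (auto simp: \<B>'_def)
    qed
    then obtain F where "F \<in> \<C>" "F \<subseteq> \<B>'" using sub[of \<B>'] by (auto simp: \<B>'_def)
    moreover then obtain n where "from_nat_into \<C> n = F" using rng by (metis imageE)
    ultimately show "\<exists>n. \<forall>W \<in> from_nat_into \<C> n. \<forall>x \<in> W. \<forall>x' \<in> W. \<bar>f x - f x'\<bar> \<le> e"
      by (intro exI[of _ n]) (auto simp: \<B>'_def)
  qed
qed

context lch_space
begin

definition subordinate :: "'a set \<Rightarrow> ('a \<Rightarrow> real) \<Rightarrow> bool" where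
  "subordinate A p \<longleftrightarrow> continuous_map X euclideanreal p \<and> (\<forall>y \<in> topspace X. 0 \<le> p y) \<and>
     (\<exists>C. compactin X C \<and> C \<subseteq> A \<and> (\<forall>y \<in> topspace X - C. p y = 0))"

lemma subordinate_Cc: "subordinate A p \<Longrightarrow> p \<in> Cc_real X"
  by (auto simp: subordinate_def Cc_real_def)

text \<open>Iterates \<open>split_Cc\<close> along the list. The pieces form a list and not a set,
  so that equal pieces count with multiplicity.\<close>

lemma subordinate_split_list:
  assumes "\<And>w. w \<in> set ws \<Longrightarrow> openin X (A w)" "subordinate (\<Union>w \<in> set ws. A w) p"
  shows "\<exists>cs :: ('w \<times> ('a \<Rightarrow> real)) list. (\<forall>c \<in> set cs. fst c \<in> set ws \<and> subordinate (A (fst c)) (snd c)) \<and>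
    (\<forall>y \<in> topspace X. (\<Sum>c\<leftarrow>cs. snd c y) = p y)"
  using assms
proof (induction ws arbitrary: p)
  case Nil
  then have "\<forall>y \<in> topspace X. p y = 0" by (auto simp: subordinate_def)
  then show ?case by (intro exI[of _ "[]"]) simp
next
  case (Cons w ws)
  obtain C where p: "continuous_map X euclideanreal p" "\<And>y. y \<in> topspace X \<Longrightarrow> 0 \<le> p y"
    and C: "compactin X C" "\<And>y. y \<in> topspace X \<Longrightarrow> y \<notin> C \<Longrightarrow> p y = 0"
      "C \<subseteq> A w \<union> (\<Union>w \<in> set ws. A w)"
    using Cons.prems(2) by (auto simp: subordinate_def)
  have op: "openin X (A w)" "openin X (\<Union>w \<in> set ws. A w)"
    using Cons.prems(1) by auto
  obtain g h where gh: "subordinate (A w) g" "subordinate (\<Union>w \<in> set ws. A w) h" "\<And>y. p y = g y + h y"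
  proof -
    obtain g h D E where "continuous_map X euclideanreal g" "continuous_map X euclideanreal h"
      "compactin X D" "D \<subseteq> A w" "\<And>x. x \<in> topspace X \<Longrightarrow> x \<notin> D \<Longrightarrow> g x = 0"
      "compactin X E" "E \<subseteq> (\<Union>w \<in> set ws. A w)" "\<And>x. x \<in> topspace X \<Longrightarrow> x \<notin> E \<Longrightarrow> h x = 0"
      "\<And>x. x \<in> topspace X \<Longrightarrow> 0 \<le> g x" "\<And>x. x \<in> topspace X \<Longrightarrow> 0 \<le> h x"
      "\<And>x. p x = g x + h x"
      using split_Cc[OF p C(1,2) op C(3)] by blast
    then show thesis by (intro that[of g h]) (auto simp: subordinate_def)
  qed
  obtain cs where cs: "\<forall>c \<in> set cs. fst c \<in> set ws \<and> subordinate (A (fst c)) (snd c)"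
    "\<forall>y \<in> topspace X. (\<Sum>c\<leftarrow>cs. snd c y) = h y"
    using Cons.IH[OF _ gh(2)] Cons.prems(1) by auto
  then show ?case
    using gh by (intro exI[of _ "(w, g) # cs"]) auto
qed

end

locale open_fibration = X: lch_space X + Y: lch_space Y
  for X :: "'x topology" and Y :: "'y topology" +
  fixes \<pi> :: "'x \<Rightarrow> 'y"
  assumes sc_X: "second_countable X" and cont_\<pi>: "continuous_map X Y \<pi>" and open_\<pi>: "open_map X Y \<pi>"
begin

definition node :: "'x set \<times> ('y \<Rightarrow> real) \<Rightarrow> bool" where
  "node s \<longleftrightarrow> openin X (fst s) \<and> Y.subordinate (\<pi> ` fst s) (snd s)"

definition refines :: "'x set set \<Rightarrow> 'x set \<times> ('y \<Rightarrow> real) \<Rightarrow> ('x set \<times> ('y \<Rightarrow> real)) list \<Rightarrow> bool" where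
  "refines \<W> s cs \<longleftrightarrow> (\<forall>c \<in> set cs. node c \<and> fst c \<subseteq> fst s \<and> (\<exists>W \<in> \<W>. fst c \<subseteq> W)) \<and>
     (\<forall>y \<in> topspace Y. (\<Sum>c\<leftarrow>cs. snd c y) = snd s y)"

text \<open>As \<pi> is open, the images of the sets \<open>fst s \<inter> W\<close> are open;
  finitely many of them cover the compact carrier of the weight, which is split along them. Each new
  weight is again carried by the image of its set.\<close>

lemma refinement_exists:
  assumes s: "node s" and W: "\<And>W. W \<in> \<W> \<Longrightarrow> openin X W" "fst s \<subseteq> \<Union>\<W>"
  shows "\<exists>cs. refines \<W> s cs"
proof -
  define A where "A W = \<pi> ` (fst s \<inter> W)" for W
  have op: "openin X (fst s \<inter> W)" if "W \<in> \<W>" for W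
    using s W(1)[OF that] by (auto simp: node_def)
  then have opA: "openin Y (A W)" if "W \<in> \<W>" for W
    using open_\<pi> that unfolding A_def open_map_def by blast
  obtain C where C: "compactin Y C" "C \<subseteq> \<pi> ` fst s" "\<forall>y \<in> topspace Y - C. snd s y = 0"
    using s by (auto simp: node_def Y.subordinate_def)
  have "\<pi> ` fst s \<subseteq> (\<Union>W \<in> \<W>. A W)"
  proof
    fix y assume "y \<in> \<pi> ` fst s"
    then obtain x where x: "x \<in> fst s" "y = \<pi> x" by blast
    then obtain W where "W \<in> \<W>" "x \<in> W" using W(2) by blast
    with x show "y \<in> (\<Union>W \<in> \<W>. A W)" by (auto simp: A_def)
  qed
  with C(2) have "C \<subseteq> \<Union>(A ` \<W>)" by simp
  moreover have "\<forall>U \<in> A ` \<W>. openin Y U" using opA by blast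
  ultimately obtain F where "finite F" "F \<subseteq> A ` \<W>" "C \<subseteq> \<Union>F"
    using C(1) unfolding compactin_def by meson
  then obtain \<F> where F: "finite \<F>" "\<F> \<subseteq> \<W>" "C \<subseteq> \<Union>(A ` \<F>)"
    by (metis finite_subset_image)
  obtain ws where ws: "set ws = \<F>" using finite_list[OF F(1)] by blast
  have "Y.subordinate (\<Union>w \<in> set ws. A w) (snd s)"
    using s C F(3) ws by (auto simp: node_def Y.subordinate_def)
  then obtain cs where cs: "\<forall>c \<in> set cs. fst c \<in> set ws \<and> Y.subordinate (A (fst c)) (snd c)"
    "\<forall>y \<in> topspace Y. (\<Sum>c\<leftarrow>cs. snd c y) = snd s y"
    using Y.subordinate_split_list[of ws A "snd s"] opA F(2) ws by blast
  have "refines \<W> s (map (\<lambda>c. (fst s \<inter> fst c, snd c)) cs)"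
    unfolding refines_def
  proof (intro conjI ballI)
    fix c assume "c \<in> set (map (\<lambda>c. (fst s \<inter> fst c, snd c)) cs)"
    then obtain d where d: "d \<in> set cs" "c = (fst s \<inter> fst d, snd d)" by auto
    then have "fst d \<in> \<W>" using cs(1) ws F(2) by auto
    then show "node c" "fst c \<subseteq> fst s" "\<exists>W \<in> \<W>. fst c \<subseteq> W"
      using d cs(1) op by (auto simp: node_def A_def)
  next
    fix y assume "y \<in> topspace Y"
    then show "(\<Sum>c\<leftarrow>map (\<lambda>c. (fst s \<inter> fst c, snd c)) cs. snd c y) = snd s y"
      using cs(2) by (simp add: o_def)
  qed
  then show ?thesis by blast
qed

end

text \<open>A tree of nodes \<open>(V, p)\<close>, the weight \<open>p\<close> being carried by the image of \<open>V\<close>. The weights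
  of the nodes of one level, placed at arbitrary points of the sets \<open>V\<close>, approximate a measure on the
  fibre, since a node with positive weight at \<open>y\<close> meets the fibre over \<open>y\<close>.\<close>

locale fibration_tree = open_fibration X Y \<pi>
  for X :: "'x topology" and Y :: "'y topology" and \<pi> :: "'x \<Rightarrow> 'y" +
  fixes K :: "'x set" and \<U> :: "nat \<Rightarrow> 'x set set"
    and children :: "nat \<Rightarrow> 'x set \<times> ('y \<Rightarrow> real) \<Rightarrow> ('x set \<times> ('y \<Rightarrow> real)) list"
    and root :: "'x set \<times> ('y \<Rightarrow> real)"
  assumes K: "compactin X K"
    and osc: "\<And>(f :: 'x \<Rightarrow> real) e. continuous_map X euclideanreal f \<Longrightarrow> 0 < e \<Longrightarrow>
       \<exists>n. \<forall>W \<in> \<U> n. \<forall>x \<in> W. \<forall>x' \<in> W. \<bar>f x - f x'\<bar> \<le> e"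
    and children: "node s \<Longrightarrow> fst s \<subseteq> K \<Longrightarrow> refines (\<U> n) s (children n s)"
    and root: "node root" "fst root \<subseteq> K"
begin

text \<open>The integral of f against the discrete measure formed at y by the descendants k
  generations below s; n is the index of the cover refined next. The sample points do not depend on
  y, which makes the sum continuous in y at the price of leaving the fibre over y.\<close>

fun approx :: "nat \<Rightarrow> nat \<Rightarrow> 'x set \<times> ('y \<Rightarrow> real) \<Rightarrow> ('x \<Rightarrow> real) \<Rightarrow> 'y \<Rightarrow> real" where
  "approx 0 n s f y = snd s y * f (SOME x. x \<in> fst s)"
| "approx (Suc k) n s f y = (\<Sum>c\<leftarrow>children n s. approx k (Suc n) c f y)"

lemma weight_nonneg: "node s \<Longrightarrow> y \<in> topspace Y \<Longrightarrow> 0 \<le> snd s y"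
  by (simp add: node_def Y.subordinate_def)

lemma weight_meets:
  assumes "node s" "y \<in> topspace Y" "snd s y \<noteq> 0"
  obtains x where "x \<in> fst s" "\<pi> x = y"
  using assms unfolding node_def Y.subordinate_def by blast

lemma childD:
  assumes "node s" "fst s \<subseteq> K" "c \<in> set (children n s)"
  shows "node c" "fst c \<subseteq> fst s" "fst c \<subseteq> K" "\<exists>W \<in> \<U> n. fst c \<subseteq> W"
  using children[OF assms(1,2), of n] assms(2,3) unfolding refines_def by blast+

lemma children_sum:
  "node s \<Longrightarrow> fst s \<subseteq> K \<Longrightarrow> y \<in> topspace Y \<Longrightarrow> (\<Sum>c\<leftarrow>children n s. snd c y) = snd s y"
  using children[of s n] by (simp add: refines_def)

lemma approx_bounds:
  assumes "node s" "fst s \<subseteq> K" "y \<in> topspace Y" "\<And>x. x \<in> fst s \<Longrightarrow> a \<le> f x \<and> f x \<le> b"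
  shows "a * snd s y \<le> approx k n s f y \<and> approx k n s f y \<le> b * snd s y"
  using assms
proof (induction k arbitrary: n s)
  case 0
  show ?case
  proof (cases "snd s y = 0")
    case False
    then obtain x where "x \<in> fst s" using weight_meets 0 by blast
    then have "(SOME x. x \<in> fst s) \<in> fst s" by (rule someI)
    then have "a \<le> f (SOME x. x \<in> fst s)" "f (SOME x. x \<in> fst s) \<le> b" using 0(4) by blast+
    then show ?thesis
      using weight_nonneg[OF 0(1,3)] by (simp add: mult.commute[of "snd s y"] mult_right_mono)
  qed simp
next
  case (Suc k)
  have c: "a * snd c y \<le> approx k (Suc n) c f y \<and> approx k (Suc n) c f y \<le> b * snd c y"
    if "c \<in> set (children n s)" for c
    using Suc.IH[OF childD(1,3)[OF Suc.prems(1,2) that] Suc.prems(3)]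
      childD(2)[OF Suc.prems(1,2) that] Suc.prems(4) by blast
  have "(\<Sum>c\<leftarrow>children n s. a * snd c y) \<le> approx (Suc k) n s f y"
    "approx (Suc k) n s f y \<le> (\<Sum>c\<leftarrow>children n s. b * snd c y)"
    using c by (auto intro!: sum_list_mono)
  then show ?case
    using children_sum[OF Suc.prems(1,2,3), of n] by (simp add: sum_list_const_mult)
qed

text \<open>The number j counts the generations from s down to nodes that lie inside a member of
  \<open>\<U> N\<close>. There every approximation differs from f x times the weight, x being a
  point of the node, by at most e times the weight. Two of them differ by at most twice that, and
  the bound adds up over siblings.\<close>

lemma approx_Cauchy:
  assumes "n + j = Suc N" "j \<le> k" "j \<le> k'" "node s" "fst s \<subseteq> K" "y \<in> topspace Y"
    and N: "\<forall>W \<in> \<U> N. \<forall>x \<in> W. \<forall>x' \<in> W. \<bar>f x - f x'\<bar> \<le> e"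
    and "n = Suc N \<Longrightarrow> \<exists>W \<in> \<U> N. fst s \<subseteq> W"
  shows "\<bar>approx k n s f y - approx k' n s f y\<bar> \<le> 2 * e * snd s y"
  using assms(1-6,8)
proof (induction j arbitrary: n s k k')
  case 0
  show ?case
  proof (cases "snd s y = 0")
    \<comment> \<open>The node may be an empty set here, so no sample point is at hand; any bounds
      for f on it make the approximation vanish.\<close>
    case True
    have "(\<And>x. x \<in> fst s \<Longrightarrow> a \<le> f x \<and> f x \<le> b) \<Longrightarrow> approx k n s f y = 0" for a b k
      using approx_bounds[OF 0(4,5,6), of a f b k n] True by simp
    moreover obtain W where W: "W \<in> \<U> N" "fst s \<subseteq> W" using 0 by auto
    then have "\<exists>a b. \<forall>x \<in> fst s. a \<le> f x \<and> f x \<le> b" using N by (intro osc_bounded) blast+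
    ultimately have "approx k n s f y = 0" "approx k' n s f y = 0" by blast+
    then show ?thesis using True by simp
  next
    case False
    then obtain x where x: "x \<in> fst s" using weight_meets 0(4,6) by blast
    obtain W where W: "W \<in> \<U> N" "fst s \<subseteq> W" using 0 by auto
    have "f x - e \<le> f x' \<and> f x' \<le> f x + e" if "x' \<in> fst s" for x'
    proof -
      have "\<bar>f x - f x'\<bar> \<le> e" using N W that x by blast
      then show ?thesis by linarith
    qed
    then have "(f x - e) * snd s y \<le> approx l n s f y \<and> approx l n s f y \<le> (f x + e) * snd s y" for l
      using 0 by (intro approx_bounds) auto
    from this[of k] this[of k'] show ?thesis by (simp add: algebra_simps abs_le_iff)
  qed
next
  case (Suc j)
  obtain l l' where l: "k = Suc l" "k' = Suc l'" "j \<le> l" "j \<le> l'"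
    using Suc.prems(2,3) by (metis Suc_le_D Suc_le_mono)
  have c: "\<bar>approx l (Suc n) c f y - approx l' (Suc n) c f y\<bar> \<le> 2 * e * snd c y"
    if "c \<in> set (children n s)" for c
  proof (rule Suc.IH)
    show "\<exists>W \<in> \<U> N. fst c \<subseteq> W" if "Suc n = Suc N"
      using childD(4)[OF Suc.prems(4,5) \<open>c \<in> set (children n s)\<close>] that by simp
  qed (use l Suc.prems(1,6) childD[OF Suc.prems(4,5) that] in simp_all)
  have "\<bar>approx k n s f y - approx k' n s f y\<bar>
      = \<bar>\<Sum>c\<leftarrow>children n s. approx l (Suc n) c f y - approx l' (Suc n) c f y\<bar>"
    unfolding l by (simp add: sum_list_subtractf)
  also have "\<dots> \<le> (\<Sum>c\<leftarrow>children n s. \<bar>approx l (Suc n) c f y - approx l' (Suc n) c f y\<bar>)"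
    using sum_list_abs[of "map (\<lambda>c. approx l (Suc n) c f y - approx l' (Suc n) c f y) (children n s)"]
    by (simp add: o_def)
  also have "\<dots> \<le> (\<Sum>c\<leftarrow>children n s. 2 * e * snd c y)"
    using c by (rule sum_list_mono)
  also have "\<dots> = 2 * e * snd s y"
    using children_sum[OF Suc.prems(4,5,6), of n] by (simp add: sum_list_const_mult)
  finally show ?case .
qed

text \<open>Nonnegativity of f is assumed only on the part of K over y. A node with nonzero weight
  at y contains a point over y, so f is at least - e on the whole node once it oscillates by at most
  e. This is what confines the limit measure to the fibre.\<close>

lemma approx_lower:
  assumes "n + j = Suc N" "j \<le> k" "node s" "fst s \<subseteq> K" "y \<in> topspace Y"
    and N: "\<forall>W \<in> \<U> N. \<forall>x \<in> W. \<forall>x' \<in> W. \<bar>f x - f x'\<bar> \<le> e"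
    and nonneg: "\<And>x. x \<in> K \<Longrightarrow> \<pi> x = y \<Longrightarrow> 0 \<le> f x"
    and "n = Suc N \<Longrightarrow> \<exists>W \<in> \<U> N. fst s \<subseteq> W"
  shows "- e * snd s y \<le> approx k n s f y"
  using assms(1-5,8)
proof (induction j arbitrary: n s k)
  case 0
  obtain W where W: "W \<in> \<U> N" "fst s \<subseteq> W" using 0 by auto
  show ?case
  proof (cases "snd s y = 0")
    case True
    have "\<exists>a b. \<forall>x \<in> fst s. a \<le> f x \<and> f x \<le> b" using N W by (intro osc_bounded) blast+
    then obtain a b where "\<And>x. x \<in> fst s \<Longrightarrow> a \<le> f x \<and> f x \<le> b" by blast
    then show ?thesis using approx_bounds[OF 0(3,4,5), of a f b k n] True by simp
  next
    case False
    then obtain x where x: "x \<in> fst s" "\<pi> x = y" using weight_meets 0(3,5) by blast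
    have "- e \<le> f x' \<and> f x' \<le> f x + e" if "x' \<in> fst s" for x'
    proof -
      have "\<bar>f x - f x'\<bar> \<le> e" using N W that x by blast
      moreover have "0 \<le> f x" using x 0(4) nonneg by blast
      ultimately show ?thesis by linarith
    qed
    then show ?thesis using approx_bounds[OF 0(3,4,5), of "- e" f "f x + e" k n] by simp
  qed
next
  case (Suc j)
  obtain l where l: "k = Suc l" "j \<le> l" using Suc.prems(2) by (metis Suc_le_D Suc_le_mono)
  have c: "- e * snd c y \<le> approx l (Suc n) c f y" if "c \<in> set (children n s)" for c
  proof (rule Suc.IH)
    show "\<exists>W \<in> \<U> N. fst c \<subseteq> W" if "Suc n = Suc N"
      using childD(4)[OF Suc.prems(3,4) \<open>c \<in> set (children n s)\<close>] that by simp
  qed (use l Suc.prems(1,5) childD[OF Suc.prems(3,4) that] in simp_all)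
  have "- e * snd s y = (\<Sum>c\<leftarrow>children n s. - e * snd c y)"
    unfolding sum_list_const_mult children_sum[OF Suc.prems(3,4,5)] ..
  also have "\<dots> \<le> approx k n s f y"
    unfolding l approx.simps using c by (rule sum_list_mono)
  finally show ?case .
qed

lemma approx_add: "approx k n s (\<lambda>x. f x + g x) y = approx k n s f y + approx k n s g y"
  by (induction k arbitrary: n s) (simp_all add: distrib_left sum_list_addf)

lemma approx_scale: "approx k n s (\<lambda>x. c * f x) y = c * approx k n s f y"
  by (induction k arbitrary: n s) (simp_all add: sum_list_const_mult)

lemma approx_continuous:
  "node s \<Longrightarrow> fst s \<subseteq> K \<Longrightarrow> continuous_map Y euclideanreal (approx k n s f)"
proof (induction k arbitrary: n s)
  case 0
  then show ?case by (auto simp: node_def Y.subordinate_def intro!: continuous_intros)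
next
  case (Suc k)
  have "continuous_map Y euclideanreal (\<lambda>y. \<Sum>c\<leftarrow>cs. approx k (Suc n) c f y)"
    if "set cs \<subseteq> set (children n s)" for cs
    using that by (induction cs) (auto intro!: continuous_intros Suc.IH childD(1,3)[OF Suc.prems])
  from this[OF order_refl] show ?case by simp
qed

definition limit :: "'y \<Rightarrow> ('x \<Rightarrow> real) \<Rightarrow> real" where
  "limit y f = lim (\<lambda>k. approx k 0 root f y)"

text \<open>The root weight is bounded, being continuous with a compact carrier. This makes the
  Cauchy estimate uniform in y, and the limit inherits continuity.\<close>

lemma approx_uniform:
  assumes f: "continuous_map X euclideanreal f" and e: "0 < e"
  shows "\<exists>k0. \<forall>k\<ge>k0. \<forall>k'\<ge>k0. \<forall>y \<in> topspace Y. \<bar>approx k 0 root f y - approx k' 0 root f y\<bar> \<le> e"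
proof -
  obtain B where B: "B \<ge> 0" "\<And>y. y \<in> topspace Y \<Longrightarrow> \<bar>snd root y\<bar> \<le> B"
    using root(1) Y.subordinate_Cc Cc_real_bounded unfolding node_def by metis
  define d where "d = e / (2 * (B + 1))"
  have d: "d > 0" "2 * d * B \<le> e" using e B(1) by (auto simp: d_def field_simps)
  obtain N where N: "\<forall>W \<in> \<U> N. \<forall>x \<in> W. \<forall>x' \<in> W. \<bar>f x - f x'\<bar> \<le> d"
    using osc[OF f d(1)] by blast
  have "\<bar>approx k 0 root f y - approx k' 0 root f y\<bar> \<le> e"
    if "k \<ge> Suc N" "k' \<ge> Suc N" "y \<in> topspace Y" for k k' y
  proof -
    have "\<bar>approx k 0 root f y - approx k' 0 root f y\<bar> \<le> 2 * d * snd root y"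
      using approx_Cauchy[of 0 "Suc N" N k k' root y f d] that root N by simp
    also have "\<dots> \<le> 2 * d * B" using B(2)[OF that(3)] d(1) by (intro mult_left_mono) auto
    finally show ?thesis using d(2) by linarith
  qed
  then show ?thesis by blast
qed

lemma approx_tendsto:
  assumes f: "continuous_map X euclideanreal f" and y: "y \<in> topspace Y"
  shows "(\<lambda>k. approx k 0 root f y) \<longlonglongrightarrow> limit y f"
proof -
  have "Cauchy (\<lambda>k. approx k 0 root f y)"
    unfolding Cauchy_def dist_real_def
  proof (intro allI impI)
    fix e :: real assume "0 < e"
    then obtain k0 where "\<forall>k\<ge>k0. \<forall>k'\<ge>k0. \<forall>y \<in> topspace Y. \<bar>approx k 0 root f y - approx k' 0 root f y\<bar> \<le> e / 2"
      using approx_uniform[OF f, of "e / 2"] by auto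
    then show "\<exists>M. \<forall>m\<ge>M. \<forall>n\<ge>M. \<bar>approx m 0 root f y - approx n 0 root f y\<bar> < e"
      using y \<open>0 < e\<close> by (intro exI[of _ k0]) (smt (verit) field_sum_of_halves)
  qed
  then show ?thesis
    unfolding limit_def using Cauchy_convergent_iff convergent_LIMSEQ_iff by blast
qed

lemma limit_continuous:
  assumes f: "continuous_map X euclideanreal f"
  shows "continuous_map Y euclideanreal (\<lambda>y. limit y f)"
  unfolding continuous_map_real_iff
proof (intro ballI allI impI)
  fix y and e :: real assume y: "y \<in> topspace Y" and e: "0 < e"
  obtain k0 where k0: "\<And>k k' y. k \<ge> k0 \<Longrightarrow> k' \<ge> k0 \<Longrightarrow> y \<in> topspace Y \<Longrightarrow>
      \<bar>approx k 0 root f y - approx k' 0 root f y\<bar> \<le> e / 4"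
    using approx_uniform[OF f, of "e / 4"] e by auto
  have lim: "\<bar>approx k0 0 root f y - limit y f\<bar> \<le> e / 4" if "y \<in> topspace Y" for y
    by (rule Lim_bounded[OF tendsto_rabs[OF tendsto_diff[OF tendsto_const approx_tendsto[OF f that]]], of k0])
      (use k0 that in auto)
  obtain N where N: "openin Y N" "y \<in> N" "\<And>y'. y' \<in> N \<Longrightarrow> \<bar>approx k0 0 root f y' - approx k0 0 root f y\<bar> < e / 4"
    using approx_continuous[OF root, of k0 0 f, unfolded continuous_map_real_iff, rule_format, OF y, of "e / 4"] e
    by auto
  have "\<bar>limit y' f - limit y f\<bar> < e" if "y' \<in> N" for y'
  proof -
    have "y' \<in> topspace Y" using that N(1) openin_subset by blast
    from lim[OF this] lim[OF y] N(3)[OF that] show ?thesis by linarith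
  qed
  with N show "\<exists>N. openin Y N \<and> y \<in> N \<and> (\<forall>y' \<in> N. \<bar>limit y' f - limit y f\<bar> < e)" by blast
qed

lemma limit_add:
  assumes "continuous_map X euclideanreal f" "continuous_map X euclideanreal g" "y \<in> topspace Y"
  shows "limit y (\<lambda>x. f x + g x) = limit y f + limit y g"
  using assms by (intro LIMSEQ_unique[OF approx_tendsto[OF continuous_map_add]])
    (auto simp: approx_add intro!: tendsto_add approx_tendsto)

lemma limit_scale:
  assumes "continuous_map X euclideanreal f" "y \<in> topspace Y"
  shows "limit y (\<lambda>x. c * f x) = c * limit y f"
  using assms by (intro LIMSEQ_unique[OF approx_tendsto])
    (auto simp: approx_scale intro!: tendsto_mult_left approx_tendsto continuous_intros)

lemma limit_nonneg:
  assumes f: "continuous_map X euclideanreal f" and y: "y \<in> topspace Y"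
    and nonneg: "\<And>x. x \<in> K \<Longrightarrow> \<pi> x = y \<Longrightarrow> 0 \<le> f x"
  shows "0 \<le> limit y f"
proof (rule field_le_epsilon)
  fix e :: real assume e: "0 < e"
  define d where "d = e / (snd root y + 1)"
  have p: "0 \<le> snd root y" by (rule weight_nonneg[OF root(1) y])
  have d: "d > 0" "d * snd root y \<le> e" using e p by (auto simp: d_def field_simps)
  obtain N where N: "\<forall>W \<in> \<U> N. \<forall>x \<in> W. \<forall>x' \<in> W. \<bar>f x - f x'\<bar> \<le> d"
    using osc[OF f d(1)] by blast
  have "- d * snd root y \<le> approx k 0 root f y" if "k \<ge> Suc N" for k
    using approx_lower[of 0 "Suc N" N k root y f d] that root N y nonneg by simp
  then have "- d * snd root y \<le> limit y f"
    by (intro LIMSEQ_le_const[OF approx_tendsto[OF f y]]) blast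
  then show "0 \<le> limit y f + e" using d(2) by simp
qed

text \<open>Splitting preserves the total weight, so the limit measure at y has mass
  \<open>snd root y\<close>.\<close>

lemma limit_one:
  assumes f: "continuous_map X euclideanreal f" and y: "y \<in> topspace Y" and one: "\<And>x. x \<in> K \<Longrightarrow> f x = 1"
  shows "limit y f = snd root y"
proof -
  have "approx k 0 root f y = snd root y" for k
    using approx_bounds[OF root y, of 1 f 1 k 0] one root(2) by (simp add: subsetD)
  with approx_tendsto[OF f y] have "(\<lambda>k. snd root y) \<longlonglongrightarrow> limit y f" by simp
  from LIMSEQ_unique[OF this tendsto_const] show ?thesis .
qed

lemma limit_functional: "y \<in> topspace Y \<Longrightarrow> positive_functional X (limit y)"
proof unfold_locales
  fix f assume "y \<in> topspace Y" "f \<in> Cc_real X" "\<And>x. x \<in> topspace X \<Longrightarrow> 0 \<le> f x"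
  then show "0 \<le> limit y f"
    using compactin_subset_topspace[OF K] by (intro limit_nonneg) (auto dest: Cc_real_continuous)
qed (auto intro: limit_add limit_scale dest: Cc_real_continuous)

lemma fibre_system_exists:
  "\<exists>\<beta>. fibre_system X Y \<pi> \<beta> \<and> (\<forall>y \<in> topspace Y. (AE x in \<beta> y. x \<in> K) \<and> emeasure (\<beta> y) K \<ge> ennreal (snd root y))"
proof -
  have "\<exists>M. radon_measure X M \<and> (\<forall>f \<in> Cc_real X. integral\<^sup>L M f = limit y f)" if "y \<in> topspace Y" for y
    using positive_functional.riesz_representation[OF limit_functional[OF that]] .
  then obtain \<beta> where \<beta>: "\<And>y. y \<in> topspace Y \<Longrightarrow> radon_measure X (\<beta> y)"
    "\<And>y f. y \<in> topspace Y \<Longrightarrow> f \<in> Cc_real X \<Longrightarrow> integral\<^sup>L (\<beta> y) f = limit y f"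
    by metis
  have lfb: "locally_finite_borel X (\<beta> y)" if "y \<in> topspace Y" for y
    using radon_locally_finite[OF \<beta>(1)[OF that]] .
  have AE: "AE x in \<beta> y. x \<in> K \<and> \<pi> x = y" if y: "y \<in> topspace Y" for y
  proof -
    let ?L = "K \<inter> {x \<in> topspace X. \<pi> x = y}"
    define U where "U = topspace X - ?L"
    have L: "closedin X ?L"
      using closedin_fibre[OF Y.haus cont_\<pi>] X.compact_closed[OF K] by blast
    then have U: "openin X U" by (auto simp: U_def)
    \<comment> \<open>A test function that vanishes off U is zero on the part of K over y, so
      \<open>limit_nonneg\<close> applies both to it and to its negative.\<close>
    have "emeasure (\<beta> y) U = 0"
    proof (rule X.radon_null_open[OF \<beta>(1)[OF y] U])
      fix f assume f: "f \<in> Cc_real X" "\<And>x. x \<in> topspace X \<Longrightarrow> x \<notin> U \<Longrightarrow> f x = 0"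
      have f0: "f x = 0" if "x \<in> K" "\<pi> x = y" for x
        using that f(2)[of x] compactin_subset_topspace[OF K] by (auto simp: U_def)
      have "limit y f \<ge> 0" "limit y (\<lambda>x. - 1 * f x) \<ge> 0"
        using f0 by (auto intro!: limit_nonneg continuous_intros y Cc_real_continuous[OF f(1)])
      then show "integral\<^sup>L (\<beta> y) f = 0"
        using limit_scale[OF Cc_real_continuous[OF f(1)] y, of "-1"] \<beta>(2)[OF y f(1)] by simp
    qed
    then show ?thesis
      using lfb_open[OF lfb[OF y] U] lfb_space[OF lfb[OF y]]
      by (intro AE_I'[of U]) (auto simp: null_sets_def U_def)
  qed
  have "fibre_system X Y \<pi> \<beta>"
  proof unfold_locales
    show "AE x in \<beta> y. \<pi> x = y" if "y \<in> topspace Y" for y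
      using AE[OF that] by eventually_elim simp
    show "continuous_map Y euclideanreal (\<lambda>y. integral\<^sup>L (\<beta> y) f)" if "f \<in> Cc_real X" for f
      by (rule continuous_map_eq[OF limit_continuous[OF Cc_real_continuous[OF that]]])
        (simp add: \<beta>(2)[OF _ that])
  qed (use Y.haus cont_\<pi> lfb in auto)
  moreover have "emeasure (\<beta> y) K \<ge> ennreal (snd root y)" if y: "y \<in> topspace Y" for y
  proof -
    obtain f where f: "f \<in> Cc_real X" "\<And>x. x \<in> topspace X \<Longrightarrow> 0 \<le> f x \<and> f x \<le> 1" "\<And>x. x \<in> K \<Longrightarrow> f x = 1"
      using X.urysohn_Cc[OF K openin_topspace compactin_subset_topspace[OF K]] by metis
    have Ks: "K \<in> sets (\<beta> y)" "emeasure (\<beta> y) K < \<infinity>"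
      using X.lfb_compact[OF lfb[OF y] K] lfb[OF y] K by (auto simp: locally_finite_borel_def)
    have "snd root y = integral\<^sup>L (\<beta> y) f"
      using limit_one[OF Cc_real_continuous[OF f(1)] y f(3)] \<beta>(2)[OF y f(1)] by simp
    also have "\<dots> = integral\<^sup>L (\<beta> y) (indicator K)"
      using Ks(1) f(3) AE[OF y] borel_measurable_integrable[OF X.lfb_Cc_integrable[OF lfb[OF y] f(1)]]
      by (intro integral_cong_AE) (auto elim!: eventually_mono simp: indicator_def)
    also have "\<dots> = measure (\<beta> y) K"
      using Ks(1) sets.sets_into_space by (simp add: Int_absorb1)
    finally show ?thesis using Ks(2) by (simp add: emeasure_eq_ennreal_measure)
  qed
  moreover have "AE x in \<beta> y. x \<in> K" if "y \<in> topspace Y" for y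
    using AE[OF that] by eventually_elim simp
  ultimately show ?thesis by blast
qed

end

context open_fibration
begin

lemma weighted_fibre_system_exists:
  assumes U: "openin X U" and K: "compactin X K" "U \<subseteq> K" and p: "Y.subordinate (\<pi> ` U) p"
  shows "\<exists>\<beta>. fibre_system X Y \<pi> \<beta> \<and>
    (\<forall>y \<in> topspace Y. (AE x in \<beta> y. x \<in> K) \<and> emeasure (\<beta> y) K \<ge> ennreal (p y))"
proof -
  obtain \<U> :: "nat \<Rightarrow> 'x set set" where cov:
    "\<And>n W. W \<in> \<U> n \<Longrightarrow> openin X W" "\<And>n. K \<subseteq> \<Union>(\<U> n)"
    "\<And>(f :: 'x \<Rightarrow> real) e. continuous_map X euclideanreal f \<Longrightarrow> 0 < e \<Longrightarrow>
       \<exists>n. \<forall>W \<in> \<U> n. \<forall>x \<in> W. \<forall>x' \<in> W. \<bar>f x - f x'\<bar> \<le> e"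
    using second_countable_oscillation_covers[OF sc_X K(1)] by metis
  have ex: "\<exists>cs. refines (\<U> n) s cs" if "node s" "fst s \<subseteq> K" for n s
    using that cov(2)[of n] by (intro refinement_exists cov(1)) auto
  have "refines (\<U> n) s (SOME cs. refines (\<U> n) s cs)" if "node s" "fst s \<subseteq> K" for n s
    by (rule someI_ex[OF ex[OF that]])
  then interpret fibration_tree X Y \<pi> K \<U> "\<lambda>n s. SOME cs. refines (\<U> n) s cs" "(U, p)"
    by unfold_locales (use U K p cov in \<open>auto simp: node_def\<close>)
  show ?thesis using fibre_system_exists by simp
qed

text \<open>The systems are indexed by pairs (V, W) of basic open sets, V with compact closure and W
  inside a compact subset of \<pi> V. The second component is there because a weight with compact
  carrier in \<pi> V need not be positive on all of \<pi> V; on W it equals 1.\<close>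

theorem fibre_system_sequence:
  assumes sc_Y: "second_countable Y"
  shows "\<exists>(\<beta> :: nat \<Rightarrow> 'y \<Rightarrow> 'x measure) K. \<forall>n. fibre_system X Y \<pi> (\<beta> n) \<and> compactin X (K n) \<and>
      (\<forall>y \<in> topspace Y. AE x in \<beta> n y. x \<in> K n) \<and>
      (\<forall>x U. openin X U \<longrightarrow> x \<in> U \<longrightarrow> (\<exists>n. K n \<subseteq> U \<and> emeasure (\<beta> n (\<pi> x)) (K n) > 0))"
proof -
  obtain \<B> where B: "countable \<B>" "\<And>V. V \<in> \<B> \<Longrightarrow> openin X V"
    "\<And>U x. openin X U \<Longrightarrow> x \<in> U \<Longrightarrow> \<exists>V \<in> \<B>. x \<in> V \<and> V \<subseteq> U"
    using sc_X unfolding second_countable_def by metis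
  obtain \<C> where C: "countable \<C>" "\<And>V. V \<in> \<C> \<Longrightarrow> openin Y V"
    "\<And>U x. openin Y U \<Longrightarrow> x \<in> U \<Longrightarrow> \<exists>V \<in> \<C>. x \<in> V \<and> V \<subseteq> U"
    using sc_Y unfolding second_countable_def by metis
  define I where "I = {(V, W). openin X V \<and> compactin X (X closure_of V) \<and>
     (\<exists>L. compactin Y L \<and> W \<subseteq> L \<and> L \<subseteq> \<pi> ` V)}"
  \<comment> \<open>The empty pair keeps J nonempty, so that J is the range of a sequence.\<close>
  define J where "J = insert ({}, {}) (I \<inter> (\<B> \<times> \<C>))"
  have "countable J" using B(1) C(1) by (auto simp: J_def)
  have JI: "J \<subseteq> I" by (auto simp: J_def I_def)
  have "\<exists>\<beta>. fibre_system X Y \<pi> \<beta> \<and> (\<forall>y \<in> topspace Y. (AE x in \<beta> y. x \<in> X closure_of V) \<and>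
      (y \<in> W \<longrightarrow> emeasure (\<beta> y) (X closure_of V) > 0))" if VW: "(V, W) \<in> J" for V W
  proof -
    from VW JI obtain L where V: "openin X V" "compactin X (X closure_of V)" and
      L: "compactin Y L" "W \<subseteq> L" "L \<subseteq> \<pi> ` V" by (auto simp: I_def)
    have op: "openin Y (\<pi> ` V)" using V(1) open_\<pi> by (simp add: open_map_def)
    obtain p C where p: "continuous_map Y euclideanreal p"
      "\<And>y. y \<in> topspace Y \<Longrightarrow> 0 \<le> p y \<and> p y \<le> 1" "\<And>y. y \<in> L \<Longrightarrow> p y = 1"
      "compactin Y C" "C \<subseteq> \<pi> ` V" "\<And>y. y \<in> topspace Y \<Longrightarrow> y \<notin> C \<Longrightarrow> p y = 0"
      using Y.urysohn[OF L(1) op L(3)] by blast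
    then have "Y.subordinate (\<pi> ` V) p" by (auto simp: Y.subordinate_def)
    moreover have "V \<subseteq> X closure_of V"
      by (rule closure_of_subset[OF openin_subset[OF V(1)]])
    ultimately obtain \<beta> where \<beta>: "fibre_system X Y \<pi> \<beta>" "\<And>y. y \<in> topspace Y \<Longrightarrow>
        (AE x in \<beta> y. x \<in> X closure_of V) \<and> emeasure (\<beta> y) (X closure_of V) \<ge> ennreal (p y)"
      using weighted_fibre_system_exists[OF V(1,2)] by blast
    have "emeasure (\<beta> y) (X closure_of V) > 0" if "y \<in> topspace Y" "y \<in> W" for y
    proof -
      have "ennreal (p y) = 1" using p(3) L(2) that by auto
      then have "1 \<le> emeasure (\<beta> y) (X closure_of V)" using \<beta>(2)[OF that(1)] by simp
      then show ?thesis by (rule less_le_trans[rotated]) simp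
    qed
    then show ?thesis using \<beta> by blast
  qed
  then have "\<forall>j \<in> J. \<exists>\<beta>. fibre_system X Y \<pi> \<beta> \<and> (\<forall>y \<in> topspace Y. (AE x in \<beta> y. x \<in> X closure_of (fst j)) \<and>
      (y \<in> snd j \<longrightarrow> emeasure (\<beta> y) (X closure_of (fst j)) > 0))"
    by auto
  from bchoice[OF this] obtain \<beta> where \<beta>: "\<And>j. j \<in> J \<Longrightarrow> fibre_system X Y \<pi> (\<beta> j)"
    "\<And>j y. j \<in> J \<Longrightarrow> y \<in> topspace Y \<Longrightarrow> AE x in \<beta> j y. x \<in> X closure_of (fst j)"
    "\<And>j y. j \<in> J \<Longrightarrow> y \<in> topspace Y \<Longrightarrow> y \<in> snd j \<Longrightarrow> emeasure (\<beta> j y) (X closure_of (fst j)) > 0"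
    by blast
  have ne: "J \<noteq> {}" by (simp add: J_def)
  define e where "e = from_nat_into J"
  have e: "range e = J" unfolding e_def by (rule range_from_nat_into[OF ne \<open>countable J\<close>])
  then have eJ: "e n \<in> J" for n by blast
  show ?thesis
  proof (intro exI[of _ "\<lambda>n. \<beta> (e n)"] exI[of _ "\<lambda>n. X closure_of (fst (e n))"] allI conjI impI ballI)
    show "compactin X (X closure_of fst (e n))" for n
      using eJ[of n] JI by (auto simp: I_def)
    fix x U assume U: "openin X U" "x \<in> U"
    have xX: "x \<in> topspace X" using U openin_subset by blast
    have "compactin X {x}" using xX by simp
    then obtain O1 C1 where O1: "openin X O1" "compactin X C1" "{x} \<subseteq> O1" "O1 \<subseteq> C1" "C1 \<subseteq> U"
      using X.compact_neighbourhood[of "{x}" U] U by auto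
    obtain V where V: "V \<in> \<B>" "x \<in> V" "V \<subseteq> O1" using B(3)[OF O1(1), of x] O1(3) by auto
    have cl: "X closure_of V \<subseteq> C1"
      using V(3) O1(4) X.compact_closed[OF O1(2)] by (meson closure_of_minimal order_trans)
    then have clc: "compactin X (X closure_of V)"
      by (meson O1(2) closed_compactin closedin_closure_of)
    have op: "openin Y (\<pi> ` V)" using B(2)[OF V(1)] open_\<pi> by (simp add: open_map_def)
    have y: "compactin Y {\<pi> x}" "{\<pi> x} \<subseteq> \<pi> ` V" "\<pi> x \<in> topspace Y"
      using V(2) openin_subset[OF op] by auto
    obtain O2 C2 where O2: "openin Y O2" "compactin Y C2" "{\<pi> x} \<subseteq> O2" "O2 \<subseteq> C2" "C2 \<subseteq> \<pi> ` V"
      using Y.compact_neighbourhood[OF y(1) op y(2)] by metis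
    obtain W where W: "W \<in> \<C>" "\<pi> x \<in> W" "W \<subseteq> O2" using C(3)[OF O2(1), of "\<pi> x"] O2(3) by auto
    have "(V, W) \<in> J"
      using V W O2 B(2) clc by (auto simp: J_def I_def)
    then obtain n where n: "e n = (V, W)" using e by (metis imageE)
    show "\<exists>n. X closure_of fst (e n) \<subseteq> U \<and> 0 < emeasure (\<beta> (e n) (\<pi> x)) (X closure_of fst (e n))"
      using \<beta>(3)[OF eJ[of n] y(3)] n cl O1(5) W(2) by (intro exI[of _ n]) auto
  qed (use \<beta> eJ in auto)
qed

end

section \<open>Groupoids with Haar systems\<close>

text \<open>Finite unions of compact closures of basic open sets. The last property, that every
  compact set is absorbed, is what lets one sequence dominate all compactly supported functions in
  \<open>weights_exist\<close>.\<close>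

lemma (in lch_space) compact_exhaustion:
  assumes "second_countable X"
  obtains C :: "nat \<Rightarrow> 'a set" where "\<And>n. compactin X (C n)" "\<And>m n. m \<le> n \<Longrightarrow> C m \<subseteq> C n"
    "\<And>K. compactin X K \<Longrightarrow> \<exists>n. K \<subseteq> C n"
proof -
  obtain \<B> where B: "countable \<B>" "\<And>V. V \<in> \<B> \<Longrightarrow> openin X V"
    "\<And>U x. openin X U \<Longrightarrow> x \<in> U \<Longrightarrow> \<exists>V \<in> \<B>. x \<in> V \<and> V \<subseteq> U"
    using assms unfolding second_countable_def by metis
  define \<D> where "\<D> = insert {} {V \<in> \<B>. compactin X (X closure_of V)}"
  have D: "countable \<D>" "\<D> \<noteq> {}" using B(1) by (auto simp: \<D>_def)
  define e where "e = from_nat_into \<D>"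
  have e: "range e = \<D>" unfolding e_def by (rule range_from_nat_into[OF D(2,1)])
  have De: "e n \<in> \<D>" for n using e by blast
  have De': "openin X V" "compactin X (X closure_of V)" if "V \<in> \<D>" for V
    using that B(2) by (auto simp: \<D>_def)
  show thesis
  proof (rule that[of "\<lambda>n. \<Union>i\<le>n. X closure_of (e i)"])
    show "compactin X (\<Union>i\<le>n. X closure_of (e i))" for n
      using De'(2)[OF De] by (auto intro!: compactin_Union)
    show "(\<Union>i\<le>m. X closure_of (e i)) \<subseteq> (\<Union>i\<le>n. X closure_of (e i))" if "m \<le> n" for m n
      using that by (intro UN_mono) auto
    fix K assume K: "compactin X K"
    have "K \<subseteq> \<Union>\<D>"
    proof
      fix x assume "x \<in> K"
      then have "x \<in> topspace X" using compactin_subset_topspace[OF K] by blast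
      then obtain U where U: "openin X U" "compactin X (X closure_of U)" "x \<in> U"
        using lc haus locally_compact_space_compact_closure_of[of X] by blast
      then obtain V where V: "V \<in> \<B>" "x \<in> V" "V \<subseteq> U" using B(3) by blast
      have "compactin X (X closure_of V)"
        by (rule closed_compactin[OF U(2) closure_of_mono[OF V(3)] closedin_closure_of])
      then show "x \<in> \<Union>\<D>" using V by (auto simp: \<D>_def)
    qed
    then obtain F where F: "finite F" "F \<subseteq> \<D>" "K \<subseteq> \<Union>F"
      using K De'(1) unfolding compactin_def by meson
    then obtain N where N: "finite N" "F = e ` N" using e by (metis finite_subset_image)
    then obtain n where n: "N \<subseteq> {..n}" using finite_nat_iff_bounded_le by auto
    have "e i \<subseteq> X closure_of (e i)" for i
      by (rule closure_of_subset[OF openin_subset[OF De'(1)[OF De]]])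
    then show "\<exists>n. K \<subseteq> (\<Union>i\<le>n. X closure_of (e i))"
      using F(3) N n by (intro exI[of _ n]) blast
  qed
qed

text \<open>In a Hausdorff space the compact carrier is closed and so contains the closed support;
  the two encodings of compact support agree.\<close>

lemma Cc_real_imp_Cc:
  assumes "Hausdorff_space X" "f \<in> Cc_real X"
  shows "(\<lambda>x. complex_of_real (f x)) \<in> Cc X"
proof -
  obtain K where K: "compactin X K" "\<And>x. x \<in> topspace X \<Longrightarrow> x \<notin> K \<Longrightarrow> f x = 0"
    using assms(2) by (rule Cc_realE) blast
  have "X closure_of {x \<in> topspace X. complex_of_real (f x) \<noteq> 0} \<subseteq> K"
    using K compactin_imp_closedin[OF assms(1) K(1)] by (intro closure_of_minimal) auto
  then have "compactin X (X closure_of {x \<in> topspace X. complex_of_real (f x) \<noteq> 0})"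
    using K(1) by (intro closed_compactin[OF K(1)]) auto
  moreover have "continuous_map X euclidean (\<lambda>x. complex_of_real (f x))"
    using continuous_map_compose[OF Cc_real_continuous[OF assms(2)], of euclidean complex_of_real]
    by (simp add: o_def continuous_on_of_real_id)
  ultimately show ?thesis by (simp add: Cc_def)
qed

lemma Cc_imp_Cc_real:
  assumes "f \<in> Cc X"
  shows "(\<lambda>x. Re (f x)) \<in> Cc_real X" "(\<lambda>x. Im (f x)) \<in> Cc_real X"
proof -
  let ?K = "X closure_of {x \<in> topspace X. f x \<noteq> 0}"
  have f: "continuous_map X euclidean f" "compactin X ?K" using assms by (auto simp: Cc_def)
  have "f x = 0" if "x \<in> topspace X" "x \<notin> ?K" for x
    using closure_of_subset[of "{x \<in> topspace X. f x \<noteq> 0}" X] that by blast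
  moreover have "continuous_map X euclideanreal (\<lambda>x. Re (f x))" "continuous_map X euclideanreal (\<lambda>x. Im (f x))"
    using continuous_map_compose[OF f(1), of euclideanreal Re] continuous_map_compose[OF f(1), of euclideanreal Im]
    by (simp_all add: o_def continuous_on_Re continuous_on_Im continuous_on_id)
  ultimately show "(\<lambda>x. Re (f x)) \<in> Cc_real X" "(\<lambda>x. Im (f x)) \<in> Cc_real X"
    using f(2) by (auto intro: Cc_realI)
qed

locale lch_groupoid = topological_groupoid G + lch_space "arr_top G" for G :: "'g groupoid" +
  assumes sc: "second_countable (arr_top G)"
begin

lemma rng_units [simp]: "x \<in> arrows G \<Longrightarrow> rng G x \<in> units G"
  by (simp add: units_def)

lemma units_iff: "u \<in> units G \<longleftrightarrow> u \<in> arrows G \<and> rng G u = u"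
  using rng_closed rng_rng by (force simp: units_def)

lemma src_units [simp]: "x \<in> arrows G \<Longrightarrow> src G x \<in> units G"
  by (simp add: units_iff src_closed rng_src)

lemma unit_src: "u \<in> units G \<Longrightarrow> src G u = u"
  using src_rng by (metis units_iff)

lemma topspace_unit_space [simp]: "topspace (unit_space G) = units G"
  by (auto simp: unit_space_def units_iff)

lemma inv_unit: "u \<in> units G \<Longrightarrow> gpd_inv G u = u"
  using rng_left_unit[OF inv_closed[of u]] mul_inv[of u] rng_inv[of u] unit_src[of u]
  by (auto simp: units_iff)

lemma mul_inv_cancel:
  assumes "x \<in> arrows G" "y \<in> arrows G" "rng G x = rng G y"
  shows "mul G x (mul G (gpd_inv G x) y) = y"
  using mul_assoc[of x "gpd_inv G x" y] assms inv_closed rng_inv src_inv mul_inv rng_left_unit by metis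

lemma inv_mul_cancel:
  assumes "x \<in> arrows G" "y \<in> arrows G" "src G x = rng G y"
  shows "mul G (gpd_inv G x) (mul G x y) = y"
  using mul_assoc[of "gpd_inv G x" x y] assms inv_closed rng_inv src_inv inv_mul rng_left_unit by metis

lemma mul_inv_cancel_right:
  assumes "x \<in> arrows G" "y \<in> arrows G" "src G x = src G y"
  shows "mul G (mul G x (gpd_inv G y)) y = x"
  using mul_assoc[of x "gpd_inv G y" y] assms inv_closed rng_inv src_inv inv_mul src_right_unit by metis

lemma inv_inv:
  assumes "x \<in> arrows G" shows "gpd_inv G (gpd_inv G x) = x"
  using mul_inv_cancel[of "gpd_inv G x" "src G x"] inv_mul_cancel[of "gpd_inv G x" "src G x"]
    assms mul_assoc[of "gpd_inv G (gpd_inv G x)" "gpd_inv G x" x] inv_closed rng_inv src_inv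
    inv_mul mul_inv rng_left_unit src_right_unit by metis

lemma continuous_map_mul:
  assumes "continuous_map P (arr_top G) f" "continuous_map P (arr_top G) g"
    and "\<And>p. p \<in> topspace P \<Longrightarrow> src G (f p) = rng G (g p)"
  shows "continuous_map P (arr_top G) (\<lambda>p. mul G (f p) (g p))"
proof -
  have "continuous_map P (composable_space G) (\<lambda>p. (f p, g p))"
    using assms by (auto simp: composable_space_def continuous_map_in_subtopology continuous_map_pairwise o_def)
  from continuous_map_compose[OF this continuous_mul] show ?thesis by (simp add: o_def)
qed

lemma continuous_map_inv:
  "continuous_map P (arr_top G) f \<Longrightarrow> continuous_map P (arr_top G) (\<lambda>p. gpd_inv G (f p))"
  using continuous_map_compose[OF _ continuous_inv, of P f] by (simp add: o_def)

lemma continuous_rng: "continuous_map (arr_top G) (arr_top G) (rng G)"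
proof -
  have "continuous_map (arr_top G) (arr_top G) (\<lambda>x. mul G x (gpd_inv G x))"
    by (intro continuous_map_mul continuous_map_inv) (auto simp: rng_inv)
  then show ?thesis by (rule continuous_map_eq) (simp add: mul_inv)
qed

lemma continuous_src: "continuous_map (arr_top G) (arr_top G) (src G)"
proof -
  have "continuous_map (arr_top G) (arr_top G) (\<lambda>x. mul G (gpd_inv G x) x)"
    by (intro continuous_map_mul continuous_map_inv) (auto simp: src_inv)
  then show ?thesis by (rule continuous_map_eq) (simp add: inv_mul)
qed

lemma continuous_rng_unit: "continuous_map (arr_top G) (unit_space G) (rng G)"
  using continuous_rng by (auto simp: unit_space_def continuous_map_in_subtopology)

lemma continuous_src_unit: "continuous_map (arr_top G) (unit_space G) (src G)"
  using continuous_src by (auto simp: unit_space_def continuous_map_in_subtopology)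

lemma closed_units: "closedin (arr_top G) (units G)"
proof -
  have "units G = {x \<in> arrows G. rng G x = id x}" by (auto simp: units_iff)
  then show ?thesis
    using closedin_continuous_maps_eq[OF haus continuous_rng continuous_map_id] by simp
qed

lemma lch_unit_space: "lch_space (unit_space G)"
  unfolding unit_space_def
  using closed_units lc haus
  by unfold_locales (auto intro: locally_compact_space_closed_subset Hausdorff_space_subtopology)

lemma sc_unit_space: "second_countable (unit_space G)"
  unfolding unit_space_def using sc by (rule second_countable_subtopology)

lemma compact_unit_space: "compactin (unit_space G) N \<Longrightarrow> compactin (arr_top G) N"
  by (simp add: unit_space_def compactin_subtopology)

end

locale haar_groupoid = lch_groupoid G for G :: "'g groupoid" +
  fixes \<nu> :: "'g \<Rightarrow> 'g measure"
  assumes haar: "haar_system G \<nu>"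
begin

lemma haar_radon: "u \<in> units G \<Longrightarrow> radon_measure (arr_top G) (\<nu> u)"
  using haar by (simp add: haar_system_def)

lemma haar_support: "u \<in> units G \<Longrightarrow> measure_support (arr_top G) (\<nu> u) = {x \<in> arrows G. rng G x = u}"
  using haar by (simp add: haar_system_def)

lemma haar_open_pos:
  assumes "openin (arr_top G) U" "x \<in> U" "rng G x = u"
  shows "emeasure (\<nu> u) U > 0"
proof -
  have "x \<in> arrows G" using assms openin_subset by blast
  then have "x \<in> measure_support (arr_top G) (\<nu> u)" using haar_support[of u] assms(3) by auto
  then show ?thesis using assms by (auto simp: measure_support_def)
qed

text \<open>The support condition only gives each point off the fibre a null neighbourhood; a
  countable base turns these into one null set.\<close>

lemma haar_fibre:
  assumes u: "u \<in> units G"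
  shows "AE x in \<nu> u. rng G x = u"
proof -
  have lfb: "locally_finite_borel (arr_top G) (\<nu> u)"
    by (rule radon_locally_finite[OF haar_radon[OF u]])
  obtain \<B> where B: "countable \<B>" "\<And>V. V \<in> \<B> \<Longrightarrow> openin (arr_top G) V"
    "\<And>U x. openin (arr_top G) U \<Longrightarrow> x \<in> U \<Longrightarrow> \<exists>V \<in> \<B>. x \<in> V \<and> V \<subseteq> U"
    using sc unfolding second_countable_def by metis
  define \<N> where "\<N> = {V \<in> \<B>. emeasure (\<nu> u) V = 0}"
  have N: "(\<Union>V\<in>\<N>. V) \<in> null_sets (\<nu> u)"
    using B(1,2) lfb_open[OF lfb] by (intro null_sets_UN') (auto simp: \<N>_def null_sets_def)
  have "x \<in> \<Union>\<N>" if x: "x \<in> arrows G" "rng G x \<noteq> u" for x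
  proof -
    have "x \<notin> measure_support (arr_top G) (\<nu> u)" using haar_support[OF u] x by auto
    then obtain U where U: "openin (arr_top G) U" "x \<in> U" "emeasure (\<nu> u) U = 0"
      using x(1) by (auto simp: measure_support_def zero_less_iff_neq_zero)
    obtain V where V: "V \<in> \<B>" "x \<in> V" "V \<subseteq> U" using B(3)[OF U(1,2)] by blast
    then have "emeasure (\<nu> u) V = 0"
      using U emeasure_mono[OF V(3), of "\<nu> u"] lfb_open[OF lfb U(1)] by simp
    with V show ?thesis by (auto simp: \<N>_def)
  qed
  then show ?thesis
    using N lfb_space[OF lfb] by (intro AE_I'[of "\<Union>V\<in>\<N>. V"]) auto
qed

sublocale fs: fibre_system "arr_top G" "unit_space G" "rng G" \<nu>
proof unfold_locales
  show "Hausdorff_space (unit_space G)" using lch_unit_space by (simp add: lch_space_def)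
  show "continuous_map (arr_top G) (unit_space G) (rng G)" by (rule continuous_rng_unit)
  show "locally_finite_borel (arr_top G) (\<nu> u)" if "u \<in> topspace (unit_space G)" for u
    using that by (intro radon_locally_finite haar_radon) simp
  show "AE x in \<nu> u. rng G x = u" if "u \<in> topspace (unit_space G)" for u
    using haar_fibre that by simp
  fix f assume f: "f \<in> Cc_real (arr_top G)"
  \<comment> \<open>Members of \<open>Cc\<close> are complex-valued, so the real function is
    embedded and the real part of the integral is taken afterwards.\<close>
  have "continuous_map (unit_space G) euclidean (\<lambda>u. LINT x|\<nu> u. complex_of_real (f x))"
    using haar[unfolded haar_system_def, THEN conjunct2, THEN conjunct1, rule_format,
        OF Cc_real_imp_Cc[OF haus f]] .
  then have "continuous_map (unit_space G) euclidean (\<lambda>u. complex_of_real (LINT x|\<nu> u. f x))"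
    by simp
  from continuous_map_compose[OF this, of euclideanreal Re]
  show "continuous_map (unit_space G) euclideanreal (\<lambda>u. integral\<^sup>L (\<nu> u) f)"
    by (simp add: o_def continuous_on_Re continuous_on_id)
qed

lemma fibre_eq: "fs.fibre u = {x \<in> arrows G. rng G x = u}"
  by (simp add: fs.fibre_def)

text \<open>Invariance for an integrand known on one range fibre only: translation by x maps the
  fibre at \<open>src G x\<close> into the fibre at \<open>rng G x\<close>, where F agrees with a
  member of \<open>Cc_real\<close>.\<close>

lemma haar_invariant:
  assumes x: "x \<in> arrows G" and F: "fs.fibre_Cc (rng G x) F"
  shows "fs.fint (src G x) (\<lambda>y. F (mul G x y)) = fs.fint (rng G x) F"
proof -
  obtain f where f: "f \<in> Cc_real (arr_top G)" "\<And>y. y \<in> fs.fibre (rng G x) \<Longrightarrow> f y = F y"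
    using F by (rule fs.fibre_Cc_extend) blast
  have "complex_of_real (fs.fint (src G x) (\<lambda>y. f (mul G x y))) = complex_of_real (integral\<^sup>L (\<nu> (rng G x)) f)"
    using haar[unfolded haar_system_def, THEN conjunct2, THEN conjunct2, rule_format,
        OF Cc_real_imp_Cc[OF haus f(1)] x]
    by (simp add: fs.fint_def fibre_eq set_integral_complex_of_real[symmetric])
  then have "fs.fint (src G x) (\<lambda>y. f (mul G x y)) = fs.fint (rng G x) F"
    using fs.fint_Cc[OF _ f] x by simp
  moreover have "fs.fint (src G x) (\<lambda>y. F (mul G x y)) = fs.fint (src G x) (\<lambda>y. f (mul G x y))"
    using x f(2) by (intro fs.fint_cong) (auto simp: fibre_eq mul_closed rng_mul)
  ultimately show ?thesis by simp
qed

end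

section \<open>Equivalences of groupoids\<close>

locale equivalence = G: lch_groupoid G + H: lch_groupoid H + Z: lch_space Z
  for G :: "'g groupoid" and H :: "'h groupoid" and Z :: "'z topology" +
  fixes \<rho> :: "'z \<Rightarrow> 'g" and lact :: "'g \<Rightarrow> 'z \<Rightarrow> 'z"
    and \<sigma> :: "'z \<Rightarrow> 'h" and ract :: "'z \<Rightarrow> 'h \<Rightarrow> 'z"
  assumes equiv: "groupoid_equivalence G H Z \<rho> lact \<sigma> ract"
begin

lemma
  shows left_act: "left_action G Z \<rho> lact" and left_proper: "proper_left_action G Z \<rho> lact"
    and right_act: "right_action H Z \<sigma> ract" and right_free: "free_right_action H Z \<sigma> ract"
    and right_proper: "proper_right_action H Z \<sigma> ract"
    and commute: "actions_commute G H Z \<rho> lact \<sigma> ract"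
    and open_\<rho>: "open_map Z (unit_space G) \<rho>" and open_\<sigma>: "open_map Z (unit_space H) \<sigma>"
    and homeo_\<rho>: "induces_homeomorphism Z (right_orbit H \<sigma> ract) (unit_space G) \<rho>"
    and homeo_\<sigma>: "induces_homeomorphism Z (left_orbit G \<rho> lact) (unit_space H) \<sigma>"
  using equiv unfolding groupoid_equivalence_def by auto

lemma cont_\<rho>: "continuous_map Z (unit_space G) \<rho>" and cont_\<sigma>: "continuous_map Z (unit_space H) \<sigma>"
  using left_act right_act by (simp_all add: left_action_def right_action_def)

lemma \<rho>_units [simp]: "z \<in> topspace Z \<Longrightarrow> \<rho> z \<in> units G"
  using cont_\<rho> by (auto simp: continuous_map_def)

lemma \<sigma>_units [simp]: "z \<in> topspace Z \<Longrightarrow> \<sigma> z \<in> units H"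
  using cont_\<sigma> by (auto simp: continuous_map_def)

lemma \<rho>_arrow [simp]: "z \<in> topspace Z \<Longrightarrow> \<rho> z \<in> arrows G"
  and \<rho>_rng [simp]: "z \<in> topspace Z \<Longrightarrow> rng G (\<rho> z) = \<rho> z"
  and \<rho>_src [simp]: "z \<in> topspace Z \<Longrightarrow> src G (\<rho> z) = \<rho> z"
  using \<rho>_units G.units_iff G.unit_src by blast+

lemma \<sigma>_arrow [simp]: "z \<in> topspace Z \<Longrightarrow> \<sigma> z \<in> arrows H"
  and \<sigma>_rng [simp]: "z \<in> topspace Z \<Longrightarrow> rng H (\<sigma> z) = \<sigma> z"
  and \<sigma>_src [simp]: "z \<in> topspace Z \<Longrightarrow> src H (\<sigma> z) = \<sigma> z"
  using \<sigma>_units H.units_iff H.unit_src by blast+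

lemma cont_lact: "continuous_map (left_fibre_product G Z \<rho>) Z (\<lambda>(x, p). lact x p)"
  using left_act by (simp add: left_action_def)

lemma cont_ract: "continuous_map (right_fibre_product H Z \<sigma>) Z (\<lambda>(p, x). ract p x)"
  using right_act by (simp add: right_action_def)

lemma topspace_lfp: "topspace (left_fibre_product G Z \<rho>) = {(x, p). x \<in> arrows G \<and> p \<in> topspace Z \<and> src G x = \<rho> p}"
  by (auto simp: left_fibre_product_def)

lemma topspace_rfp: "topspace (right_fibre_product H Z \<sigma>) = {(p, x). p \<in> topspace Z \<and> x \<in> arrows H \<and> \<sigma> p = rng H x}"
  by (auto simp: right_fibre_product_def)

lemma continuous_map_lact:
  assumes "continuous_map P (arr_top G) f" "continuous_map P Z g"
    and "\<And>p. p \<in> topspace P \<Longrightarrow> src G (f p) = \<rho> (g p)"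
  shows "continuous_map P Z (\<lambda>p. lact (f p) (g p))"
proof -
  have "continuous_map P (left_fibre_product G Z \<rho>) (\<lambda>p. (f p, g p))"
    using assms by (auto simp: left_fibre_product_def continuous_map_in_subtopology continuous_map_pairwise o_def)
  from continuous_map_compose[OF this cont_lact] show ?thesis by (simp add: o_def)
qed

lemma lact_closed [simp]: "x \<in> arrows G \<Longrightarrow> z \<in> topspace Z \<Longrightarrow> src G x = \<rho> z \<Longrightarrow> lact x z \<in> topspace Z"
  using imageI[of "(x, z)" "topspace (left_fibre_product G Z \<rho>)" "\<lambda>(x, p). lact x p"]
    continuous_map_image_subset_topspace[OF cont_lact] by (auto simp: topspace_lfp)

lemma ract_closed [simp]: "z \<in> topspace Z \<Longrightarrow> x \<in> arrows H \<Longrightarrow> \<sigma> z = rng H x \<Longrightarrow> ract z x \<in> topspace Z"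
  using imageI[of "(z, x)" "topspace (right_fibre_product H Z \<sigma>)" "\<lambda>(p, x). ract p x"]
    continuous_map_image_subset_topspace[OF cont_ract] by (auto simp: topspace_rfp)

lemma \<rho>_lact [simp]: "x \<in> arrows G \<Longrightarrow> z \<in> topspace Z \<Longrightarrow> src G x = \<rho> z \<Longrightarrow> \<rho> (lact x z) = rng G x"
  and lact_unit [simp]: "z \<in> topspace Z \<Longrightarrow> lact (\<rho> z) z = z"
  and lact_lact: "x \<in> arrows G \<Longrightarrow> y \<in> arrows G \<Longrightarrow> z \<in> topspace Z \<Longrightarrow> src G x = rng G y \<Longrightarrow> src G y = \<rho> z \<Longrightarrow>
    lact x (lact y z) = lact (mul G x y) z"
  using left_act by (auto simp: left_action_def)

lemma \<sigma>_ract [simp]: "z \<in> topspace Z \<Longrightarrow> x \<in> arrows H \<Longrightarrow> \<sigma> z = rng H x \<Longrightarrow> \<sigma> (ract z x) = src H x"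
  and ract_unit [simp]: "z \<in> topspace Z \<Longrightarrow> ract z (\<sigma> z) = z"
  and ract_ract: "z \<in> topspace Z \<Longrightarrow> x \<in> arrows H \<Longrightarrow> y \<in> arrows H \<Longrightarrow> \<sigma> z = rng H x \<Longrightarrow> src H x = rng H y \<Longrightarrow>
    ract (ract z x) y = ract z (mul H x y)"
  using right_act by (auto simp: right_action_def)

lemma \<rho>_ract [simp]: "z \<in> topspace Z \<Longrightarrow> y \<in> arrows H \<Longrightarrow> \<sigma> z = rng H y \<Longrightarrow> \<rho> (ract z y) = \<rho> z"
  and \<sigma>_lact [simp]: "x \<in> arrows G \<Longrightarrow> z \<in> topspace Z \<Longrightarrow> src G x = \<rho> z \<Longrightarrow> \<sigma> (lact x z) = \<sigma> z"
  and ract_lact: "x \<in> arrows G \<Longrightarrow> z \<in> topspace Z \<Longrightarrow> y \<in> arrows H \<Longrightarrow> src G x = \<rho> z \<Longrightarrow> \<sigma> z = rng H y \<Longrightarrow>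
    ract (lact x z) y = lact x (ract z y)"
  using commute by (auto simp: actions_commute_def)

lemma \<rho>_surj: "\<rho> ` topspace Z = units G" and \<sigma>_surj: "\<sigma> ` topspace Z = units H"
proof -
  have surj: "m ` topspace Z = topspace Y" if ih: "induces_homeomorphism Z q Y m"
    for q :: "'z \<Rightarrow> 'b" and Y :: "'c topology" and m
  proof -
    obtain f where f: "homeomorphic_map (quotient_topology Z q) Y f" "\<forall>x \<in> topspace Z. f (q x) = m x"
      using ih unfolding induces_homeomorphism_def by blast
    have "topspace (quotient_topology Z q) = q ` topspace Z"
      using quotient_imp_surjective_map[OF quotient_map_quotient_topology] by metis
    then have "topspace Y = f ` (q ` topspace Z)"
      using homeomorphic_imp_surjective_map[OF f(1)] by simp
    also have "\<dots> = m ` topspace Z"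
      unfolding image_image using f(2) by (intro image_cong) auto
    finally show ?thesis by simp
  qed
  show "\<rho> ` topspace Z = units G" "\<sigma> ` topspace Z = units H"
    using surj[OF homeo_\<rho>] surj[OF homeo_\<sigma>] by simp_all
qed

text \<open>Injectivity of the induced map turns equality of moments into equality of orbits, which
  yields transitivity of each action on the fibres of the other moment map.\<close>

lemma induces_homeomorphism_orbit:
  assumes ih: "induces_homeomorphism X q Y m" and xy: "x \<in> topspace X" "y \<in> topspace X" "m x = m y"
  shows "q x = q y"
proof -
  obtain f where f: "homeomorphic_map (quotient_topology X q) Y f" "\<forall>x \<in> topspace X. f (q x) = m x"
    using ih unfolding induces_homeomorphism_def by blast
  have "topspace (quotient_topology X q) = q ` topspace X"
    using quotient_imp_surjective_map[OF quotient_map_quotient_topology] by metis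
  then have "inj_on f (q ` topspace X)"
    using homeomorphic_imp_injective_map[OF f(1)] by simp
  then show ?thesis using f(2) xy by (metis image_eqI inj_onD)
qed

lemma right_transitive:
  assumes "z \<in> topspace Z" "w \<in> topspace Z" "\<rho> z = \<rho> w"
  obtains h where "h \<in> arrows H" "rng H h = \<sigma> z" "ract z h = w"
proof -
  have "right_orbit H \<sigma> ract z = right_orbit H \<sigma> ract w"
    using induces_homeomorphism_orbit[OF homeo_\<rho> assms] .
  moreover have "w \<in> right_orbit H \<sigma> ract w"
    using assms(2) by (auto simp: right_orbit_def intro!: exI[of _ "\<sigma> w"])
  ultimately have "w \<in> right_orbit H \<sigma> ract z" by simp
  then show thesis using that by (auto simp: right_orbit_def)
qed

lemma left_transitive:
  assumes "z \<in> topspace Z" "w \<in> topspace Z" "\<sigma> z = \<sigma> w"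
  obtains x where "x \<in> arrows G" "src G x = \<rho> z" "lact x z = w"
proof -
  have "left_orbit G \<rho> lact z = left_orbit G \<rho> lact w"
    using induces_homeomorphism_orbit[OF homeo_\<sigma> assms] .
  moreover have "w \<in> left_orbit G \<rho> lact w"
    using assms(2) by (auto simp: left_orbit_def intro!: exI[of _ "\<rho> w"])
  ultimately have "w \<in> left_orbit G \<rho> lact z" by simp
  then show thesis using that by (auto simp: left_orbit_def)
qed

text \<open>If z h = z k, then h k^-1 fixes z and is a unit by freeness.\<close>

lemma right_cancel:
  assumes z: "z \<in> topspace Z" and h: "h \<in> arrows H" "rng H h = \<sigma> z" and k: "k \<in> arrows H" "rng H k = \<sigma> z"
    and eq: "ract z h = ract z k"
  shows "h = k"
proof -
  have sk: "src H h = src H k" using eq \<sigma>_ract[OF z h(1)] \<sigma>_ract[OF z k(1)] h k by simp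
  have ik: "gpd_inv H k \<in> arrows H" "rng H (gpd_inv H k) = src H k" "src H (gpd_inv H k) = rng H k"
    using k by (simp_all add: H.inv_closed H.rng_inv H.src_inv)
  have "ract z (mul H h (gpd_inv H k)) = ract (ract z k) (gpd_inv H k)"
    using ract_ract[OF z h(1) ik(1)] h ik sk eq by simp
  also have "\<dots> = z"
    using ract_ract[OF z k(1) ik(1)] k ik H.mul_inv[OF k(1)] z by simp
  finally have "ract z (mul H h (gpd_inv H k)) = z" .
  moreover have "mul H h (gpd_inv H k) \<in> arrows H" "\<sigma> z = rng H (mul H h (gpd_inv H k))"
    using h ik sk by (simp_all add: H.mul_closed H.rng_mul)
  ultimately have "mul H h (gpd_inv H k) = \<sigma> z"
    using right_free z unfolding free_right_action_def by blast
  then have "h = mul H (\<sigma> z) k"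
    using H.mul_inv_cancel_right[OF h(1) k(1) sk] by simp
  then show ?thesis using H.rng_left_unit[OF k(1)] k(2) by simp
qed

text \<open>The \<open>H\<close>-valued bracket of the equivalence. For \<rho> z = \<rho> w,
  existence comes from transitivity of \<open>H\<close> on the fibres of \<rho> and uniqueness from
  \<open>right_cancel\<close>.\<close>

definition transporter :: "'z \<Rightarrow> 'z \<Rightarrow> 'h" where
  "transporter z w = (THE h. h \<in> arrows H \<and> rng H h = \<sigma> z \<and> ract z h = w)"

lemma transporter_eq: "z \<in> topspace Z \<Longrightarrow> h \<in> arrows H \<Longrightarrow> rng H h = \<sigma> z \<Longrightarrow> ract z h = w \<Longrightarrow> transporter z w = h"
  unfolding transporter_def by (rule the_equality) (auto intro: right_cancel)

lemma transporter:
  assumes "z \<in> topspace Z" "w \<in> topspace Z" "\<rho> z = \<rho> w"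
  shows "transporter z w \<in> arrows H" "rng H (transporter z w) = \<sigma> z" "ract z (transporter z w) = w" "src H (transporter z w) = \<sigma> w"
proof -
  obtain h where h: "h \<in> arrows H" "rng H h = \<sigma> z" "ract z h = w" using right_transitive[OF assms] .
  moreover have "transporter z w = h" by (rule transporter_eq[OF assms(1) h])
  ultimately show "transporter z w \<in> arrows H" "rng H (transporter z w) = \<sigma> z" "ract z (transporter z w) = w" by auto
  then show "src H (transporter z w) = \<sigma> w" using \<sigma>_ract[OF assms(1)] by metis
qed

text \<open>Holds because the actions commute. It lets a quotient of two arrows of \<open>H\<close>
  be computed after a common arrow of \<open>G\<close> has been cancelled.\<close>

lemma transporter_lact:
  assumes z: "z \<in> topspace Z" "w \<in> topspace Z" "\<rho> z = \<rho> w" and x: "x \<in> arrows G" "src G x = \<rho> z"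
  shows "transporter (lact x z) (lact x w) = transporter z w"
  using transporter[OF z] assms ract_lact[OF x(1) z(1)] by (intro transporter_eq) auto

text \<open>The source of left invariance: moving the first argument by h turns the transporter into
  its left translate by h^-1.\<close>

lemma transporter_ract:
  assumes z: "z \<in> topspace Z" "w \<in> topspace Z" "\<rho> z = \<rho> w" and h: "h \<in> arrows H" "rng H h = \<sigma> z"
  shows "mul H h (transporter (ract z h) w) = transporter z w"
proof -
  have zh: "ract z h \<in> topspace Z" "\<rho> (ract z h) = \<rho> w" "\<sigma> (ract z h) = src H h" using z h by auto
  note t = transporter[OF zh(1) z(2) zh(2)]
  have "ract z (mul H h (transporter (ract z h) w)) = w"
    using ract_ract[OF z(1) h(1) t(1)] t zh h by simp
  then have "transporter z w = mul H h (transporter (ract z h) w)"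
    using t zh h z by (intro transporter_eq) (auto simp: H.mul_closed H.rng_mul)
  then show ?thesis by simp
qed

text \<open>Properness makes \<open>(p, h) \<mapsto> (p h, p)\<close> a closed embedding, and \<open>transporter\<close> is read off its inverse.\<close>

lemma continuous_transporter:
  "continuous_map (subtopology (prod_topology Z Z) {(z, w). \<rho> z = \<rho> w}) (arr_top H) (\<lambda>(z, w). transporter z w)"
proof -
  let ?E = "right_fibre_product H Z \<sigma>" and ?ZZ = "prod_topology Z Z"
  define \<Theta> where "\<Theta> = (\<lambda>(p, x). (ract p x, p))"
  have ZZ: "locally_compact_space ?ZZ" "Hausdorff_space ?ZZ"
    using Z.lc Z.haus by (auto simp: locally_compact_space_prod_topology Hausdorff_space_prod_topology)
  have snd: "continuous_map ?E (arr_top H) snd" and fst: "continuous_map ?E Z fst"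
    unfolding right_fibre_product_def
    by (auto intro: continuous_map_from_subtopology continuous_map_fst continuous_map_snd)
  have cont: "continuous_map ?E ?ZZ \<Theta>"
    using cont_ract fst by (auto simp: \<Theta>_def continuous_map_pairwise o_def case_prod_unfold)
  \<comment> \<open>Compact preimages of compact sets give a closed map because the target, being
    locally compact, is a k-space.\<close>
  have "proper_map ?E ?ZZ \<Theta>"
  proof (rule compact_imp_proper_map)
    show "k_space ?ZZ" "kc_space ?ZZ"
      using ZZ by (auto intro: locally_compact_imp_k_space Hausdorff_imp_kc_space)
    show "\<Theta> \<in> topspace ?E \<rightarrow> topspace ?ZZ" "continuous_map ?E ?ZZ \<Theta> \<or> kc_space ?E"
      using cont by (auto simp: continuous_map_def)
    fix C assume "compactin ?ZZ C"
    then have "compactin ?E {(p, x) \<in> topspace ?E. (ract p x, p) \<in> C}"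
      using right_proper by (simp add: proper_right_action_def)
    moreover have "{z \<in> topspace ?E. \<Theta> z \<in> C} = {(p, x) \<in> topspace ?E. (ract p x, p) \<in> C}"
      by (auto simp: \<Theta>_def)
    ultimately show "compactin ?E {z \<in> topspace ?E. \<Theta> z \<in> C}" by simp
  qed
  then have "closed_map ?E ?ZZ \<Theta>" by (simp add: proper_map_def)
  moreover have "inj_on \<Theta> (topspace ?E)"
    by (auto simp: inj_on_def \<Theta>_def topspace_rfp intro: right_cancel)
  ultimately have "embedding_map ?E ?ZZ \<Theta>"
    using cont by (intro injective_closed_imp_embedding_map)
  then obtain g where g: "continuous_map (subtopology ?ZZ (\<Theta> ` topspace ?E)) ?E g"
    "\<And>e. e \<in> topspace ?E \<Longrightarrow> g (\<Theta> e) = e"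
    unfolding embedding_map_def homeomorphic_map_maps homeomorphic_maps_def by blast
  let ?W = "subtopology ?ZZ {(z, w). \<rho> z = \<rho> w}"
  have in_E: "(z, transporter z w) \<in> topspace ?E" "\<Theta> (z, transporter z w) = (w, z)"
    if "z \<in> topspace Z" "w \<in> topspace Z" "\<rho> z = \<rho> w" for z w
    using transporter[OF that] that by (auto simp: topspace_rfp \<Theta>_def)
  have "continuous_map ?W ?ZZ prod.swap"
    by (auto simp: continuous_map_pairwise o_def
        intro: continuous_map_from_subtopology continuous_map_fst continuous_map_snd)
  moreover have "prod.swap ` topspace ?W \<subseteq> \<Theta> ` topspace ?E"
  proof
    fix e assume "e \<in> prod.swap ` topspace ?W"
    then obtain z w where "e = (w, z)" "z \<in> topspace Z" "w \<in> topspace Z" "\<rho> z = \<rho> w" by auto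
    then show "e \<in> \<Theta> ` topspace ?E"
      using in_E[of z w] by (metis image_eqI)
  qed
  ultimately have "continuous_map ?W (subtopology ?ZZ (\<Theta> ` topspace ?E)) prod.swap"
    by (auto simp: continuous_map_in_subtopology)
  from continuous_map_compose[OF continuous_map_compose[OF this g(1)] snd]
  have "continuous_map ?W (arr_top H) (snd \<circ> (g \<circ> prod.swap))" .
  then show ?thesis
  proof (rule continuous_map_eq)
    fix e assume "e \<in> topspace ?W"
    then obtain z w where e: "e = (z, w)" "z \<in> topspace Z" "w \<in> topspace Z" "\<rho> z = \<rho> w" by auto
    then show "(snd \<circ> (g \<circ> prod.swap)) e = (\<lambda>(z, w). transporter z w) e"
      using g(2)[OF in_E(1), of z w] in_E(2)[of z w] by simp
  qed
qed

end

section \<open>Compactness in fibre products and the countable base of \<open>Z\<close>\<close>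

lemma compact_image_equalizer:
  assumes A: "compactin X A" and B: "compactin Y B" and T: "Hausdorff_space T"
    and f: "continuous_map X T f" and g: "continuous_map Y T g"
    and \<phi>: "continuous_map (subtopology (prod_topology X Y) {(x, y). f x = g y}) W (\<lambda>(x, y). \<phi> x y)"
  shows "compactin W {\<phi> a b |a b. a \<in> A \<and> b \<in> B \<and> f a = g b}"
proof -
  let ?P = "prod_topology X Y" and ?E = "{(a, b). a \<in> A \<and> b \<in> B \<and> f a = g b}"
  have AB: "compactin ?P (A \<times> B)" using A B by (simp add: compactin_Times)
  have "compactin ?P ({e \<in> topspace ?P. (f \<circ> fst) e = (g \<circ> snd) e} \<inter> A \<times> B)"
    by (rule closed_Int_compactin[OF closedin_continuous_maps_eq[OF T
          continuous_map_compose[OF continuous_map_fst f] continuous_map_compose[OF continuous_map_snd g]] AB])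
  moreover have "{e \<in> topspace ?P. (f \<circ> fst) e = (g \<circ> snd) e} \<inter> A \<times> B = ?E"
    using compactin_subset_topspace[OF A] compactin_subset_topspace[OF B] by auto
  ultimately have "compactin (subtopology ?P {(x, y). f x = g y}) ?E"
    by (auto simp: compactin_subtopology)
  from image_compactin[OF this \<phi>] show ?thesis
    by (rule back_subst[where P = "compactin W"]) auto
qed

lemma second_countable_prod_topology:
  assumes "second_countable X" "second_countable Y"
  shows "second_countable (prod_topology X Y)"
proof -
  obtain \<B> where B: "countable \<B>" "\<And>V. V \<in> \<B> \<Longrightarrow> openin X V"
    "\<And>U x. openin X U \<Longrightarrow> x \<in> U \<Longrightarrow> \<exists>V \<in> \<B>. x \<in> V \<and> V \<subseteq> U"
    using assms(1) unfolding second_countable_def by metis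
  obtain \<C> where C: "countable \<C>" "\<And>V. V \<in> \<C> \<Longrightarrow> openin Y V"
    "\<And>U x. openin Y U \<Longrightarrow> x \<in> U \<Longrightarrow> \<exists>V \<in> \<C>. x \<in> V \<and> V \<subseteq> U"
    using assms(2) unfolding second_countable_def by metis
  show ?thesis
    unfolding second_countable_def
  proof (intro exI[of _ "(\<lambda>(U, V). U \<times> V) ` (\<B> \<times> \<C>)"] conjI allI impI ballI)
    show "countable ((\<lambda>(U, V). U \<times> V) ` (\<B> \<times> \<C>))" using B(1) C(1) by auto
    show "openin (prod_topology X Y) W" if "W \<in> (\<lambda>(U, V). U \<times> V) ` (\<B> \<times> \<C>)" for W
      using that B(2) C(2) by (auto simp: openin_prod_Times_iff)
    fix W e assume W: "openin (prod_topology X Y) W \<and> e \<in> W"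
    obtain x y where e: "e = (x, y)" by (cases e)
    obtain U V where UV: "openin X U" "openin Y V" "x \<in> U" "y \<in> V" "U \<times> V \<subseteq> W"
      using W unfolding e openin_prod_topology_alt by metis
    obtain U' where U': "U' \<in> \<B>" "x \<in> U'" "U' \<subseteq> U" using B(3)[OF UV(1,3)] by blast
    obtain V' where V': "V' \<in> \<C>" "y \<in> V'" "V' \<subseteq> V" using C(3)[OF UV(2,4)] by blast
    have "U' \<times> V' \<in> (\<lambda>(U, V). U \<times> V) ` (\<B> \<times> \<C>)" using U' V' by auto
    moreover have "e \<in> U' \<times> V'" "U' \<times> V' \<subseteq> W" using U' V' UV(5) e by auto
    ultimately show "\<exists>V\<in>(\<lambda>(U, V). U \<times> V) ` (\<B> \<times> \<C>). e \<in> V \<and> V \<subseteq> W" by blast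
  qed
qed

text \<open>A continuous injection of a compact space into a Hausdorff space is an embedding, and
  subspaces inherit a countable base.\<close>

lemma second_countable_compact_injection:
  assumes C: "compactin Z C" and W: "Hausdorff_space W" "second_countable W"
    and \<phi>: "continuous_map Z W \<phi>" "inj_on \<phi> C"
  shows "second_countable (subtopology Z C)"
proof -
  have CZ: "C \<subseteq> topspace Z" using C compactin_subset_topspace by blast
  have c: "continuous_map (subtopology Z C) W \<phi>"
    using \<phi>(1) by (rule continuous_map_from_subtopology)
  have "closed_map (subtopology Z C) W \<phi>"
    using C W(1) c by (intro continuous_imp_closed_map) (auto simp: compact_space_subtopology)
  then have "embedding_map (subtopology Z C) W \<phi>"
    using c \<phi>(2) CZ by (intro injective_closed_imp_embedding_map) (auto simp: Int_absorb1)
  then have "subtopology Z C homeomorphic_space subtopology W (\<phi> ` topspace (subtopology Z C))"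
    unfolding embedding_map_def homeomorphic_space by blast
  then show ?thesis
    using second_countable_subtopology[OF W(2)] homeomorphic_space_second_countability by blast
qed

lemma second_countable_countable_open_cover:
  assumes D: "countable D" "\<And>d. d \<in> D \<Longrightarrow> openin Z (U d)" "topspace Z \<subseteq> (\<Union>d\<in>D. U d)"
    and sc: "\<And>d. d \<in> D \<Longrightarrow> second_countable (subtopology Z (U d))"
  shows "second_countable Z"
proof -
  have "\<exists>\<B>. countable \<B> \<and> (\<forall>V\<in>\<B>. openin (subtopology Z (U d)) V) \<and>
     (\<forall>O' x. openin (subtopology Z (U d)) O' \<and> x \<in> O' \<longrightarrow> (\<exists>V\<in>\<B>. x \<in> V \<and> V \<subseteq> O'))" if "d \<in> D" for d
    using sc[OF that] unfolding second_countable_def by blast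
  then obtain \<B> where B: "\<And>d. d \<in> D \<Longrightarrow> countable (\<B> d)"
    "\<And>d V. d \<in> D \<Longrightarrow> V \<in> \<B> d \<Longrightarrow> openin (subtopology Z (U d)) V"
    "\<And>d O' x. d \<in> D \<Longrightarrow> openin (subtopology Z (U d)) O' \<Longrightarrow> x \<in> O' \<Longrightarrow> \<exists>V\<in>\<B> d. x \<in> V \<and> V \<subseteq> O'"
    by metis
  show ?thesis
    unfolding second_countable_def
  proof (intro exI[of _ "\<Union>d\<in>D. \<B> d"] conjI allI impI ballI)
    show "countable (\<Union>d\<in>D. \<B> d)" using D(1) B(1) by blast
    show "openin Z V" if V: "V \<in> (\<Union>d\<in>D. \<B> d)" for V
    proof -
      obtain d where "d \<in> D" "V \<in> \<B> d" using V by blast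
      then show ?thesis using B(2) D(2) openin_open_subtopology by blast
    qed
    fix O' x assume O': "openin Z O' \<and> x \<in> O'"
    then have "x \<in> topspace Z" using openin_subset by blast
    then obtain d where d: "d \<in> D" "x \<in> U d" using D(3) by blast
    have "openin (subtopology Z (U d)) (O' \<inter> U d)"
      using O' by (auto simp: openin_subtopology)
    then obtain V where "V \<in> \<B> d" "x \<in> V" "V \<subseteq> O' \<inter> U d"
      using B(3)[OF d(1), of "O' \<inter> U d" x] O' d(2) by blast
    then show "\<exists>V\<in>(\<Union>d\<in>D. \<B> d). x \<in> V \<and> V \<subseteq> O'" using d(1) by blast
  qed
qed

context equivalence
begin

lemma compact_ract:
  assumes "compactin Z K" "compactin (arr_top H) L"
  shows "compactin Z {ract p h |p h. p \<in> K \<and> h \<in> L \<and> \<sigma> p = rng H h}"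
  by (rule compact_image_equalizer[OF assms H.haus])
    (use cont_\<sigma> H.continuous_rng cont_ract in
      \<open>auto simp: unit_space_def right_fibre_product_def dest: continuous_map_into_fulltopology\<close>)

text \<open>By the Lindelof property, the \<rho>-images of countably many compact neighbourhoods
  cover the units of \<open>G\<close>. As \<open>H\<close> is transitive on the fibres of \<rho>,
  moving these neighbourhoods by a compact exhaustion of \<open>H\<close> covers
  \<open>Z\<close>.\<close>

lemma sigma_compact_Z:
  obtains \<K> where "countable \<K>" "\<And>K. K \<in> \<K> \<Longrightarrow> compactin Z K" "topspace Z \<subseteq> \<Union>\<K>"
proof -
  have "\<forall>z \<in> topspace Z. \<exists>U C. openin Z U \<and> compactin Z C \<and> z \<in> U \<and> U \<subseteq> C"
    using Z.lc by (simp add: locally_compact_space_def)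
  then obtain U C where UC: "\<And>z. z \<in> topspace Z \<Longrightarrow> openin Z (U z)" "\<And>z. z \<in> topspace Z \<Longrightarrow> compactin Z (C z)"
    "\<And>z. z \<in> topspace Z \<Longrightarrow> z \<in> U z" "\<And>z. z \<in> topspace Z \<Longrightarrow> U z \<subseteq> C z"
    by metis
  have "Lindelof_space (unit_space G)"
    using G.sc_unit_space by (rule second_countable_imp_Lindelof_space)
  moreover have "\<forall>V \<in> (\<lambda>z. \<rho> ` U z) ` topspace Z. openin (unit_space G) V"
    using UC(1) open_\<rho> by (auto simp: open_map_def)
  moreover have "topspace (unit_space G) \<subseteq> \<Union>((\<lambda>z. \<rho> ` U z) ` topspace Z)"
    using \<rho>_surj UC(3) by fastforce
  ultimately obtain \<V> where V: "countable \<V>" "\<V> \<subseteq> (\<lambda>z. \<rho> ` U z) ` topspace Z" "units G \<subseteq> \<Union>\<V>"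
    unfolding Lindelof_space_alt by (metis G.topspace_unit_space)
  then obtain D where D: "countable D" "D \<subseteq> topspace Z" "units G \<subseteq> (\<Union>z\<in>D. \<rho> ` U z)"
    by (metis countable_subset_image)
  obtain E :: "nat \<Rightarrow> 'h set" where E: "\<And>n. compactin (arr_top H) (E n)" "\<And>m n. m \<le> n \<Longrightarrow> E m \<subseteq> E n"
    "\<And>K. compactin (arr_top H) K \<Longrightarrow> \<exists>n. K \<subseteq> E n"
    using H.compact_exhaustion[OF H.sc] by blast
  define Q where "Q z n = {ract p h |p h. p \<in> C z \<and> h \<in> E n \<and> \<sigma> p = rng H h}" for z n
  show thesis
  proof (rule that[of "(\<lambda>(z, n). Q z n) ` (D \<times> UNIV)"])
    show "countable ((\<lambda>(z, n). Q z n) ` (D \<times> UNIV))" using D(1) by auto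
    show "compactin Z K" if "K \<in> (\<lambda>(z, n). Q z n) ` (D \<times> UNIV)" for K
      using that D(2) UC(2) compact_ract[OF _ E(1)] by (auto simp: Q_def)
    show "topspace Z \<subseteq> \<Union>((\<lambda>(z, n). Q z n) ` (D \<times> UNIV))"
    proof
      fix w assume w: "w \<in> topspace Z"
      then obtain d p where d: "d \<in> D" "p \<in> U d" "\<rho> p = \<rho> w" 
        using subsetD[OF D(3) \<rho>_units[OF w]] that by (elim UN_E imageE) metis
      have dZ: "d \<in> topspace Z" using d(1) D(2) by blast
      have p: "p \<in> C d" "p \<in> topspace Z"
        using d(2) UC(4)[OF dZ] openin_subset[OF UC(1)[OF dZ]] by auto
      obtain h where h: "h \<in> arrows H" "rng H h = \<sigma> p" "ract p h = w"
        using right_transitive[OF p(2) w d(3)] .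
      have "compactin (arr_top H) {h}" using h by simp
      then obtain n where "h \<in> E n" using E(3) by blast
      then have "w \<in> Q d n" unfolding Q_def using h(2,3)[symmetric] p(1) by blast
      then show "w \<in> \<Union>((\<lambda>(z, n). Q z n) ` (D \<times> UNIV))" using d(1) by auto
    qed
  qed
qed

text \<open>An arrow carrying z to w has source \<rho> z and range \<rho> w; when these agree it
  lies in an isotropy group.\<close>

lemma principal_injective:
  assumes pr: "principal_groupoid G"
    and z: "z \<in> topspace Z" "w \<in> topspace Z" "\<rho> z = \<rho> w" "\<sigma> z = \<sigma> w"
  shows "z = w"
proof -
  obtain x where x: "x \<in> arrows G" "src G x = \<rho> z" "lact x z = w"
    using left_transitive[OF z(1,2,4)] .
  then have "rng G x = \<rho> z" using \<rho>_lact[OF x(1) z(1)] z(3) by simp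
  then have "x = \<rho> z"
    using pr x z(1) by (auto simp: principal_groupoid_def free_left_action_def)
  then show ?thesis using x(3) z(1) by simp
qed

text \<open>Each compact neighbourhood embeds by (\<rho>, \<sigma>) into the product of the unit
  spaces, and countably many of the open sets inside such neighbourhoods cover
  \<open>Z\<close>.\<close>

lemma second_countable_Z:
  assumes pr: "principal_groupoid G"
  shows "second_countable Z"
proof -
  let ?W = "prod_topology (unit_space G) (unit_space H)"
  have W: "Hausdorff_space ?W" "second_countable ?W"
    using G.lch_unit_space H.lch_unit_space G.sc_unit_space H.sc_unit_space
    by (auto simp: Hausdorff_space_prod_topology second_countable_prod_topology lch_space_def)
  have c: "continuous_map Z ?W (\<lambda>z. (\<rho> z, \<sigma> z))"
    using cont_\<rho> cont_\<sigma> by (simp add: continuous_map_pairwise o_def)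
  have "\<forall>z \<in> topspace Z. \<exists>U C. openin Z U \<and> compactin Z C \<and> z \<in> U \<and> U \<subseteq> C"
    using Z.lc by (simp add: locally_compact_space_def)
  then obtain U C where UC: "\<And>z. z \<in> topspace Z \<Longrightarrow> openin Z (U z)" "\<And>z. z \<in> topspace Z \<Longrightarrow> compactin Z (C z)"
    "\<And>z. z \<in> topspace Z \<Longrightarrow> z \<in> U z" "\<And>z. z \<in> topspace Z \<Longrightarrow> U z \<subseteq> C z"
    by metis
  have scU: "second_countable (subtopology Z (U z))" if "z \<in> topspace Z" for z
  proof -
    have "inj_on (\<lambda>z. (\<rho> z, \<sigma> z)) (C z)"
      using principal_injective[OF pr] compactin_subset_topspace[OF UC(2)[OF that]]
      by (auto simp: inj_on_def subset_iff)
    then have "second_countable (subtopology Z (C z))"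
      using second_countable_compact_injection[OF UC(2)[OF that] W c] by blast
    from second_countable_subtopology[OF this, of "U z"] show ?thesis
      using UC(4)[OF that] by (simp add: subtopology_subtopology Int_absorb1)
  qed
  obtain \<K> where K: "countable \<K>" "\<And>K. K \<in> \<K> \<Longrightarrow> compactin Z K" "topspace Z \<subseteq> \<Union>\<K>"
    using sigma_compact_Z by blast
  have "\<exists>F. finite F \<and> F \<subseteq> topspace Z \<and> K \<subseteq> (\<Union>z\<in>F. U z)" if KK: "K \<in> \<K>" for K
  proof -
    have "K \<subseteq> \<Union>(U ` topspace Z)" using compactin_subset_topspace[OF K(2)[OF KK]] UC(3) by blast
    moreover have "\<forall>V \<in> U ` topspace Z. openin Z V" using UC(1) by blast
    ultimately obtain \<F> where "finite \<F>" "\<F> \<subseteq> U ` topspace Z" "K \<subseteq> \<Union>\<F>"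
      using K(2)[OF KK] unfolding compactin_def by meson
    then show ?thesis by (metis finite_subset_image)
  qed
  then obtain F where F: "\<And>K. K \<in> \<K> \<Longrightarrow> finite (F K)" "\<And>K. K \<in> \<K> \<Longrightarrow> F K \<subseteq> topspace Z"
    "\<And>K. K \<in> \<K> \<Longrightarrow> K \<subseteq> (\<Union>z\<in>F K. U z)" by metis
  show ?thesis
  proof (rule second_countable_countable_open_cover[of "\<Union>K\<in>\<K>. F K" Z U])
    show "countable (\<Union>K\<in>\<K>. F K)" using K(1) F(1) by (auto intro: countable_finite)
    show "topspace Z \<subseteq> (\<Union>d\<in>\<Union>K\<in>\<K>. F K. U d)"
    proof
      fix z assume "z \<in> topspace Z"
      then obtain K where "K \<in> \<K>" "z \<in> K" using K(3) by blast
      with F(3)[of K] show "z \<in> (\<Union>d\<in>\<Union>K\<in>\<K>. F K. U d)" by blast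
    qed
  qed (use F(2) UC(1) scU in auto)
qed

end

section \<open>Averaging over orbits of \<open>G\<close>\<close>

locale haar_equivalence = G: haar_groupoid G \<nu> + equivalence G H Z \<rho> lact \<sigma> ract
  for G :: "'g groupoid" and \<nu> :: "'g \<Rightarrow> 'g measure" and H :: "'h groupoid" and Z :: "'z topology"
    and \<rho> :: "'z \<Rightarrow> 'g" and lact :: "'g \<Rightarrow> 'z \<Rightarrow> 'z"
    and \<sigma> :: "'z \<Rightarrow> 'h" and ract :: "'z \<Rightarrow> 'h \<Rightarrow> 'z"
begin

text \<open>Properness of the left action, put in terms of inverses because \<open>avg\<close> moves
  z by \<open>gpd_inv G x\<close>.\<close>

lemma orbit_return_compact:
  assumes K: "compactin Z K" and C: "compactin Z C"
  obtains L where "compactin (arr_top G) L"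
    "\<And>x z. z \<in> C \<Longrightarrow> x \<in> arrows G \<Longrightarrow> rng G x = \<rho> z \<Longrightarrow> lact (gpd_inv G x) z \<in> K \<Longrightarrow> x \<in> L"
proof -
  let ?E = "left_fibre_product G Z \<rho>"
  have "compactin ?E {(x, p) \<in> topspace ?E. (lact x p, p) \<in> K \<times> C}" (is "compactin _ ?S")
    using left_proper[unfolded proper_left_action_def, rule_format, of "K \<times> C"] K C
    by (simp only: compactin_Times) simp
  moreover have "continuous_map ?E (arr_top G) (\<lambda>e. gpd_inv G (fst e))"
    unfolding left_fibre_product_def
    by (intro G.continuous_map_inv continuous_map_from_subtopology continuous_map_fst)
  ultimately have L: "compactin (arr_top G) ((\<lambda>e. gpd_inv G (fst e)) ` ?S)"
    by (rule image_compactin)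
  show thesis
  proof (rule that[OF L])
    fix x z assume z: "z \<in> C" and x: "x \<in> arrows G" "rng G x = \<rho> z" and *: "lact (gpd_inv G x) z \<in> K"
    have "(gpd_inv G x, z) \<in> ?S"
      using z x * compactin_subset_topspace[OF C]
      by (auto simp: topspace_lfp G.inv_closed G.src_inv)
    moreover have "x = gpd_inv G (fst (gpd_inv G x, z))" using G.inv_inv[OF x(1)] by simp
    ultimately show "x \<in> (\<lambda>e. gpd_inv G (fst e)) ` ?S" by (metis (no_types, lifting) imageI)
  qed
qed

text \<open>Haar measures sit on range fibres, so x runs through the arrows with range \<rho> z and
  z is moved by the inverse of x.\<close>

definition avg :: "('z \<Rightarrow> real) \<Rightarrow> 'z \<Rightarrow> real" where
  "avg g z = G.fs.fint (\<rho> z) (\<lambda>x. g (lact (gpd_inv G x) z))"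

lemma avg_continuous:
  assumes g: "g \<in> Cc_real Z"
  shows "continuous_map Z euclideanreal (avg g)"
    and "\<And>z. z \<in> topspace Z \<Longrightarrow> G.fs.fibre_Cc (\<rho> z) (\<lambda>x. g (lact (gpd_inv G x) z))"
proof -
  obtain K where K: "compactin Z K" "\<And>x. x \<in> topspace Z \<Longrightarrow> x \<notin> K \<Longrightarrow> g x = 0"
    using g by (rule Cc_realE) blast
  let ?W = "subtopology (prod_topology Z (arr_top G)) {(z, x). \<rho> z = rng G x}"
  have "continuous_map ?W Z (\<lambda>e. lact (gpd_inv G (snd e)) (fst e))"
    by (intro continuous_map_lact G.continuous_map_inv continuous_map_from_subtopology continuous_map_fst continuous_map_snd)
      (auto simp: G.src_inv)
  from continuous_map_compose[OF this Cc_real_continuous[OF g]]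
  have F: "continuous_map ?W euclideanreal (\<lambda>(z, x). g (lact (gpd_inv G x) z))"
    by (simp add: o_def case_prod_unfold)
  have supp: "\<exists>N L. openin Z N \<and> z \<in> N \<and> compactin (arr_top G) L \<and>
      (\<forall>z' \<in> N. \<forall>x \<in> arrows G. \<rho> z' = rng G x \<longrightarrow> x \<notin> L \<longrightarrow> g (lact (gpd_inv G x) z') = 0)"
    if z: "z \<in> topspace Z" for z
  proof -
    obtain N C where NC: "openin Z N" "compactin Z C" "z \<in> N" "N \<subseteq> C"
      using Z.lc[unfolded locally_compact_space_def, rule_format, OF z] by auto
    obtain L where L: "compactin (arr_top G) L"
      "\<And>x z. z \<in> C \<Longrightarrow> x \<in> arrows G \<Longrightarrow> rng G x = \<rho> z \<Longrightarrow> lact (gpd_inv G x) z \<in> K \<Longrightarrow> x \<in> L"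
      using orbit_return_compact[OF K(1) NC(2)] by blast
    have "g (lact (gpd_inv G x) z') = 0"
      if "z' \<in> N" "x \<in> arrows G" "\<rho> z' = rng G x" "x \<notin> L" for z' x
      using that L(2)[of z' x] NC openin_subset[OF NC(1)]
      by (intro K(2) lact_closed) (auto simp: G.inv_closed G.src_inv)
    then show ?thesis using NC L(1) by blast
  qed
  show "continuous_map Z euclideanreal (avg g)"
    using G.fs.continuous_fint(1)[OF cont_\<rho> F supp] by (simp add: avg_def[abs_def])
  show "G.fs.fibre_Cc (\<rho> z) (\<lambda>x. g (lact (gpd_inv G x) z))" if "z \<in> topspace Z" for z
    using G.fs.continuous_fint(2)[OF cont_\<rho> F supp that] .
qed

text \<open>The substitution of x y for y is governed by (x y)^-1 (x z) = y^-1 z.\<close>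

lemma avg_invariant:
  assumes g: "g \<in> Cc_real Z" and z: "z \<in> topspace Z" and x: "x \<in> arrows G" "src G x = \<rho> z"
  shows "avg g (lact x z) = avg g z"
proof -
  have xz: "lact x z \<in> topspace Z" "\<rho> (lact x z) = rng G x" using z x by auto
  have "avg g z = G.fs.fint (src G x) (\<lambda>y. g (lact (gpd_inv G (mul G x y)) (lact x z)))"
    unfolding avg_def x(2)
  proof (rule G.fs.fint_cong)
    fix y assume "y \<in> G.fs.fibre (\<rho> z)"
    then have y: "y \<in> arrows G" "rng G y = \<rho> z" by (auto simp: G.fibre_eq)
    let ?m = "mul G x y"
    have m: "?m \<in> arrows G" "rng G ?m = rng G x" "src G ?m = src G y"
      using x y by (simp_all add: G.mul_closed G.rng_mul G.src_mul)
    have im: "gpd_inv G ?m \<in> arrows G" "rng G (gpd_inv G ?m) = src G y" "src G (gpd_inv G ?m) = rng G x"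
      using m by (simp_all add: G.inv_closed G.rng_inv G.src_inv)
    have iy: "gpd_inv G y \<in> arrows G" "rng G (gpd_inv G y) = src G y" "src G (gpd_inv G y) = \<rho> z"
      using y by (simp_all add: G.inv_closed G.rng_inv G.src_inv)
    have "mul G (gpd_inv G ?m) x = mul G (mul G (mul G (gpd_inv G ?m) x) y) (gpd_inv G y)"
      using G.mul_inv_cancel_right[of "mul G (gpd_inv G ?m) x" "gpd_inv G y"] im x y iy
      by (simp add: G.mul_closed G.src_mul G.inv_inv)
    also have "mul G (mul G (gpd_inv G ?m) x) y = src G y"
      using G.mul_assoc[of "gpd_inv G ?m" x y] G.inv_mul[OF m(1)] im x y m by simp
    also have "mul G (src G y) (gpd_inv G y) = gpd_inv G y"
      using G.rng_left_unit[OF iy(1)] iy(2) by simp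
    finally have "lact (gpd_inv G ?m) (lact x z) = lact (gpd_inv G y) z"
      using lact_lact[OF im(1) x(1) z] im x by simp
    then show "g (lact (gpd_inv G y) z) = g (lact (gpd_inv G ?m) (lact x z))" by simp
  qed
  also have "\<dots> = G.fs.fint (rng G x) (\<lambda>y. g (lact (gpd_inv G y) (lact x z)))"
    using avg_continuous(2)[OF g xz(1)] unfolding xz(2) by (rule G.haar_invariant[OF x(1)])
  also have "\<dots> = avg g (lact x z)" by (simp add: avg_def xz(2))
  finally show ?thesis by simp
qed

lemma avg_add:
  assumes "f \<in> Cc_real Z" "g \<in> Cc_real Z" "z \<in> topspace Z"
  shows "avg (\<lambda>x. f x + g x) z = avg f z + avg g z"
  unfolding avg_def using assms by (intro G.fs.fint_add avg_continuous(2)) auto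

lemma avg_scale: "avg (\<lambda>x. c * g x) z = c * avg g z"
  unfolding avg_def by (rule G.fs.fint_scale)

lemma avg_arg:
  assumes "z \<in> topspace Z" "x \<in> G.fs.fibre (\<rho> z)"
  shows "lact (gpd_inv G x) z \<in> topspace Z" "\<sigma> (lact (gpd_inv G x) z) = \<sigma> z"
    "gpd_inv G x \<in> arrows G" "src G (gpd_inv G x) = \<rho> z"
  using assms by (auto simp: G.fibre_eq G.inv_closed G.src_inv)

lemma avg_nonneg:
  assumes "z \<in> topspace Z" "\<And>w. w \<in> topspace Z \<Longrightarrow> \<sigma> w = \<sigma> z \<Longrightarrow> 0 \<le> g w"
  shows "0 \<le> avg g z"
  unfolding avg_def using assms avg_arg by (intro G.fs.fint_nonneg) auto

lemma avg_cong:
  assumes "z \<in> topspace Z" "\<And>w. w \<in> topspace Z \<Longrightarrow> \<sigma> w = \<sigma> z \<Longrightarrow> f w = g w"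
  shows "avg f z = avg g z"
  unfolding avg_def using assms avg_arg by (intro G.fs.fint_cong) auto

text \<open>The unit \<rho> z contributes the value g z, and the support condition gives each of its
  neighbourhoods positive measure.\<close>

lemma avg_pos:
  assumes g: "g \<in> Cc_real Z" "\<And>w. w \<in> topspace Z \<Longrightarrow> 0 \<le> g w" and z: "z \<in> topspace Z" "0 < g z"
  shows "0 < avg g z"
proof -
  let ?F = "\<lambda>x. g (lact (gpd_inv G x) z)"
  obtain f where f: "f \<in> Cc_real (arr_top G)" "\<And>x. x \<in> G.fs.fibre (\<rho> z) \<Longrightarrow> f x = ?F x"
    using avg_continuous(2)[OF g(1) z(1)] by (rule G.fs.fibre_Cc_extend) blast
  let ?U = "{x \<in> arrows G. f x \<in> {0<..}}"
  have U: "openin (arr_top G) ?U"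
    using Cc_real_continuous[OF f(1)] by (rule openin_continuous_map_preimage) auto
  have "f (\<rho> z) = g z"
    using f(2)[of "\<rho> z"] z(1) G.inv_unit[of "\<rho> z"] by (simp add: G.fibre_eq)
  then have "emeasure (\<nu> (\<rho> z)) ?U > 0"
    using z by (intro G.haar_open_pos[OF U, of "\<rho> z"]) auto
  moreover have "?U \<in> sets (\<nu> (\<rho> z))"
    using lfb_open[OF G.fs.\<beta>_lfb U] z(1) by simp
  ultimately show ?thesis
    unfolding avg_def using avg_continuous(2)[OF g(1) z(1)] avg_arg[OF z(1)] g(2) f(2) z(1)
    by (intro G.fs.fint_pos[of "\<rho> z" ?F ?U]) auto
qed

end

section \<open>The Haar system of an equivalent groupoid\<close>

locale haar_transfer = haar_equivalence G \<nu> H Z \<rho> lact \<sigma> ract + b: fibre_system Z "unit_space G" \<rho> \<beta>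
  for G :: "'g groupoid" and \<nu> :: "'g \<Rightarrow> 'g measure" and H :: "'h groupoid" and Z :: "'z topology"
    and \<rho> :: "'z \<Rightarrow> 'g" and lact :: "'g \<Rightarrow> 'z \<Rightarrow> 'z"
    and \<sigma> :: "'z \<Rightarrow> 'h" and ract :: "'z \<Rightarrow> 'h \<Rightarrow> 'z" and \<beta> :: "'g \<Rightarrow> 'z measure" +
  fixes K :: "'z set"
  assumes K: "compactin Z K" and \<beta>_K: "u \<in> units G \<Longrightarrow> AE w in \<beta> u. w \<in> K"
begin

definition pair :: "('h \<Rightarrow> real) \<Rightarrow> 'z \<Rightarrow> real" where
  "pair f x = b.fint (\<rho> x) (\<lambda>w. f (transporter x w))"

definition J :: "('h \<Rightarrow> real) \<Rightarrow> 'z \<Rightarrow> real" where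
  "J f = avg (pair f)"

lemma fibre_transporter:
  assumes "x \<in> topspace Z" "w \<in> b.fibre (\<rho> x)"
  shows "w \<in> topspace Z" "\<rho> x = \<rho> w" "transporter x w \<in> arrows H" "rng H (transporter x w) = \<sigma> x" "ract x (transporter x w) = w"
proof -
  show w: "w \<in> topspace Z" "\<rho> x = \<rho> w" using assms(2) by (auto simp: b.fibre_def)
  show "transporter x w \<in> arrows H" "rng H (transporter x w) = \<sigma> x" "ract x (transporter x w) = w"
    using transporter[OF assms(1) w] by auto
qed

text \<open>The carrier of \<beta> makes \<open>pair f\<close> compactly supported: if w lies in K
  and t = \<open>transporter x w\<close> in the carrier C of f, then x = w t^-1 lies in the compact
  product of K with the inverses of C. Hence \<open>avg\<close> can be applied to it.\<close>

lemma
  assumes f: "f \<in> Cc_real (arr_top H)"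
  shows pair_Cc: "pair f \<in> Cc_real Z"
    and pair_fibre_Cc: "\<And>x. x \<in> topspace Z \<Longrightarrow> b.fibre_Cc (\<rho> x) (\<lambda>w. f (transporter x w))"
proof -
  obtain C where C: "compactin (arr_top H) C" "\<And>h. h \<in> arrows H \<Longrightarrow> h \<notin> C \<Longrightarrow> f h = 0"
    using f by (rule Cc_realE) blast
  have F: "continuous_map (subtopology (prod_topology Z Z) {(x, w). \<rho> x = \<rho> w}) euclideanreal (\<lambda>(x, w). f (transporter x w))"
    using continuous_map_compose[OF continuous_transporter Cc_real_continuous[OF f]]
    by (simp add: o_def case_prod_unfold)
  have supp: "\<exists>N L. openin Z N \<and> x \<in> N \<and> compactin Z L \<and>
      (\<forall>x' \<in> N. \<forall>w \<in> topspace Z. \<rho> x' = \<rho> w \<longrightarrow> w \<notin> L \<longrightarrow> f (transporter x' w) = 0)"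
    if x: "x \<in> topspace Z" for x
  proof -
    obtain N D where ND: "openin Z N" "compactin Z D" "x \<in> N" "N \<subseteq> D"
      using Z.lc[unfolded locally_compact_space_def, rule_format, OF x] by auto
    \<comment> \<open>Since w = x t, the points w that matter for x in D lie in the product of D
      with C.\<close>
    let ?L = "{ract p h |p h. p \<in> D \<and> h \<in> C \<and> \<sigma> p = rng H h}"
    have "f (transporter x' w) = 0" if "x' \<in> N" "w \<in> topspace Z" "\<rho> x' = \<rho> w" "w \<notin> ?L" for x' w
    proof (rule C(2))
      have x': "x' \<in> topspace Z" "x' \<in> D" using that(1) ND openin_subset by blast+
      note t = transporter[OF x'(1) that(2,3)]
      show "transporter x' w \<in> arrows H" by (rule t(1))
      show "transporter x' w \<notin> C"
      proof
        assume "transporter x' w \<in> C"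
        then have "\<exists>p h. w = ract p h \<and> p \<in> D \<and> h \<in> C \<and> \<sigma> p = rng H h"
          using x'(2) t(2,3) by (intro exI[of _ x'] exI[of _ "transporter x' w"]) simp
        with that(4) show False by simp
      qed
    qed
    then show ?thesis using ND compact_ract[OF ND(2) C(1)] by blast
  qed
  show "b.fibre_Cc (\<rho> x) (\<lambda>w. f (transporter x w))" if "x \<in> topspace Z" for x
    using b.continuous_fint(2)[OF cont_\<rho> F supp that] .
  have cont: "continuous_map Z euclideanreal (pair f)"
    using b.continuous_fint(1)[OF cont_\<rho> F supp] by (simp add: pair_def[abs_def])
  have invC: "compactin (arr_top H) (gpd_inv H ` C)"
    by (rule image_compactin[OF C(1) H.continuous_inv])
  let ?L = "{ract p h |p h. p \<in> K \<and> h \<in> gpd_inv H ` C \<and> \<sigma> p = rng H h}"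
  have zero: "pair f x = 0" if x: "x \<in> topspace Z" "x \<notin> ?L" for x
  proof -
    have "f (transporter x w) = 0" if w: "w \<in> b.fibre (\<rho> x)" "w \<in> K" for w
    proof (rule C(2))
      note t = fibre_transporter[OF x(1) w(1)]
      show "transporter x w \<in> arrows H" by (rule t(3))
      show "transporter x w \<notin> C"
      proof
        assume "transporter x w \<in> C"
        moreover have "ract w (gpd_inv H (transporter x w)) = x"
          using ract_ract[OF x(1) t(3) H.inv_closed[OF t(3)]] t x(1) H.rng_inv[OF t(3)] H.mul_inv[OF t(3)]
          by simp
        moreover have "\<sigma> w = rng H (gpd_inv H (transporter x w))"
          using H.rng_inv[OF t(3)] \<sigma>_ract[OF x(1) t(3)] t by simp
        ultimately have "\<exists>p h. x = ract p h \<and> p \<in> K \<and> h \<in> gpd_inv H ` C \<and> \<sigma> p = rng H h"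
          using w(2) by (intro exI[of _ w] exI[of _ "gpd_inv H (transporter x w)"]) simp
        with x(2) show False by simp
      qed
    qed
    moreover have "AE w in \<beta> (\<rho> x). w \<in> K" by (rule \<beta>_K) (simp add: x)
    ultimately have "AE w in \<beta> (\<rho> x). indicator (b.fibre (\<rho> x)) w *\<^sub>R f (transporter x w) = 0"
      by (simp add: indicator_def eventually_mono)
    then show ?thesis
      unfolding pair_def b.fint_def set_lebesgue_integral_def by (rule integral_eq_zero_AE)
  qed
  show "pair f \<in> Cc_real Z"
    by (rule Cc_realI[OF cont compact_ract[OF K invC] zero])
qed

lemma pair_cong:
  assumes "x \<in> topspace Z" "\<And>h. h \<in> arrows H \<Longrightarrow> rng H h = \<sigma> x \<Longrightarrow> f h = g h"
  shows "pair f x = pair g x"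
  unfolding pair_def by (intro b.fint_cong assms(2) fibre_transporter(3,4)[OF assms(1)])

lemma pair_nonneg:
  assumes "x \<in> topspace Z" "\<And>h. h \<in> arrows H \<Longrightarrow> rng H h = \<sigma> x \<Longrightarrow> 0 \<le> f h"
  shows "0 \<le> pair f x"
  unfolding pair_def by (intro b.fint_nonneg assms(2) fibre_transporter(3,4)[OF assms(1)])

lemma J_continuous: "f \<in> Cc_real (arr_top H) \<Longrightarrow> continuous_map Z euclideanreal (J f)"
  unfolding J_def by (intro avg_continuous(1) pair_Cc)

lemma J_lact:
  "f \<in> Cc_real (arr_top H) \<Longrightarrow> z \<in> topspace Z \<Longrightarrow> x \<in> arrows G \<Longrightarrow> src G x = \<rho> z \<Longrightarrow> J f (lact x z) = J f z"
  unfolding J_def by (intro avg_invariant pair_Cc)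

lemma J_add:
  assumes "f \<in> Cc_real (arr_top H)" "g \<in> Cc_real (arr_top H)" "z \<in> topspace Z"
  shows "J (\<lambda>x. f x + g x) z = J f z + J g z"
proof -
  have "J (\<lambda>x. f x + g x) z = avg (\<lambda>x. pair f x + pair g x) z"
    unfolding J_def
  proof (rule avg_cong[OF assms(3)])
    fix w assume w: "w \<in> topspace Z"
    show "pair (\<lambda>x. f x + g x) w = pair f w + pair g w"
      unfolding pair_def using w assms by (intro b.fint_add pair_fibre_Cc) auto
  qed
  then show ?thesis
    unfolding J_def using assms by (simp add: avg_add pair_Cc)
qed

lemma J_scale: "J (\<lambda>x. c * f x) z = c * J f z"
  unfolding J_def pair_def b.fint_scale avg_scale ..

lemma J_cong:
  assumes z: "z \<in> topspace Z" and eq: "\<And>h. h \<in> arrows H \<Longrightarrow> rng H h = \<sigma> z \<Longrightarrow> f h = g h"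
  shows "J f z = J g z"
  unfolding J_def by (intro avg_cong[OF z] pair_cong eq) auto

lemma J_nonneg:
  assumes z: "z \<in> topspace Z" and "\<And>h. h \<in> arrows H \<Longrightarrow> rng H h = \<sigma> z \<Longrightarrow> 0 \<le> f h"
  shows "0 \<le> J f z"
  unfolding J_def using assms by (intro avg_nonneg[OF z] pair_nonneg) auto

lemma J_zero: "J (\<lambda>h. 0) z = 0"
  using J_scale[of 0 "\<lambda>h. 0" z] by simp

text \<open>h commutes with \<open>G\<close> and preserves \<rho>, so the outer integral runs over
  the same arrows; in the inner one \<open>transporter_ract\<close> trades the shift of the base
  point for a left translation of f. The condition on \<phi> concerns the range fibre where the
  translate is meaningful.\<close>

lemma J_translate:
  assumes z: "z \<in> topspace Z" and h: "h \<in> arrows H" "rng H h = \<sigma> z"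
    and \<phi>: "\<And>k. k \<in> arrows H \<Longrightarrow> rng H k = src H h \<Longrightarrow> \<phi> k = f (mul H h k)"
  shows "J \<phi> (ract z h) = J f z"
proof -
  have zh: "ract z h \<in> topspace Z" "\<rho> (ract z h) = \<rho> z" "\<sigma> (ract z h) = src H h"
    using z h by auto
  have *: "pair \<phi> (lact (gpd_inv G x) (ract z h)) = pair f (lact (gpd_inv G x) z)"
    if "x \<in> G.fs.fibre (\<rho> z)" for x
  proof -
    note x = avg_arg[OF z that]
    let ?v = "lact (gpd_inv G x) z"
    have v: "lact (gpd_inv G x) (ract z h) = ract ?v h"
      using ract_lact[OF x(3) z h(1)] x h by simp
    have vh: "ract ?v h \<in> topspace Z" "\<rho> (ract ?v h) = \<rho> ?v" "\<sigma> (ract ?v h) = src H h"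
      using x h by auto
    have "pair \<phi> (ract ?v h) = b.fint (\<rho> ?v) (\<lambda>w. f (transporter ?v w))"
      unfolding pair_def vh(2)
    proof (rule b.fint_cong)
      fix w assume w: "w \<in> b.fibre (\<rho> ?v)"
      note t = fibre_transporter[OF vh(1), unfolded vh(2,3), OF w]
      have "mul H h (transporter (ract ?v h) w) = transporter ?v w"
        using transporter_ract[OF x(1) t(1) _ h(1)] fibre_transporter(2)[OF x(1) w] h x(2) by simp
      then show "\<phi> (transporter (ract ?v h) w) = f (transporter ?v w)" using \<phi>[OF t(3,4)] by simp
    qed
    then show ?thesis unfolding v pair_def .
  qed
  show ?thesis
    unfolding J_def avg_def zh(2) using * by (rule G.fs.fint_cong)
qed

text \<open>\<open>avg_pos\<close> asks for positivity of \<open>pair f\<close> at z alone, and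
  there the integrand is positive on the part of K in the fibre, which has positive mass.\<close>

lemma J_pos:
  assumes f: "f \<in> Cc_real (arr_top H)" "\<And>h. h \<in> arrows H \<Longrightarrow> 0 \<le> f h" and z: "z \<in> topspace Z"
    and pos: "\<And>w. w \<in> K \<Longrightarrow> w \<in> topspace Z \<Longrightarrow> \<rho> w = \<rho> z \<Longrightarrow> 0 < f (transporter z w)"
    and mass: "emeasure (\<beta> (\<rho> z)) K > 0"
  shows "0 < J f z"
  unfolding J_def
proof (rule avg_pos[OF pair_Cc[OF f(1)] _ z])
  show "0 \<le> pair f w" if "w \<in> topspace Z" for w
    using that f(2) by (intro pair_nonneg) auto
  have u: "\<rho> z \<in> topspace (unit_space G)" using z by simp
  show "0 < pair f z"
    unfolding pair_def
  proof (rule b.fint_pos[OF u pair_fibre_Cc[OF f(1) z] _ _ mass])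
    show "0 \<le> f (transporter z w)" if "w \<in> b.fibre (\<rho> z)" for w
      by (rule f(2)[OF fibre_transporter(3)[OF z that]])
    show "K \<in> sets (\<beta> (\<rho> z))"
      by (rule Z.lfb_compact[OF b.\<beta>_lfb[OF u] K])
    show "0 < f (transporter z w)" if "w \<in> K" "w \<in> b.fibre (\<rho> z)" for w
      using that(2) by (intro pos[OF that(1)]) (simp_all add: b.fibre_def)
  qed
qed

end

section \<open>Weighted sums of countably many functionals\<close>

locale haar_transfer_sequence = haar_equivalence G \<nu> H Z \<rho> lact \<sigma> ract
  for G :: "'g groupoid" and \<nu> :: "'g \<Rightarrow> 'g measure" and H :: "'h groupoid" and Z :: "'z topology"
    and \<rho> :: "'z \<Rightarrow> 'g" and lact :: "'g \<Rightarrow> 'z \<Rightarrow> 'z"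
    and \<sigma> :: "'z \<Rightarrow> 'h" and ract :: "'z \<Rightarrow> 'h \<Rightarrow> 'z" +
  fixes \<beta> :: "nat \<Rightarrow> 'g \<Rightarrow> 'z measure" and K :: "nat \<Rightarrow> 'z set"
  assumes fibre_systems: "fibre_system Z (unit_space G) \<rho> (\<beta> n)"
    and K: "compactin Z (K n)" and \<beta>_K: "u \<in> units G \<Longrightarrow> AE w in \<beta> n u. w \<in> K n"
    and small: "openin Z U \<Longrightarrow> w \<in> U \<Longrightarrow> \<exists>n. K n \<subseteq> U \<and> emeasure (\<beta> n (\<rho> w)) (K n) > 0"
begin

sublocale tr: haar_transfer G \<nu> H Z \<rho> lact \<sigma> ract "\<beta> n" "K n" for n
proof -
  interpret fibre_system Z "unit_space G" \<rho> "\<beta> n" by (rule fibre_systems)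
  show "haar_transfer G \<nu> H Z \<rho> lact \<sigma> ract (\<beta> n) (K n)"
    by unfold_locales (use K \<beta>_K in auto)
qed

end

text \<open>The Weierstrass test with domination from N on, because the weights control a given
  function only for large indices.\<close>

lemma continuous_map_suminf:
  fixes F :: "nat \<Rightarrow> 'a \<Rightarrow> real"
  assumes F: "\<And>n. continuous_map P euclideanreal (F n)" and M: "summable M"
    and bd: "\<And>n p. n \<ge> N \<Longrightarrow> p \<in> topspace P \<Longrightarrow> \<bar>F n p\<bar> \<le> M n"
  shows "continuous_map P euclideanreal (\<lambda>p. \<Sum>n. F n p)"
proof -
  have ul: "uniform_limit (topspace P) (\<lambda>n p. \<Sum>i<n. F i p) (\<lambda>p. \<Sum>i. F i p) sequentially"
    using M bd by (intro Weierstrass_m_test_ev) (auto simp: eventually_sequentially)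
  show ?thesis
    unfolding continuous_map_real_iff
  proof (intro ballI allI impI)
    fix p and e :: real assume p: "p \<in> topspace P" and e: "0 < e"
    then obtain n where n: "\<And>p. p \<in> topspace P \<Longrightarrow> \<bar>(\<Sum>i<n. F i p) - (\<Sum>i. F i p)\<bar> < e / 3"
      using uniform_limitD[OF ul, of "e / 3"] by (auto simp: eventually_sequentially dist_real_def)
    have "continuous_map P euclideanreal (\<lambda>p. \<Sum>i<n. F i p)"
      using F by (intro continuous_map_sum) auto
    then obtain N where N: "openin P N" "p \<in> N" "\<And>p'. p' \<in> N \<Longrightarrow> \<bar>(\<Sum>i<n. F i p') - (\<Sum>i<n. F i p)\<bar> < e / 3"
      using p e unfolding continuous_map_real_iff by (metis divide_pos_pos zero_less_numeral)
    have "\<bar>(\<Sum>i. F i p') - (\<Sum>i. F i p)\<bar> < e" if "p' \<in> N" for p'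
    proof -
      have "p' \<in> topspace P" using that N(1) openin_subset by blast
      from n[OF this] n[OF p] N(3)[OF that] show ?thesis by linarith
    qed
    with N show "\<exists>N. openin P N \<and> p \<in> N \<and> (\<forall>p'\<in>N. \<bar>(\<Sum>i. F i p') - (\<Sum>i. F i p)\<bar> < e)" by blast
  qed
qed

context haar_transfer_sequence
begin

text \<open>An arbitrary choice without continuity; by \<open>J_section\<close> the values of
  \<open>J\<close> do not depend on it.\<close>

definition section_map :: "'h \<Rightarrow> 'z" where
  "section_map v = (SOME z. z \<in> topspace Z \<and> \<sigma> z = v)"

lemma section_map:
  assumes "v \<in> units H" shows "section_map v \<in> topspace Z" "\<sigma> (section_map v) = v"
proof -
  have "\<exists>z. z \<in> topspace Z \<and> \<sigma> z = v" using assms \<sigma>_surj by force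
  then have "section_map v \<in> topspace Z \<and> \<sigma> (section_map v) = v"
    unfolding section_map_def by (rule someI_ex)
  then show "section_map v \<in> topspace Z" "\<sigma> (section_map v) = v" by auto
qed

lemma J_section:
  assumes f: "f \<in> Cc_real (arr_top H)" and z: "z \<in> topspace Z"
  shows "tr.J n f (section_map (\<sigma> z)) = tr.J n f z"
proof -
  note s = section_map[OF \<sigma>_units[OF z]]
  obtain x where x: "x \<in> arrows G" "src G x = \<rho> z" "lact x z = section_map (\<sigma> z)"
    using left_transitive[OF z s(1)] s(2) by metis
  then show ?thesis using tr.J_lact[OF f z x(1,2), of n] by simp
qed

text \<open>\<sigma> is open, continuous and onto, hence a quotient map, and composing with \<sigma>
  gives back \<open>J f\<close> on \<open>Z\<close>.\<close>

lemma J_section_continuous: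
  assumes f: "f \<in> Cc_real (arr_top H)"
  shows "continuous_map (unit_space H) euclideanreal (\<lambda>v. tr.J n f (section_map v))"
proof -
  have "quotient_map Z (unit_space H) \<sigma>"
    using cont_\<sigma> open_\<sigma> \<sigma>_surj by (intro continuous_open_imp_quotient_map) simp_all
  moreover have "continuous_map Z euclideanreal ((\<lambda>v. tr.J n f (section_map v)) \<circ> \<sigma>)"
    by (rule continuous_map_eq[OF tr.J_continuous[OF f, of n]]) (simp add: J_section[OF f])
  ultimately show ?thesis by (rule continuous_compose_quotient_map)
qed

text \<open>A diagonal choice: every f is dominated by a multiple of some \<phi> j, and the n-th
  weight is small enough for all \<phi> j with j \<le> n, hence for f once n \<ge> j.\<close>

lemma weights_exist:
  "\<exists>c :: nat \<Rightarrow> real. (\<forall>n. 0 < c n) \<and> (\<forall>f \<in> Cc_real (arr_top H). \<exists>M N. summable M \<and>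
     (\<forall>n\<ge>N. \<forall>v \<in> units H. \<bar>c n * tr.J n f (section_map v)\<bar> \<le> M n))"
proof -
  obtain C :: "nat \<Rightarrow> 'h set" where C: "\<And>n. compactin (arr_top H) (C n)" "\<And>m n. m \<le> n \<Longrightarrow> C m \<subseteq> C n"
    "\<And>K. compactin (arr_top H) K \<Longrightarrow> \<exists>n. K \<subseteq> C n"
    using H.compact_exhaustion[OF H.sc] by blast
  have "\<exists>\<phi>. \<phi> \<in> Cc_real (arr_top H) \<and> (\<forall>h \<in> arrows H. 0 \<le> \<phi> h) \<and> (\<forall>h \<in> C j. \<phi> h = 1)" for j
    using H.urysohn_Cc[OF C(1)[of j] openin_topspace compactin_subset_topspace[OF C(1)]] by metis
  then obtain \<phi> where \<phi>: "\<And>j. \<phi> j \<in> Cc_real (arr_top H)" "\<And>j h. h \<in> arrows H \<Longrightarrow> 0 \<le> \<phi> j h"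
    "\<And>j h. h \<in> C j \<Longrightarrow> \<phi> j h = 1" by metis
  \<comment> \<open>A bound over all units exists because the function is continuous and vanishes at
    units over which the carrier of \<phi> j has no arrow.\<close>
  have "\<exists>B\<ge>0. \<forall>v \<in> units H. \<bar>tr.J n (\<phi> j) (section_map v)\<bar> \<le> B" for n j
  proof -
    obtain L where L: "compactin (arr_top H) L" "\<And>h. h \<in> arrows H \<Longrightarrow> h \<notin> L \<Longrightarrow> \<phi> j h = 0"
      using \<phi>(1)[of j] by (rule Cc_realE) blast
    have "(\<lambda>v. tr.J n (\<phi> j) (section_map v)) \<in> Cc_real (unit_space H)"
    proof (rule Cc_realI[OF J_section_continuous[OF \<phi>(1)]])
      show "compactin (unit_space H) (rng H ` L)"
        by (rule image_compactin[OF L(1) H.continuous_rng_unit])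
      fix v assume v: "v \<in> topspace (unit_space H)" "v \<notin> rng H ` L"
      note s = section_map[of v]
      have "tr.J n (\<phi> j) (section_map v) = tr.J n (\<lambda>h. 0) (section_map v)"
        using v s by (intro tr.J_cong L(2)) auto
      then show "tr.J n (\<phi> j) (section_map v) = 0" by (simp add: tr.J_zero)
    qed
    from Cc_real_bounded[OF this] show ?thesis by (metis H.topspace_unit_space)
  qed
  then obtain B where B: "\<And>n j. 0 \<le> B n j" "\<And>n j v. v \<in> units H \<Longrightarrow> \<bar>tr.J n (\<phi> j) (section_map v)\<bar> \<le> B n j"
    by metis
  \<comment> \<open>The denominator exceeds each \<open>B n j\<close> with j \<le> n, and the 1
    keeps it positive.\<close>
  define c where "c n = (1 / 2) ^ n / (1 + (\<Sum>j\<le>n. B n j))" for n :: nat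
  have den: "0 < 1 + (\<Sum>j\<le>n. B n j)" for n
    using B(1) by (intro add_pos_nonneg sum_nonneg) auto
  have cB: "c n * B n j \<le> (1 / 2) ^ n" "0 < c n" if "j \<le> n" for n j
  proof -
    show "0 < c n" using den[of n] by (simp add: c_def)
    have "B n j \<le> (\<Sum>j\<le>n. B n j)" using B(1) that by (intro member_le_sum) auto
    then have "B n j \<le> 1 + (\<Sum>j\<le>n. B n j)" by simp
    then have "(1 / 2) ^ n * B n j \<le> (1 / 2) ^ n * (1 + (\<Sum>j\<le>n. B n j))"
      by (intro mult_left_mono) auto
    then show "c n * B n j \<le> (1 / 2) ^ n" using den[of n] by (simp add: c_def divide_le_eq)
  qed
  show ?thesis
  proof (rule exI[of _ c], intro conjI allI ballI)
    show "0 < c n" for n using cB(2)[of n n] by simp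
    fix f assume f: "f \<in> Cc_real (arr_top H)"
    obtain L where L: "compactin (arr_top H) L" "\<And>h. h \<in> arrows H \<Longrightarrow> h \<notin> L \<Longrightarrow> f h = 0"
      using f by (rule Cc_realE) blast
    obtain b where b: "b \<ge> 0" "\<And>h. h \<in> arrows H \<Longrightarrow> \<bar>f h\<bar> \<le> b"
      using f by (rule Cc_real_bounded) blast
    obtain j where j: "L \<subseteq> C j" using C(3)[OF L(1)] by blast
    have fb: "\<bar>f h\<bar> \<le> b * \<phi> j h" if "h \<in> arrows H" for h
      using that b \<phi>(2)[OF that, of j] \<phi>(3)[of h j] L(2)[OF that] j by (cases "h \<in> L") auto
    have "\<bar>c n * tr.J n f (section_map v)\<bar> \<le> b * (1 / 2) ^ n" if n: "n \<ge> j" and v: "v \<in> units H" for n v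
    proof -
      note s = section_map[OF v]
      have bf: "(\<lambda>h. b * \<phi> j h) \<in> Cc_real (arr_top H)" by (rule Cc_real_scale[OF \<phi>(1)])
      have nf: "(\<lambda>h. - 1 * f h) \<in> Cc_real (arr_top H)" by (rule Cc_real_scale[OF f])
      have nn: "0 \<le> b * \<phi> j h + f h" "0 \<le> b * \<phi> j h + - 1 * f h" if "h \<in> arrows H" for h
        using fb[OF that] by linarith+
      have "0 \<le> tr.J n (\<lambda>h. b * \<phi> j h + f h) (section_map v)"
        by (rule tr.J_nonneg[OF s(1)]) (rule nn)
      moreover have "0 \<le> tr.J n (\<lambda>h. b * \<phi> j h + - 1 * f h) (section_map v)"
        by (rule tr.J_nonneg[OF s(1)]) (rule nn)
      ultimately have "\<bar>tr.J n f (section_map v)\<bar> \<le> b * tr.J n (\<phi> j) (section_map v)"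
        unfolding tr.J_add[OF bf f s(1)] tr.J_add[OF bf nf s(1)] tr.J_scale by linarith
      also have "\<dots> \<le> b * B n j"
        using b(1) B(2)[OF v, of n j] by (intro mult_left_mono) auto
      finally have "c n * \<bar>tr.J n f (section_map v)\<bar> \<le> c n * (b * B n j)"
        using cB(2)[OF n] by (intro mult_left_mono) auto
      also have "\<dots> = b * (c n * B n j)" by simp
      also have "\<dots> \<le> b * (1 / 2) ^ n" using b(1) cB(1)[OF n] by (intro mult_left_mono)
      finally show ?thesis using cB(2)[OF n] by (simp add: abs_mult)
    qed
    then show "\<exists>M N. summable M \<and> (\<forall>n\<ge>N. \<forall>v\<in>units H. \<bar>c n * tr.J n f (section_map v)\<bar> \<le> M n)"
      by (intro exI[of _ "\<lambda>n. b * (1 / 2) ^ n"] exI[of _ j]) (auto intro: summable_mult)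
  qed
qed

end

locale haar_transfer_series = haar_transfer_sequence G \<nu> H Z \<rho> lact \<sigma> ract \<beta> K
  for G :: "'g groupoid" and \<nu> :: "'g \<Rightarrow> 'g measure" and H :: "'h groupoid" and Z :: "'z topology"
    and \<rho> :: "'z \<Rightarrow> 'g" and lact :: "'g \<Rightarrow> 'z \<Rightarrow> 'z"
    and \<sigma> :: "'z \<Rightarrow> 'h" and ract :: "'z \<Rightarrow> 'h \<Rightarrow> 'z"
    and \<beta> :: "nat \<Rightarrow> 'g \<Rightarrow> 'z measure" and K :: "nat \<Rightarrow> 'z set" +
  fixes c :: "nat \<Rightarrow> real"
  assumes c_pos: "0 < c n"
    and c_bound: "f \<in> Cc_real (arr_top H) \<Longrightarrow> \<exists>M N. summable M \<and>
     (\<forall>n\<ge>N. \<forall>v \<in> units H. \<bar>c n * tr.J n f (section_map v)\<bar> \<le> M n)"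
begin

definition total :: "'h \<Rightarrow> ('h \<Rightarrow> real) \<Rightarrow> real" where
  "total v f = (\<Sum>n. c n * tr.J n f (section_map v))"

lemma total_summable:
  assumes "f \<in> Cc_real (arr_top H)" "v \<in> units H"
  shows "summable (\<lambda>n. c n * tr.J n f (section_map v))"
proof -
  obtain M N where M: "summable M" "\<forall>n\<ge>N. \<forall>v \<in> units H. \<bar>c n * tr.J n f (section_map v)\<bar> \<le> M n"
    using c_bound[OF assms(1)] by auto
  show ?thesis
    by (rule summable_comparison_test'[OF M(1), of N]) (use M(2) assms(2) in simp)
qed

lemma total_continuous:
  assumes f: "f \<in> Cc_real (arr_top H)"
  shows "continuous_map (unit_space H) euclideanreal (\<lambda>v. total v f)"
proof -
  obtain M N where "summable M" "\<forall>n\<ge>N. \<forall>v \<in> units H. \<bar>c n * tr.J n f (section_map v)\<bar> \<le> M n"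
    using c_bound[OF f] by auto
  then show ?thesis
    unfolding total_def
    by (intro continuous_map_suminf[where M = M and N = N])
      (auto intro!: continuous_intros J_section_continuous[OF f])
qed

lemma total_functional:
  assumes v: "v \<in> units H" shows "positive_functional (arr_top H) (total v)"
proof unfold_locales
  note s = section_map[OF v]
  fix f assume f: "f \<in> Cc_real (arr_top H)"
  show "total v (\<lambda>x. a * f x) = a * total v f" for a
    unfolding total_def tr.J_scale using suminf_mult[OF total_summable[OF f v], of a]
    by (simp add: mult.left_commute)
  show "total v (\<lambda>x. f x + g x) = total v f + total v g" if g: "g \<in> Cc_real (arr_top H)" for g
    unfolding total_def tr.J_add[OF f g s(1)] distrib_left
    by (rule suminf_add[OF total_summable[OF f v] total_summable[OF g v], symmetric])
  show "0 \<le> total v f" if "\<And>x. x \<in> arrows H \<Longrightarrow> 0 \<le> f x"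
    unfolding total_def using that c_pos
    by (intro suminf_nonneg[OF total_summable[OF f v]] mult_nonneg_nonneg tr.J_nonneg[OF s(1)])
      (auto intro: less_imp_le)
qed

lemma total_translate:
  assumes x: "x \<in> arrows H" and f: "f \<in> Cc_real (arr_top H)" and \<phi>: "\<phi> \<in> Cc_real (arr_top H)"
    and eq: "\<And>k. k \<in> arrows H \<Longrightarrow> rng H k = src H x \<Longrightarrow> \<phi> k = f (mul H x k)"
  shows "total (src H x) \<phi> = total (rng H x) f"
proof -
  note s = section_map[OF H.rng_units[OF x]]
  have zx: "ract (section_map (rng H x)) x \<in> topspace Z" "\<sigma> (ract (section_map (rng H x)) x) = src H x"
    using s x by auto
  have "tr.J n \<phi> (section_map (src H x)) = tr.J n f (section_map (rng H x))" for n
  proof -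
    have "tr.J n \<phi> (ract (section_map (rng H x)) x) = tr.J n f (section_map (rng H x))"
      by (rule tr.J_translate[OF s(1) x s(2)[symmetric]]) (rule eq)
    then show ?thesis using J_section[OF \<phi> zx(1), of n] zx(2) by simp
  qed
  then show ?thesis by (simp add: total_def)
qed

lemma total_local:
  assumes "v \<in> units H" "\<And>h. h \<in> arrows H \<Longrightarrow> rng H h = v \<Longrightarrow> f h = 0"
  shows "total v f = 0"
proof -
  note s = section_map[OF assms(1)]
  have "tr.J n f (section_map v) = 0" for n
    using tr.J_cong[OF s(1), of f "\<lambda>h. 0" n] assms(2) s(2) by (simp add: tr.J_zero)
  then show ?thesis by (simp add: total_def)
qed

text \<open>The transporter from z to z h is h, so f of the transporter stays positive near z h
  within the fibre of \<rho>. Some \<open>K n\<close> fits into that neighbourhood with positive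
  mass, and all other terms are nonnegative.\<close>

lemma total_pos:
  assumes f: "f \<in> Cc_real (arr_top H)" "\<And>h. h \<in> arrows H \<Longrightarrow> 0 \<le> f h"
    and h: "h \<in> arrows H" "0 < f h"
  shows "0 < total (rng H h) f"
proof -
  have v: "rng H h \<in> units H" using h by simp
  define z where "z = section_map (rng H h)"
  have z: "z \<in> topspace Z" "\<sigma> z = rng H h" unfolding z_def by (rule section_map[OF v])+
  have zh: "ract z h \<in> topspace Z" "\<rho> (ract z h) = \<rho> z" using z h by auto
  let ?S = "{w \<in> topspace Z. \<rho> w = \<rho> z}"
  have "continuous_map (subtopology Z ?S) (subtopology (prod_topology Z Z) {(z, w). \<rho> z = \<rho> w}) (\<lambda>w. (z, w))"
    using z(1) by (auto simp: continuous_map_in_subtopology continuous_map_pairwise o_def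
        intro: continuous_map_from_subtopology)
  from continuous_map_compose[OF continuous_map_compose[OF this continuous_transporter] Cc_real_continuous[OF f(1)]]
  have "continuous_map (subtopology Z ?S) euclideanreal (\<lambda>w. f (transporter z w))" by (simp add: o_def)
  then have "openin (subtopology Z ?S) {w \<in> topspace (subtopology Z ?S). f (transporter z w) \<in> {0<..}}"
    by (rule openin_continuous_map_preimage) auto
  then obtain U where U: "openin Z U" "{w \<in> topspace (subtopology Z ?S). f (transporter z w) \<in> {0<..}} = U \<inter> ?S"
    unfolding openin_subtopology by blast
  have "transporter z (ract z h) = h" by (rule transporter_eq[OF z(1) h(1) z(2)[symmetric] refl])
  then have "ract z h \<in> {w \<in> topspace (subtopology Z ?S). f (transporter z w) \<in> {0<..}}"
    using zh h(2) by simp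
  then have "ract z h \<in> U" using U(2) by blast
  from small[OF U(1) this] obtain n where n: "K n \<subseteq> U" "emeasure (\<beta> n (\<rho> z)) (K n) > 0"
    using zh(2) by auto
  have "0 < tr.J n f z"
  proof (rule tr.J_pos[OF f z(1) _ n(2)])
    fix w assume "w \<in> K n" "w \<in> topspace Z" "\<rho> w = \<rho> z"
    then have "w \<in> U \<inter> ?S" using n(1) by auto
    then show "0 < f (transporter z w)" unfolding U(2)[symmetric] by simp
  qed
  then have "0 < c n * tr.J n f z" using c_pos by simp
  moreover have "0 \<le> c m * tr.J m f z" for m
    using c_pos[of m] f(2) by (intro mult_nonneg_nonneg tr.J_nonneg[OF z(1)]) auto
  ultimately show ?thesis
    unfolding total_def z_def[symmetric] using total_summable[OF f(1) v, folded z_def]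
    by (intro suminf_pos2[of _ n]) auto
qed

end

section \<open>Translates, complex integrals and the Haar system of \<open>H\<close>\<close>

lemma (in lch_groupoid) translate_Cc:
  assumes x: "x \<in> arrows G" and f: "f \<in> Cc_real (arr_top G)"
  shows "continuous_map (subtopology (arr_top G) {y \<in> arrows G. rng G y = src G x}) euclideanreal (\<lambda>y. f (mul G x y))"
    and "\<exists>K. compactin (arr_top G) K \<and> (\<forall>y \<in> {y \<in> arrows G. rng G y = src G x} - K. f (mul G x y) = 0)"
proof -
  let ?S = "\<lambda>u. {y \<in> arrows G. rng G y = u}"
  have mul: "continuous_map (subtopology (arr_top G) (?S (src G z))) (arr_top G) (\<lambda>y. mul G z y)" if "z \<in> arrows G" for z
    using that by (intro continuous_map_mul continuous_map_from_subtopology) auto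
  from continuous_map_compose[OF mul[OF x] Cc_real_continuous[OF f]]
  show "continuous_map (subtopology (arr_top G) (?S (src G x))) euclideanreal (\<lambda>y. f (mul G x y))"
    by (simp add: o_def)
  obtain L where L: "compactin (arr_top G) L" "\<And>h. h \<in> arrows G \<Longrightarrow> h \<notin> L \<Longrightarrow> f h = 0"
    using f by (rule Cc_realE) blast
  note ix = inv_closed[OF x] src_inv[OF x]
  have "closedin (arr_top G) (?S (rng G x))"
    using closedin_fibre[OF haus continuous_rng] by simp
  then have "compactin (arr_top G) (?S (rng G x) \<inter> L)" by (rule closed_Int_compactin[OF _ L(1)])
  then have "compactin (subtopology (arr_top G) (?S (src G (gpd_inv G x)))) (?S (rng G x) \<inter> L)"
    by (auto simp: compactin_subtopology ix)
  from image_compactin[OF this mul[OF ix(1)]]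
  have K: "compactin (arr_top G) ((\<lambda>y. mul G (gpd_inv G x) y) ` (?S (rng G x) \<inter> L))" .
  have "f (mul G x y) = 0" if y: "y \<in> arrows G" "rng G y = src G x" "y \<notin> (\<lambda>y. mul G (gpd_inv G x) y) ` (?S (rng G x) \<inter> L)" for y
  proof (rule L(2))
    show m: "mul G x y \<in> arrows G" using x y by (simp add: mul_closed)
    show "mul G x y \<notin> L"
    proof
      assume "mul G x y \<in> L"
      then have "mul G x y \<in> ?S (rng G x) \<inter> L" using m x y by (simp add: rng_mul)
      then have "mul G (gpd_inv G x) (mul G x y) \<in> (\<lambda>y. mul G (gpd_inv G x) y) ` (?S (rng G x) \<inter> L)" by (rule imageI)
      then show False using y inv_mul_cancel[OF x y(1)] by simp
    qed
  qed
  then show "\<exists>K. compactin (arr_top G) K \<and> (\<forall>y \<in> ?S (src G x) - K. f (mul G x y) = 0)"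
    using K by blast
qed

text \<open>The representing measures come from real functionals, while \<open>haar_system\<close>
  is stated for complex functions; real and imaginary parts link the two.\<close>

lemma integral_complex_eq:
  fixes f :: "'a \<Rightarrow> complex"
  assumes "integrable M (\<lambda>x. Re (f x))" "integrable M (\<lambda>x. Im (f x))"
  shows "integral\<^sup>L M f = Complex (LINT x|M. Re (f x)) (LINT x|M. Im (f x))"
proof -
  have "integrable M (\<lambda>x. complex_of_real (Re (f x)) + \<i> * complex_of_real (Im (f x)))"
    using assms by (intro Bochner_Integration.integrable_add integrable_mult_right integrable_of_real)
  then have i: "integrable M f" by (simp add: complex_eq[symmetric])
  show ?thesis
    unfolding complex_eq_iff using integral_Re[OF i] integral_Im[OF i] by simp
qed

lemma set_integral_complex_eq:
  fixes f :: "'a \<Rightarrow> complex"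
  assumes "set_integrable M A (\<lambda>x. Re (f x))" "set_integrable M A (\<lambda>x. Im (f x))"
  shows "(LINT x:A|M. f x) = Complex (LINT x:A|M. Re (f x)) (LINT x:A|M. Im (f x))"
  using integral_complex_eq[of M "\<lambda>x. indicator A x *\<^sub>R f x"] assms
  by (simp add: set_lebesgue_integral_def set_integrable_def)

lemma continuous_map_Complex:
  assumes "continuous_map P euclideanreal a" "continuous_map P euclideanreal b"
  shows "continuous_map P euclidean (\<lambda>p. Complex (a p) (b p))"
proof -
  have r: "continuous_map P euclidean (\<lambda>p. complex_of_real (d p))" if "continuous_map P euclideanreal d" for d
    using continuous_map_compose[OF that, of euclidean complex_of_real]
    by (simp add: o_def continuous_on_of_real_id)
  have "continuous_map P euclidean (\<lambda>p. \<i> * complex_of_real (b p))"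
    using continuous_map_compose[OF r[OF assms(2)], of euclidean "\<lambda>z. \<i> * z"]
    by (simp add: o_def continuous_on_mult_left continuous_on_id)
  then have "continuous_map P euclidean (\<lambda>p. complex_of_real (a p) + \<i> * complex_of_real (b p))"
    by (intro continuous_map_add r assms(1))
  then show ?thesis by (simp add: Complex_eq)
qed

context haar_transfer_series
begin

theorem haar_system_exists: "\<exists>\<mu>. haar_system H \<mu>"
proof -
  have "\<exists>M. radon_measure (arr_top H) M \<and> (\<forall>f \<in> Cc_real (arr_top H). integral\<^sup>L M f = total v f)"
    if "v \<in> units H" for v
    by (rule positive_functional.riesz_representation[OF total_functional[OF that]])
  then obtain \<mu> where \<mu>: "\<And>v. v \<in> units H \<Longrightarrow> radon_measure (arr_top H) (\<mu> v)"
    "\<And>v f. v \<in> units H \<Longrightarrow> f \<in> Cc_real (arr_top H) \<Longrightarrow> integral\<^sup>L (\<mu> v) f = total v f"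
    by metis
  have lfb: "locally_finite_borel (arr_top H) (\<mu> v)" if "v \<in> units H" for v
    using \<mu>(1)[OF that] by (rule radon_locally_finite)
  have U: "openin (arr_top H) {h \<in> arrows H. rng H h \<noteq> v}" for v
  proof -
    have "{h \<in> arrows H. rng H h \<noteq> v} = arrows H - {h \<in> arrows H. rng H h = v}" by auto
    then show ?thesis
      using openin_diff[OF openin_topspace closedin_fibre[OF H.haus H.continuous_rng, of v]] by simp
  qed
  have null: "emeasure (\<mu> v) {h \<in> arrows H. rng H h \<noteq> v} = 0" if v: "v \<in> units H" for v
    by (rule H.radon_null_open[OF \<mu>(1)[OF v] U]) (use \<mu>(2)[OF v] total_local[OF v] in auto)
  have "fibre_system (arr_top H) (unit_space H) (rng H) \<mu>"
  proof unfold_locales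
    show "Hausdorff_space (unit_space H)" using H.lch_unit_space by (simp add: lch_space_def)
    show "continuous_map (arr_top H) (unit_space H) (rng H)" by (rule H.continuous_rng_unit)
    show "locally_finite_borel (arr_top H) (\<mu> v)" if "v \<in> topspace (unit_space H)" for v
      using that lfb by simp
    show "AE h in \<mu> v. rng H h = v" if "v \<in> topspace (unit_space H)" for v
      using null[of v] U lfb_open[OF lfb[of v] U] lfb_space[OF lfb[of v]] that
      by (intro AE_I'[of "{h \<in> arrows H. rng H h \<noteq> v}"]) (auto simp: null_sets_def)
    show "continuous_map (unit_space H) euclideanreal (\<lambda>v. integral\<^sup>L (\<mu> v) f)" if "f \<in> Cc_real (arr_top H)" for f
      by (rule continuous_map_eq[OF total_continuous[OF that]]) (simp add: \<mu>(2) that)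
  qed
  then interpret m: fibre_system "arr_top H" "unit_space H" "rng H" \<mu> .
  have inv: "m.fint (src H x) (\<lambda>y. f (mul H x y)) = integral\<^sup>L (\<mu> (rng H x)) f"
    and fCc: "m.fibre_Cc (src H x) (\<lambda>y. f (mul H x y))"
    if x: "x \<in> arrows H" and f: "f \<in> Cc_real (arr_top H)" for x f
  proof -
    show fCc: "m.fibre_Cc (src H x) (\<lambda>y. f (mul H x y))"
      using H.translate_Cc[OF x f] by (simp add: m.fibre_Cc_def m.fibre_def)
    \<comment> \<open>The translate of f lives on one range fibre; it is extended to all arrows so
      that \<open>total\<close> can be evaluated on it.\<close>
    obtain \<phi> where \<phi>: "\<phi> \<in> Cc_real (arr_top H)" "\<And>y. y \<in> m.fibre (src H x) \<Longrightarrow> \<phi> y = f (mul H x y)"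
      using fCc by (rule m.fibre_Cc_extend) blast
    have "m.fint (src H x) (\<lambda>y. f (mul H x y)) = integral\<^sup>L (\<mu> (src H x)) \<phi>"
      using x by (intro m.fint_Cc \<phi>) auto
    also have "\<dots> = total (rng H x) f"
      using \<mu>(2)[OF H.src_units[OF x] \<phi>(1)] total_translate[OF x f \<phi>(1)] \<phi>(2) by (simp add: m.fibre_def)
    finally show "m.fint (src H x) (\<lambda>y. f (mul H x y)) = integral\<^sup>L (\<mu> (rng H x)) f"
      using \<mu>(2)[OF H.rng_units[OF x] f] by simp
  qed
  have "haar_system H \<mu>"
    unfolding haar_system_def
  proof (intro conjI ballI)
    fix v assume v: "v \<in> units H"
    show "radon_measure (arr_top H) (\<mu> v)" by (rule \<mu>(1)[OF v])
    show "measure_support (arr_top H) (\<mu> v) = {h \<in> arrows H. rng H h = v}"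
    proof (intro equalityI subsetI)
      fix h assume h: "h \<in> measure_support (arr_top H) (\<mu> v)"
      then show "h \<in> {h \<in> arrows H. rng H h = v}"
        using U[of v] null[OF v] unfolding measure_support_def by force
    next
      fix h assume h: "h \<in> {h \<in> arrows H. rng H h = v}"
      have "emeasure (\<mu> v) W > 0" if W: "openin (arr_top H) W" "h \<in> W" for W
      proof -
        have "compactin (arr_top H) {h}" using h by simp
        then obtain f where f: "f \<in> Cc_real (arr_top H)" "\<And>x. x \<in> arrows H \<Longrightarrow> 0 \<le> f x \<and> f x \<le> 1"
          "\<And>x. x \<in> {h} \<Longrightarrow> f x = 1" "\<And>x. x \<in> arrows H \<Longrightarrow> x \<notin> W \<Longrightarrow> f x = 0"
          using H.urysohn_Cc[OF _ W(1), of "{h}"] W(2) by auto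
        have "0 < integral\<^sup>L (\<mu> v) f"
          using total_pos[OF f(1), of h] f(2,3) h \<mu>(2)[OF v f(1)] by auto
        moreover have "integral\<^sup>L (\<mu> v) f = 0" if "emeasure (\<mu> v) W = 0"
        proof (rule integral_eq_zero_AE, rule AE_I'[of W])
          show "W \<in> null_sets (\<mu> v)" using that lfb_open[OF lfb[OF v] W(1)] by (simp add: null_sets_def)
          show "{x \<in> space (\<mu> v). f x \<noteq> 0} \<subseteq> W" using f(4) lfb_space[OF lfb[OF v]] by auto
        qed
        ultimately show ?thesis by (metis less_irrefl not_gr_zero)
      qed
      then show "h \<in> measure_support (arr_top H) (\<mu> v)" using h by (simp add: measure_support_def)
    qed
  next
    fix f assume "f \<in> Cc (arr_top H)"
    note f = Cc_imp_Cc_real[OF this]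
    have eq: "(LINT x|\<mu> v. f x) = Complex (LINT x|\<mu> v. Re (f x)) (LINT x|\<mu> v. Im (f x))" if "v \<in> units H" for v
      by (rule integral_complex_eq[OF H.lfb_Cc_integrable[OF lfb[OF that] f(1)] H.lfb_Cc_integrable[OF lfb[OF that] f(2)]])
    show "continuous_map (unit_space H) euclidean (\<lambda>v. LINT x|\<mu> v. f x)"
      by (rule continuous_map_eq[OF continuous_map_Complex[OF m.\<beta>_continuous[OF f(1)] m.\<beta>_continuous[OF f(2)]]])
        (simp add: eq)
    fix x assume x: "x \<in> arrows H"
    have u: "src H x \<in> topspace (unit_space H)" using x by simp
    have "(LINT y:m.fibre (src H x)|\<mu> (src H x). f (mul H x y)) =
        Complex (m.fint (src H x) (\<lambda>y. Re (f (mul H x y)))) (m.fint (src H x) (\<lambda>y. Im (f (mul H x y))))"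
      unfolding m.fint_def
      by (rule set_integral_complex_eq[OF m.fibre_Cc_integrable[OF u fCc[OF x f(1)]] m.fibre_Cc_integrable[OF u fCc[OF x f(2)]]])
    also have "\<dots> = (LINT y|\<mu> (rng H x). f y)"
      unfolding inv[OF x f(1)] inv[OF x f(2)] using eq[OF H.rng_units[OF x]] by simp
    finally show "(LINT y:{y \<in> arrows H. rng H y = src H x}|\<mu> (src H x). f (mul H x y)) = (LINT y|\<mu> (rng H x). f y)"
      by (simp add: m.fibre_def)
  qed
  then show ?thesis by blast
qed

end

theorem (in haar_equivalence) equivalent_haar_system_exists:
  assumes pr: "principal_groupoid G"
  shows "\<exists>\<mu>. haar_system H \<mu>"
proof -
  interpret U: lch_space "unit_space G" by (rule G.lch_unit_space)
  interpret open_fibration Z "unit_space G" \<rho>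
    by unfold_locales (use second_countable_Z[OF pr] cont_\<rho> open_\<rho> in auto)
  obtain \<beta> :: "nat \<Rightarrow> 'g \<Rightarrow> 'z measure" and K where
    \<beta>: "\<forall>n. fibre_system Z (unit_space G) \<rho> (\<beta> n) \<and> compactin Z (K n) \<and>
      (\<forall>u \<in> topspace (unit_space G). AE w in \<beta> n u. w \<in> K n) \<and>
      (\<forall>w U. openin Z U \<longrightarrow> w \<in> U \<longrightarrow> (\<exists>n. K n \<subseteq> U \<and> emeasure (\<beta> n (\<rho> w)) (K n) > 0))"
    using fibre_system_sequence[OF G.sc_unit_space] by (elim exE)
  interpret haar_transfer_sequence G \<nu> H Z \<rho> lact \<sigma> ract \<beta> K
  proof (rule haar_transfer_sequence.intro[OF haar_equivalence_axioms], rule haar_transfer_sequence_axioms.intro)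
    show "fibre_system Z (unit_space G) \<rho> (\<beta> n)" "compactin Z (K n)" for n
      using \<beta>[rule_format, of n] by blast+
    show "AE w in \<beta> n u. w \<in> K n" if "u \<in> units G" for n u
      using \<beta>[rule_format, of n] that by simp
    show "\<exists>n. K n \<subseteq> U \<and> emeasure (\<beta> n (\<rho> w)) (K n) > 0" if "openin Z U" "w \<in> U" for U w
      using \<beta>[rule_format, of 0, THEN conjunct2, THEN conjunct2, THEN conjunct2, rule_format, OF that] .
  qed
  obtain c where "\<And>n :: nat. 0 < c n" "\<And>f. f \<in> Cc_real (arr_top H) \<Longrightarrow> \<exists>M N. summable M \<and>
     (\<forall>n\<ge>N. \<forall>v \<in> units H. \<bar>c n * tr.J n f (section_map v)\<bar> \<le> M n)"
    using weights_exist by metis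
  then interpret haar_transfer_series G \<nu> H Z \<rho> lact \<sigma> ract \<beta> K c
    by unfold_locales
  show ?thesis by (rule haar_system_exists)
qed

section \<open>Integrability\<close>

lemma continuous_real_bounded_on_compact:
  fixes f :: "'a \<Rightarrow> real"
  assumes f: "continuous_map X euclideanreal f" and K: "compactin X K"
  obtains B where "0 \<le> B" "\<And>x. x \<in> K \<Longrightarrow> f x \<le> B"
proof -
  have "compact (f ` K)" using image_compactin[OF K f] by simp
  then obtain B where "\<And>x. x \<in> K \<Longrightarrow> \<bar>f x\<bar> \<le> B"
    by (metis bounded_real compact_imp_bounded image_eqI)
  then show thesis by (intro that[of "max 0 B"]) (fastforce simp: le_max_iff_disj)+
qed

lemma continuous_real_pos_on_compact:
  fixes f :: "'a \<Rightarrow> real"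
  assumes f: "continuous_map X euclideanreal f" and K: "compactin X K" and pos: "\<And>x. x \<in> K \<Longrightarrow> 0 < f x"
  obtains c where "0 < c" "\<And>x. x \<in> K \<Longrightarrow> c \<le> f x"
proof (cases "K = {}")
  case False
  have "compact (f ` K)" using image_compactin[OF K f] by simp
  then obtain s where "s \<in> f ` K" "\<forall>t \<in> f ` K. s \<le> t"
    using compact_attains_inf[of "f ` K"] False by auto
  then show thesis using pos by (intro that[of s]) auto
qed (auto intro: that[of 1])

lemma (in lch_groupoid) compact_mul:
  assumes "compactin (arr_top G) A" "compactin (arr_top G) B"
  shows "compactin (arr_top G) {mul G a b |a b. a \<in> A \<and> b \<in> B \<and> src G a = rng G b}"
  by (rule compact_image_equalizer[OF assms haus continuous_src continuous_rng])
    (rule continuous_mul[unfolded composable_space_def])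

context haar_groupoid
begin

lemma translate_integral:
  assumes x: "x \<in> arrows G" and f: "f \<in> Cc_real (arr_top G)"
  shows "fs.fibre_Cc (rng G x) (\<lambda>y. f (mul G (gpd_inv G x) y))"
    and "fs.fint (rng G x) (\<lambda>y. f (mul G (gpd_inv G x) y)) = integral\<^sup>L (\<nu> (src G x)) f"
proof -
  note ix = inv_closed[OF x] src_inv[OF x] rng_inv[OF x]
  show "fs.fibre_Cc (rng G x) (\<lambda>y. f (mul G (gpd_inv G x) y))"
    using translate_Cc[OF ix(1) f] by (simp add: fs.fibre_Cc_def fs.fibre_def ix)
  have "fs.fint (rng G x) (\<lambda>y. f (mul G (gpd_inv G x) y)) = fs.fint (src G x) f"
    using haar_invariant[OF ix(1), of f] fs.Cc_fibre_Cc[OF f refl] by (simp add: ix)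
  also have "\<dots> = integral\<^sup>L (\<nu> (src G x)) f"
    using x by (intro fs.fint_Cc f) auto
  finally show "fs.fint (rng G x) (\<lambda>y. f (mul G (gpd_inv G x) y)) = integral\<^sup>L (\<nu> (src G x)) f" .
qed

text \<open>Such a sum is used twice: bounded above by an indicator it counts translates, and
  dominating an indicator it estimates a measure.\<close>

lemma translates_sum:
  assumes u: "u \<in> units G" and F: "finite F" "\<And>x. x \<in> F \<Longrightarrow> x \<in> arrows G \<and> rng G x = u"
    and f: "f \<in> Cc_real (arr_top G)"
  shows "fs.fibre_Cc u (\<lambda>y. \<Sum>x\<in>F. f (mul G (gpd_inv G x) y)) \<and>
    fs.fint u (\<lambda>y. \<Sum>x\<in>F. f (mul G (gpd_inv G x) y)) = (\<Sum>x\<in>F. integral\<^sup>L (\<nu> (src G x)) f)"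
  using F
proof (induction F rule: finite_induct)
  case empty
  show ?case
    using fs.Cc_fibre_Cc[OF Cc_real_zero refl] fs.fint_scale[of u 0 "\<lambda>y. 0"] by simp
next
  case (insert x F)
  let ?f = "\<lambda>x y. f (mul G (gpd_inv G x) y)"
  have x: "x \<in> arrows G" "rng G x = u" using insert.prems by auto
  note t = translate_integral[OF x(1) f, unfolded x(2)]
  have IH: "fs.fibre_Cc u (\<lambda>y. \<Sum>x\<in>F. ?f x y)"
    "fs.fint u (\<lambda>y. \<Sum>x\<in>F. ?f x y) = (\<Sum>x\<in>F. integral\<^sup>L (\<nu> (src G x)) f)"
    using insert by auto
  obtain g where g: "g \<in> Cc_real (arr_top G)" "\<And>y. y \<in> fs.fibre u \<Longrightarrow> g y = ?f x y"
    using t(1) by (rule fs.fibre_Cc_extend) blast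
  obtain h where h: "h \<in> Cc_real (arr_top G)" "\<And>y. y \<in> fs.fibre u \<Longrightarrow> h y = (\<Sum>x\<in>F. ?f x y)"
    using IH(1) by (rule fs.fibre_Cc_extend) blast
  have "fs.fibre_Cc u (\<lambda>y. ?f x y + (\<Sum>x\<in>F. ?f x y))"
    by (rule fs.Cc_fibre_Cc[OF Cc_real_add[OF g(1) h(1)]]) (simp add: g(2) h(2))
  moreover have "fs.fint u (\<lambda>y. ?f x y + (\<Sum>x\<in>F. ?f x y)) = fs.fint u (?f x) + fs.fint u (\<lambda>y. \<Sum>x\<in>F. ?f x y)"
    using u by (intro fs.fint_add t(1) IH(1)) simp
  ultimately show ?case using insert.hyps t(2) IH(2) by simp
qed

lemma closed_src_preimage:
  assumes "compactin (unit_space G) N"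
  shows "closedin (arr_top G) {x \<in> arrows G. src G x \<in> N}"
  using assms compact_closed[OF compact_unit_space] continuous_src
  by (intro closedin_continuous_map_preimage[of "arr_top G" "arr_top G" "src G" N]) auto

text \<open>Integrability bounds the number of disjoint translates of a compact neighbourhood of \<open>N\<close>
  based at one unit; a maximal disjoint family yields a covering by translates of a slightly
  larger compact set.\<close>

lemma integrable_imp_uniform_cover:
  assumes int: "integrable_groupoid G \<nu>" and N: "compactin (unit_space G) N"
  obtains W k where "compactin (arr_top G) W"
    "\<And>u. u \<in> N \<Longrightarrow> \<exists>F. finite F \<and> card F \<le> k \<and> (\<forall>x \<in> F. x \<in> arrows G \<and> rng G x = u \<and> src G x \<in> N) \<and>
       (\<forall>x \<in> arrows G. rng G x = u \<and> src G x \<in> N \<longrightarrow>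
          (\<exists>x' \<in> F. \<exists>w \<in> W. src G x' = rng G w \<and> x = mul G x' w))"
proof -
  have NU: "N \<subseteq> units G" using compactin_subset_topspace[OF N] by simp
  obtain V C where VC: "openin (arr_top G) V" "compactin (arr_top G) C" "N \<subseteq> V" "V \<subseteq> C"
    using compact_neighbourhood[OF compact_unit_space[OF N] openin_topspace]
      compactin_subset_topspace[OF compact_unit_space[OF N]] by metis
  obtain f where f: "f \<in> Cc_real (arr_top G)" "\<And>x. x \<in> arrows G \<Longrightarrow> 0 \<le> f x \<and> f x \<le> 1"
    "\<And>x. x \<in> N \<Longrightarrow> f x = 1" "\<And>x. x \<in> arrows G \<Longrightarrow> x \<notin> V \<Longrightarrow> f x = 0"
    using urysohn_Cc[OF compact_unit_space[OF N] VC(1,3)] by blast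
  have CA: "C \<subseteq> arrows G" using compactin_subset_topspace[OF VC(2)] .
  have pos: "0 < integral\<^sup>L (\<nu> u) f" if u: "u \<in> N" for u
  proof -
    have uU: "u \<in> units G" "u \<in> arrows G" "rng G u = u" using u NU by (auto simp: units_iff)
    let ?U = "{x \<in> arrows G. f x \<in> {0<..}}"
    have U: "openin (arr_top G) ?U"
      using Cc_real_continuous[OF f(1)] by (rule openin_continuous_map_preimage) auto
    have "0 < fs.fint u f"
    proof (rule fs.fint_pos[of u f ?U])
      show "fs.fibre_Cc u f" by (rule fs.Cc_fibre_Cc[OF f(1) refl])
      show "?U \<in> sets (\<nu> u)" using lfb_open[OF fs.\<beta>_lfb U] uU(1) by simp
      show "0 < emeasure (\<nu> u) ?U" using haar_open_pos[OF U, of u u] uU f(3)[OF u] by simp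
    qed (use uU f(2) in \<open>auto simp: fibre_eq\<close>)
    then show ?thesis using fs.fint_Cc[OF _ f(1) refl, of u] uU(1) by simp
  qed
  \<comment> \<open>A lower bound for the mass of f over all units in N: it is positive at each
    unit, continuous, and N is compact.\<close>
  obtain c where c: "0 < c" "\<And>u. u \<in> N \<Longrightarrow> c \<le> integral\<^sup>L (\<nu> u) f"
    using continuous_real_pos_on_compact[OF fs.\<beta>_continuous[OF f(1)] N pos] by blast
  \<comment> \<open>All sources of a translate of C lie in the source image of C. Adding N puts the
    base units into the same compact set, to which integrability is applied.\<close>
  define N' where "N' = N \<union> src G ` C"
  have N': "compactin (unit_space G) N'"
    unfolding N'_def by (rule compactin_Un[OF N image_compactin[OF VC(2) continuous_src_unit]])
  let ?D = "{x \<in> arrows G. src G x \<in> N'}"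
  have "(SUP u \<in> N'. emeasure (\<nu> u) ?D) < \<infinity>"
    using int N' by (simp add: integrable_groupoid_def)
  then obtain b where b: "0 \<le> b" "(SUP u \<in> N'. emeasure (\<nu> u) ?D) = ennreal b"
    by (cases "SUP u \<in> N'. emeasure (\<nu> u) ?D") auto
  have bD: "emeasure (\<nu> u) ?D \<le> ennreal b" if "u \<in> N" for u
    unfolding b(2)[symmetric] using that by (intro SUP_upper) (simp add: N'_def)
  let ?T = "\<lambda>u. {x \<in> arrows G. rng G x = u \<and> src G x \<in> N}"
  \<comment> \<open>The translates x C and x' C have an arrow in common.\<close>
  define meet where "meet x x' \<longleftrightarrow> (\<exists>y \<in> arrows G. rng G y = rng G x \<and> rng G y = rng G x' \<and>
     mul G (gpd_inv G x) y \<in> C \<and> mul G (gpd_inv G x') y \<in> C)" for x x'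
  define packing where "packing u F \<longleftrightarrow> finite F \<and> F \<subseteq> ?T u \<and>
    (\<forall>x \<in> F. \<forall>x' \<in> F. x \<noteq> x' \<longrightarrow> \<not> meet x x')" for u F
  \<comment> \<open>Disjoint translates carry mass at least c each, inside a set of measure at most
    b.\<close>
  define k where "k = nat \<lfloor>b / c\<rfloor>"
  have bound: "card F \<le> k" if u: "u \<in> N" and P: "packing u F" for u F
  proof -
    have uU: "u \<in> units G" using u NU by blast
    have F: "finite F" "\<And>x. x \<in> F \<Longrightarrow> x \<in> arrows G \<and> rng G x = u \<and> src G x \<in> N"
      using P by (auto simp: packing_def)
    have disj: "\<not> meet x x'" if "x \<in> F" "x' \<in> F" "x \<noteq> x'" for x x'
      using P that unfolding packing_def by blast
    let ?S = "\<lambda>y. \<Sum>x\<in>F. f (mul G (gpd_inv G x) y)"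
    have S: "fs.fibre_Cc u ?S" "fs.fint u ?S = (\<Sum>x\<in>F. integral\<^sup>L (\<nu> (src G x)) f)"
      using translates_sum[OF uU F(1) _ f(1)] F(2) by auto
    \<comment> \<open>By disjointness at most one summand is nonzero at y.\<close>
    have SD: "?S y \<le> indicator ?D y" if y: "y \<in> arrows G" "rng G y = u" for y
    proof (cases "\<exists>x0 \<in> F. mul G (gpd_inv G x0) y \<in> C")
      case True
      then obtain x0 where x0: "x0 \<in> F" "mul G (gpd_inv G x0) y \<in> C" by blast
      have "f (mul G (gpd_inv G x) y) = 0" if x: "x \<in> F" "x \<noteq> x0" for x
      proof (rule f(4))
        show "mul G (gpd_inv G x) y \<in> arrows G"
          using F(2)[OF x(1)] y by (simp add: mul_closed inv_closed src_inv)
        show "mul G (gpd_inv G x) y \<notin> V"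
          using disj[OF x(1) x0(1) x(2)] x0(2) y F(2)[OF x(1)] F(2)[OF x0(1)] VC(4)
          unfolding meet_def by auto
      qed
      then have "(\<Sum>x\<in>F - {x0}. f (mul G (gpd_inv G x) y)) = 0" by (intro sum.neutral) auto
      then have "?S y = f (mul G (gpd_inv G x0) y)"
        using sum.remove[OF F(1) x0(1), of "\<lambda>x. f (mul G (gpd_inv G x) y)"] by simp
      also have "\<dots> \<le> 1" using f(2) x0(2) CA by blast
      also have "src G (mul G (gpd_inv G x0) y) = src G y"
        using F(2)[OF x0(1)] y by (simp add: src_mul inv_closed src_inv)
      then have "src G y \<in> N'" unfolding N'_def using x0(2) by (metis UnI2 imageI)
      then have "(1 :: real) = indicator ?D y" using y by simp
      finally show ?thesis .
    next
      case False
      have "f (mul G (gpd_inv G x) y) = 0" if x: "x \<in> F" for x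
      proof (rule f(4))
        show "mul G (gpd_inv G x) y \<in> arrows G"
          using F(2)[OF x] y by (simp add: mul_closed inv_closed src_inv)
        show "mul G (gpd_inv G x) y \<notin> V" using False x VC(4) by blast
      qed
      then show ?thesis by simp
    qed
    have Dm: "?D \<in> sets (\<nu> u)"
      using lfb_closed[OF fs.\<beta>_lfb closed_src_preimage[OF N']] uU by simp
    have "real (card F) * c \<le> (\<Sum>x\<in>F. integral\<^sup>L (\<nu> (src G x)) f)"
      using c(2) F(2) by (intro sum_bounded_below) auto
    also have "\<dots> = fs.fint u ?S" by (rule S(2)[symmetric])
    also have "\<dots> \<le> integral\<^sup>L (\<nu> u) (indicator ?D)"
      unfolding fs.fint_def set_lebesgue_integral_def
    proof (rule integral_mono)
      show "integrable (\<nu> u) (\<lambda>y. indicator (fs.fibre u) y *\<^sub>R ?S y)"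
        using fs.fibre_Cc_integrable[OF _ S(1)] uU by (simp add: set_integrable_def)
      show "integrable (\<nu> u) (indicator ?D :: _ \<Rightarrow> real)"
        using Dm bD[OF u] by (intro integrable_real_indicator) (auto simp: le_less_trans)
      show "indicator (fs.fibre u) y *\<^sub>R ?S y \<le> indicator ?D y" for y
        using SD[of y] by (auto simp: indicator_def fibre_eq)
    qed
    also have "\<dots> = measure (\<nu> u) ?D"
      using Dm sets.sets_into_space[OF Dm] by (simp add: Int_absorb2 Int_absorb1)
    also have "\<dots> \<le> b"
      using bD[OF u] b(1) by (simp add: measure_def enn2real_leI)
    finally have "real (card F) \<le> b / c" using c(1) by (simp add: field_simps)
    then show ?thesis unfolding k_def using le_nat_floor by blast
  qed
  \<comment> \<open>If y lies in both x' C and x C, then x = x' (x'^-1 y) (x^-1 y)^-1, so the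
    quotient belongs to C C^-1.\<close>
  define W where "W = {mul G a a' |a a'. a \<in> C \<and> a' \<in> gpd_inv G ` C \<and> src G a = rng G a'}"
  have W: "compactin (arr_top G) W"
    unfolding W_def by (rule compact_mul[OF VC(2) image_compactin[OF VC(2) continuous_inv]])
  show thesis
  proof (rule that[OF W, of k])
    fix u assume u: "u \<in> N"
    have "packing u {}" by (simp add: packing_def)
    moreover have "\<forall>F. packing u F \<longrightarrow> card F < Suc k" using bound[OF u] by (simp add: less_Suc_eq_le)
    ultimately obtain F where F: "packing u F" "\<And>F'. packing u F' \<Longrightarrow> card F' \<le> card F"
      using ex_has_greatest_nat[of "packing u" "{}" card "Suc k"] by (metis less_imp_le)
    have FT: "finite F" "F \<subseteq> ?T u" using F(1) by (auto simp: packing_def)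
    have "\<exists>x' \<in> F. \<exists>w \<in> W. src G x' = rng G w \<and> x = mul G x' w"
      if x: "x \<in> arrows G" "rng G x = u" "src G x \<in> N" for x
    proof -
      have "\<exists>x' \<in> F. meet x' x"
      proof (cases "x \<in> F")
        case True
        have "mul G (gpd_inv G x) x \<in> C" using inv_mul[OF x(1)] x(3) VC by auto
        then have "meet x x" unfolding meet_def using x by blast
        then show ?thesis using True by blast
      next
        case False
        \<comment> \<open>F has maximal size, so adding x spoils the packing, and the pair that
          meets must involve x.\<close>
        then have "\<not> packing u (insert x F)" using F(2)[of "insert x F"] FT(1) by auto
        moreover have "finite (insert x F)" "insert x F \<subseteq> ?T u" using x FT by auto
        ultimately obtain x1 x2 where xx: "x1 \<in> insert x F" "x2 \<in> insert x F" "x1 \<noteq> x2" "meet x1 x2"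
          unfolding packing_def by blast
        have "\<not> (x1 \<in> F \<and> x2 \<in> F)" using F(1) xx(3,4) unfolding packing_def by blast
        then consider "x1 = x" "x2 \<in> F" | "x2 = x" "x1 \<in> F" using xx(1-3) by blast
        then show ?thesis
        proof cases
          case 1
          then have "meet x2 x" using xx(4) unfolding meet_def by blast
          then show ?thesis using 1 by blast
        next
          case 2
          then show ?thesis using xx(4) by blast
        qed
      qed
      then obtain x' y where y: "x' \<in> F" "y \<in> arrows G" "rng G y = rng G x'" "rng G y = rng G x"
        "mul G (gpd_inv G x') y \<in> C" "mul G (gpd_inv G x) y \<in> C"
        unfolding meet_def by blast
      have x': "x' \<in> arrows G" using y(1) FT by blast
      let ?a = "mul G (gpd_inv G x') y" and ?a' = "mul G (gpd_inv G x) y"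
      note ix = inv_closed[OF x(1)] src_inv[OF x(1)] rng_inv[OF x(1)]
      note ix' = inv_closed[OF x'] src_inv[OF x'] rng_inv[OF x']
      have a: "?a \<in> arrows G" "src G ?a = src G y" "rng G ?a = src G x'"
        using ix' y(2,3) by (simp_all add: mul_closed src_mul rng_mul)
      have a': "?a' \<in> arrows G" "src G ?a' = src G y" "rng G ?a' = src G x"
        using ix y(2,4) by (simp_all add: mul_closed src_mul rng_mul)
      note ia' = inv_closed[OF a'(1)] src_inv[OF a'(1)] rng_inv[OF a'(1)]
      have comp: "src G ?a = rng G (gpd_inv G ?a')" using a(2) a'(2) ia'(3) by simp
      have w: "mul G ?a (gpd_inv G ?a') \<in> W"
        unfolding W_def using y(5) imageI[OF y(6), of "gpd_inv G"] comp by blast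
      have rw: "rng G (mul G ?a (gpd_inv G ?a')) = src G x'"
        using rng_mul[OF a(1) ia'(1) comp] a(3) by simp
      have "mul G x' (mul G ?a (gpd_inv G ?a')) = mul G (mul G x' ?a) (gpd_inv G ?a')"
        using mul_assoc[OF x' a(1) ia'(1)] a a' ia' by simp
      also have "mul G x' ?a = y" using mul_inv_cancel[OF x' y(2)] y(3) by simp
      also have "mul G y (gpd_inv G ?a') = mul G (mul G x ?a') (gpd_inv G ?a')"
        using mul_inv_cancel[OF x(1) y(2)] y(4) by simp
      also have "\<dots> = mul G x (mul G ?a' (gpd_inv G ?a'))"
        using mul_assoc[OF x(1) a'(1) ia'(1)] a' ia' by simp
      also have "\<dots> = x" using mul_inv[OF a'(1)] a'(3) src_right_unit[OF x(1)] by simp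
      finally show ?thesis using w rw y(1) by metis
    qed
    then show "\<exists>F. finite F \<and> card F \<le> k \<and> (\<forall>x \<in> F. x \<in> arrows G \<and> rng G x = u \<and> src G x \<in> N) \<and>
       (\<forall>x \<in> arrows G. rng G x = u \<and> src G x \<in> N \<longrightarrow>
          (\<exists>x' \<in> F. \<exists>w \<in> W. src G x' = rng G w \<and> x = mul G x' w))"
      using FT bound[OF u F(1)] by (intro exI[of _ F]) blast
  qed
qed

end

context equivalence
begin

lemma compact_lact:
  assumes "compactin (arr_top G) W" "compactin Z K"
  shows "compactin Z {lact x p |x p. x \<in> W \<and> p \<in> K \<and> src G x = \<rho> p}"
  by (rule compact_image_equalizer[OF assms G.haus])
    (use cont_\<rho> G.continuous_src cont_lact in
      \<open>auto simp: unit_space_def left_fibre_product_def dest: continuous_map_into_fulltopology\<close>)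

lemma compact_transporter:
  assumes "compactin Z K"
  shows "compactin (arr_top H) {transporter z w |z w. z \<in> K \<and> w \<in> K \<and> \<rho> z = \<rho> w}"
  using G.lch_unit_space
  by (intro compact_image_equalizer[OF assms assms _ cont_\<rho> cont_\<rho> continuous_transporter]) (simp add: lch_space_def)

text \<open>As \<sigma> is open, images of compact neighbourhoods contain open sets, and finitely
  many of these cover N.\<close>

lemma compact_lift_\<sigma>:
  assumes N: "compactin (unit_space H) N"
  obtains K where "compactin Z K" "N \<subseteq> \<sigma> ` K"
proof -
  have "\<forall>z \<in> topspace Z. \<exists>U C. openin Z U \<and> compactin Z C \<and> z \<in> U \<and> U \<subseteq> C"
    using Z.lc by (simp add: locally_compact_space_def)
  then obtain U C where UC: "\<And>z. z \<in> topspace Z \<Longrightarrow> openin Z (U z)" "\<And>z. z \<in> topspace Z \<Longrightarrow> compactin Z (C z)"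
    "\<And>z. z \<in> topspace Z \<Longrightarrow> z \<in> U z" "\<And>z. z \<in> topspace Z \<Longrightarrow> U z \<subseteq> C z"
    by metis
  have "\<forall>V \<in> (\<lambda>z. \<sigma> ` U z) ` topspace Z. openin (unit_space H) V"
    using UC(1) open_\<sigma> by (auto simp: open_map_def)
  moreover have "N \<subseteq> \<Union>((\<lambda>z. \<sigma> ` U z) ` topspace Z)"
  proof
    fix v assume "v \<in> N"
    then have "v \<in> \<sigma> ` topspace Z" using compactin_subset_topspace[OF N] \<sigma>_surj by auto
    then obtain z where "z \<in> topspace Z" "v = \<sigma> z" by blast
    then show "v \<in> \<Union>((\<lambda>z. \<sigma> ` U z) ` topspace Z)" using UC(3) by blast
  qed
  ultimately obtain \<F> where "finite \<F>" "\<F> \<subseteq> (\<lambda>z. \<sigma> ` U z) ` topspace Z" "N \<subseteq> \<Union>\<F>"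
    using N unfolding compactin_def by meson
  then obtain D where D: "finite D" "D \<subseteq> topspace Z" "N \<subseteq> (\<Union>z\<in>D. \<sigma> ` U z)"
    by (metis finite_subset_image)
  show thesis
  proof (rule that[of "\<Union>z\<in>D. C z"])
    show "compactin Z (\<Union>z\<in>D. C z)" using D(1,2) UC(2) by (intro compactin_Union) auto
    show "N \<subseteq> \<sigma> ` (\<Union>z\<in>D. C z)" using D(2,3) UC(4) by blast
  qed
qed

end

text \<open>If \<open>x h = \<gamma> y\<close> and \<open>x h' = \<gamma> y'\<close> with \<open>y, y'\<close> in a compact set, then the quotient of
  \<open>h\<close> and \<open>h'\<close> is \<open>transporter y y'\<close>; so a uniform covering of the arrows of \<open>G\<close> yields one for \<open>H\<close>.\<close>

theorem (in haar_equivalence) integrable_transfer: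
  assumes int: "integrable_groupoid G \<nu>" and \<mu>: "haar_system H \<mu>"
  shows "integrable_groupoid H \<mu>"
  unfolding integrable_groupoid_def
proof (intro allI impI)
  interpret Hm: haar_groupoid H \<mu> by unfold_locales (rule \<mu>)
  fix N assume N: "compactin (unit_space H) N"
  have NU: "N \<subseteq> units H" using compactin_subset_topspace[OF N] by simp
  obtain K where K: "compactin Z K" "N \<subseteq> \<sigma> ` K" using compact_lift_\<sigma>[OF N] .
  have KZ: "K \<subseteq> topspace Z" using compactin_subset_topspace[OF K(1)] .
  have "compactin (unit_space G) (\<rho> ` K)" by (rule image_compactin[OF K(1) cont_\<rho>])
  then obtain W k where W: "compactin (arr_top G) W"
    and cover: "\<And>u. u \<in> \<rho> ` K \<Longrightarrow> \<exists>F. finite F \<and> card F \<le> k \<and>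
       (\<forall>x \<in> F. x \<in> arrows G \<and> rng G x = u \<and> src G x \<in> \<rho> ` K) \<and>
       (\<forall>x \<in> arrows G. rng G x = u \<and> src G x \<in> \<rho> ` K \<longrightarrow>
          (\<exists>x' \<in> F. \<exists>w \<in> W. src G x' = rng G w \<and> x = mul G x' w))"
    by (rule G.integrable_imp_uniform_cover[OF int]) (rule that)
  have WA: "W \<subseteq> arrows G" using compactin_subset_topspace[OF W] .
  \<comment> \<open>The covering of the arrows of \<open>G\<close> leaves a factor w in W; letting
    it act on K absorbs it into a larger compact set.\<close>
  define K' where "K' = {lact x p |x p. x \<in> W \<and> p \<in> K \<and> src G x = \<rho> p}"
  have K': "compactin Z K'" unfolding K'_def by (rule compact_lact[OF W K(1)])
  define W' where "W' = {transporter z w |z w. z \<in> K' \<and> w \<in> K' \<and> \<rho> z = \<rho> w}"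
  have W': "compactin (arr_top H) W'" unfolding W'_def by (rule compact_transporter[OF K'])
  obtain f where f: "f \<in> Cc_real (arr_top H)" "\<And>x. x \<in> arrows H \<Longrightarrow> 0 \<le> f x \<and> f x \<le> 1"
    "\<And>x. x \<in> W' \<Longrightarrow> f x = 1"
    using H.urysohn_Cc[OF W' openin_topspace compactin_subset_topspace[OF W']] by metis
  \<comment> \<open>On the side of \<open>H\<close> the mass of f over N is bounded from above, in
    contrast to the lower bound used for \<open>G\<close>.\<close>
  obtain B where B: "0 \<le> B" "\<And>v. v \<in> N \<Longrightarrow> integral\<^sup>L (\<mu> v) f \<le> B"
    using continuous_real_bounded_on_compact[OF Hm.fs.\<beta>_continuous[OF f(1)] N] by blast
  let ?D = "{h \<in> arrows H. src H h \<in> N}"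
  have "emeasure (\<mu> v) ?D \<le> ennreal (k * B)" if v: "v \<in> N" for v
  proof -
    have vU: "v \<in> units H" using v NU by blast
    obtain x where x: "x \<in> K" "\<sigma> x = v" using v K(2) by blast
    have xZ: "x \<in> topspace Z" using x KZ by blast
    obtain F where F: "finite F" "card F \<le> k" "\<And>g. g \<in> F \<Longrightarrow> g \<in> arrows G \<and> rng G g = \<rho> x \<and> src G g \<in> \<rho> ` K"
      "\<And>g. g \<in> arrows G \<Longrightarrow> rng G g = \<rho> x \<Longrightarrow> src G g \<in> \<rho> ` K \<Longrightarrow>
         \<exists>g' \<in> F. \<exists>w \<in> W. src G g' = rng G w \<and> g = mul G g' w"
      using cover[of "\<rho> x"] x(1) by blast
    \<comment> \<open>h is attached to the member g of the covering when x h lies in g K'.\<close>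
    define near where "near g h \<longleftrightarrow> h \<in> arrows H \<and> rng H h = v \<and> src H h \<in> N \<and>
      (\<exists>a \<in> K'. \<rho> a = src G g \<and> ract x h = lact g a)" for g h
    have near_ex: "\<exists>g \<in> F. near g h" if h: "h \<in> arrows H" "rng H h = v" "src H h \<in> N" for h
    proof -
      have "src H h \<in> \<sigma> ` K" by (rule subsetD[OF K(2) h(3)])
      then obtain y where y: "src H h = \<sigma> y" "y \<in> K" by (rule imageE)
      have yZ: "y \<in> topspace Z" using y KZ by blast
      have xh: "ract x h \<in> topspace Z" "\<sigma> (ract x h) = src H h" "\<rho> (ract x h) = \<rho> x"
        using xZ x(2) h by simp_all
      have "\<sigma> y = \<sigma> (ract x h)" using y(1) xh(2) by simp
      then obtain g where g: "g \<in> arrows G" "src G g = \<rho> y" "lact g y = ract x h"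
        using left_transitive[OF yZ xh(1)] by blast
      have "rng G g = \<rho> x" using \<rho>_lact[OF g(1) yZ g(2)] g(3) xh(3) by simp
      then obtain g' w where gw: "g' \<in> F" "w \<in> W" "src G g' = rng G w" "g = mul G g' w"
        using F(4)[OF g(1)] g(2) y(2) by blast
      have A: "g' \<in> arrows G" "w \<in> arrows G" using F(3)[OF gw(1)] gw(2) WA by auto
      have sw: "src G w = \<rho> y" using g(2) gw(4) G.src_mul[OF A gw(3)] by simp
      have "lact w y \<in> K'" unfolding K'_def using gw(2) y(2) sw by blast
      moreover have "\<rho> (lact w y) = src G g'" using \<rho>_lact[OF A(2) yZ sw] gw(3) by simp
      moreover have "ract x h = lact g' (lact w y)"
        using lact_lact[OF A yZ gw(3) sw] g(3) gw(4) by simp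
      ultimately have "near g' h" unfolding near_def using h by blast
      then show ?thesis using gw(1) by blast
    qed
    define F' where "F' = {g \<in> F. \<exists>h. near g h}"
    \<comment> \<open>One arrow of \<open>H\<close> is kept for each g to which any is attached;
      these at most k arrows are the base points of the translates in \<open>H\<close>.\<close>
    define pick where "pick g = (SOME h. near g h)" for g
    have pick: "near g (pick g)" if "g \<in> F'" for g
      using that someI_ex[of "near g"] by (simp add: F'_def pick_def)
    define E where "E = pick ` F'"
    have E: "finite E" "card E \<le> k" "\<And>h. h \<in> E \<Longrightarrow> h \<in> arrows H \<and> rng H h = v \<and> src H h \<in> N"
    proof -
      show "finite E" unfolding E_def F'_def using F(1) by simp
      have "card E \<le> card F'" unfolding E_def F'_def using F(1) by (intro card_image_le) simp
      also have "\<dots> \<le> card F" unfolding F'_def using F(1) by (intro card_mono) auto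
      finally show "card E \<le> k" using F(2) by simp
      show "h \<in> arrows H \<and> rng H h = v \<and> src H h \<in> N" if "h \<in> E" for h
        using that pick by (auto simp: E_def near_def)
    qed
    let ?S = "\<lambda>y. \<Sum>h\<in>E. f (mul H (gpd_inv H h) y)"
    have S: "Hm.fs.fibre_Cc v ?S" "Hm.fs.fint v ?S = (\<Sum>h\<in>E. integral\<^sup>L (\<mu> (src H h)) f)"
      using Hm.translates_sum[OF vU E(1) _ f(1)] E(3) by auto
    have term_nonneg: "0 \<le> f (mul H (gpd_inv H h) y)" if "h \<in> E" "y \<in> arrows H" "rng H y = v" for h y
      using f(2)[of "mul H (gpd_inv H h) y"] E(3)[OF that(1)] that(2,3)
      by (simp add: H.mul_closed H.inv_closed H.src_inv)
    \<comment> \<open>The summand at the arrow picked for the same g equals 1 because f is 1 on W';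
      the others are nonnegative.\<close>
    have S1: "1 \<le> ?S h" if h: "h \<in> arrows H" "rng H h = v" "src H h \<in> N" for h
    proof -
      obtain g where g: "g \<in> F" "near g h" using near_ex[OF h] by blast
      then have gF': "g \<in> F'" by (auto simp: F'_def)
      let ?h = "pick g"
      have hE: "?h \<in> E" using gF' by (simp add: E_def)
      note e = E(3)[OF hE]
      obtain a a' where a: "a \<in> K'" "\<rho> a = src G g" "ract x h = lact g a"
        and a': "a' \<in> K'" "\<rho> a' = src G g" "ract x ?h = lact g a'"
        using g(2) pick[OF gF'] unfolding near_def by blast
      have aZ: "a \<in> topspace Z" "a' \<in> topspace Z" using a(1) a'(1) compactin_subset_topspace[OF K'] by auto
      have gA: "g \<in> arrows G" using F(3)[OF g(1)] by simp
      have ih: "gpd_inv H ?h \<in> arrows H" "src H (gpd_inv H ?h) = v" "rng H (gpd_inv H ?h) = src H ?h"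
        using e by (simp_all add: H.inv_closed H.src_inv H.rng_inv)
      have xh: "ract x ?h \<in> topspace Z" "\<sigma> (ract x ?h) = src H ?h" using xZ x(2) e by auto
      let ?m = "mul H (gpd_inv H ?h) h"
      have m: "?m \<in> arrows H" "rng H ?m = src H ?h" using ih h by (simp_all add: H.mul_closed H.rng_mul)
      have "ract (ract x ?h) ?m = ract x (mul H ?h ?m)"
        using ract_ract[OF xZ _ m(1)] e m x(2) by simp
      also have "\<dots> = ract x h" using H.mul_inv_cancel[of ?h h] e h by simp
      finally have "transporter (ract x ?h) (ract x h) = ?m"
        using transporter_eq[OF xh(1) m(1)] m(2) xh(2) by simp
      moreover have \<rho>a: "\<rho> a' = \<rho> a" using a(2) a'(2) by metis
      have "transporter (lact g a') (lact g a) = transporter a' a"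
        by (rule transporter_lact[OF aZ(2,1) \<rho>a gA a'(2)[symmetric]])
      ultimately have "?m = transporter a' a" using a(3) a'(3) by metis
      moreover have "transporter a' a \<in> W'" unfolding W'_def using a(1) a'(1) \<rho>a by blast
      ultimately have "?m \<in> W'" by simp
      then have "1 = f (mul H (gpd_inv H ?h) h)" using f(3) by simp
      also have "\<dots> \<le> ?S h" using term_nonneg h(1,2) by (intro member_le_sum[OF hE _ E(1)]) auto
      finally show ?thesis .
    qed
    have Dm: "?D \<in> sets (\<mu> v)"
      using lfb_closed[OF Hm.fs.\<beta>_lfb Hm.closed_src_preimage[OF N]] vU by simp
    have i: "integrable (\<mu> v) (\<lambda>y. indicator (Hm.fs.fibre v) y *\<^sub>R ?S y)"
      using Hm.fs.fibre_Cc_integrable[OF _ S(1)] vU by (simp add: set_integrable_def)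
    have nn: "0 \<le> indicator (Hm.fs.fibre v) y *\<^sub>R ?S y" for y
      using term_nonneg by (auto simp: indicator_def Hm.fibre_eq intro!: sum_nonneg)
    have "emeasure (\<mu> v) ?D = (\<integral>\<^sup>+y. indicator ?D y \<partial>\<mu> v)" using Dm by simp
    also have "\<dots> \<le> (\<integral>\<^sup>+y. ennreal (indicator (Hm.fs.fibre v) y *\<^sub>R ?S y) \<partial>\<mu> v)"
    proof (rule nn_integral_mono_AE)
      show "AE y in \<mu> v. indicator ?D y \<le> ennreal (indicator (Hm.fs.fibre v) y *\<^sub>R ?S y)"
        using Hm.haar_fibre[OF vU]
      proof eventually_elim
        case (elim y)
        then show ?case using S1[of y] by (auto simp: indicator_def Hm.fibre_eq)
      qed
    qed
    also have "\<dots> = ennreal (Hm.fs.fint v ?S)"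
      unfolding Hm.fs.fint_def set_lebesgue_integral_def using nn by (intro nn_integral_eq_integral i) auto
    also have "\<dots> \<le> ennreal (k * B)"
    proof (rule ennreal_leI)
      have "(\<Sum>h\<in>E. integral\<^sup>L (\<mu> (src H h)) f) \<le> card E * B"
        using B(2) E(3) by (intro sum_bounded_above) auto
      also have "\<dots> \<le> k * B" using E(2) B(1) by (intro mult_right_mono) auto
      finally show "Hm.fs.fint v ?S \<le> k * B" unfolding S(2) .
    qed
    finally show ?thesis .
  qed
  then have "(SUP v \<in> N. emeasure (\<mu> v) ?D) \<le> ennreal (k * B)" by (rule SUP_least)
  then show "(SUP v \<in> N. emeasure (\<mu> v) ?D) < \<infinity>"
    by (simp add: le_less_trans)
qed

theorem proposition5p2:
  fixes G :: "'g groupoid" and H :: "'h groupoid" and Z :: "'z topology"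
    and \<rho> :: "'z \<Rightarrow> 'g" and lact :: "'g \<Rightarrow> 'z \<Rightarrow> 'z"
    and \<sigma> :: "'z \<Rightarrow> 'h" and ract :: "'z \<Rightarrow> 'h \<Rightarrow> 'z"
    and \<nu> :: "'g \<Rightarrow> 'g measure"
  assumes "topological_groupoid G"
    and "second_countable (arr_top G)"
    and "locally_compact_space (arr_top G)"
    and "Hausdorff_space (arr_top G)"
    and "principal_groupoid G"
    and "haar_system G \<nu>"
    and "topological_groupoid H"
    and "second_countable (arr_top H)"
    and "locally_compact_space (arr_top H)"
    and "Hausdorff_space (arr_top H)"
    and "groupoid_equivalence G H Z \<rho> lact \<sigma> ract"
    and "integrable_groupoid G \<nu>"
  shows "(\<exists>\<mu>. haar_system H \<mu>) \<and> (\<forall>\<mu>. haar_system H \<mu> \<longrightarrow> integrable_groupoid H \<mu>)"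
proof -
  have "locally_compact_space Z" "Hausdorff_space Z"
    using assms(11) by (simp_all add: groupoid_equivalence_def)
  then interpret haar_equivalence G \<nu> H Z \<rho> lact \<sigma> ract
    using assms
    by (simp add: haar_equivalence_def equivalence_def equivalence_axioms_def haar_groupoid_def
        haar_groupoid_axioms_def lch_groupoid_def lch_groupoid_axioms_def lch_space_def)
  show ?thesis
    using equivalent_haar_system_exists[OF assms(5)] integrable_transfer[OF assms(12)] by blast
qed

end
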